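(* Let $\boldsymbol{X}=(X_t)_{t\in T}$ be a continuous max-id process with vertex $\boldsymbol 0$ and exponent measure $\mu$, let $t_1,\ldots,t_d\in T$, and let $J_0$, $\tilde\mu$, $\tilde{\boldsymbol X}$ be as defined in the context. Suppose that Algorithm 1 is executed in the top-down fashion described in the context. Then the expected number of simulated functions during the execution of Algorithm 1 is given by $$d-|J_0|+\mu\big(\{f\in C_0(T): f(t_j)>0\text{ for some }j\in J_0\}\big)+\sum_{i\in\{1,\ldots,d\}\setminus J_0}\mathbb E\Big[\tilde\mu\big(\{f\in C_0(T): f(t_i)\in[\tilde X_{t_i},\infty)\}\big)\Big].$$ Moreover, when $(\tilde X_{t_i})_{i\notin J_0}$ has continuous marginal distributions, the expected number of simulated functions during the execution of Algorithm 1 (with the stopping rule for continuous margins described in the context) is equal to $$d-|J_0|+\mu\big(\{f\in C_0(T): f(t_j)>0\text{ for some }j\in J_0\}\big).$$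
   Context: $T$ is a locally compact metric space. $C(T)$ is the space of continuous functions $f:T\to\mathbb{R}$ with the Borel $\sigma$-algebra of the topology of uniform convergence on compact sets, and $C_0(T):=\{f\in C(T): f\ge 0,\ f\neq \boldsymbol 0\}$. Maxima of functions are pointwise, and the maximum over the empty set is $\boldsymbol 0$. PRM means Poisson random measure. A stochastic process $\boldsymbol X=(X_t)_{t\in T}$ is max-id if for every $n$ there are iid processes $\boldsymbol X^{(1,n)},\ldots,\boldsymbol X^{(n,n)}$ with $\boldsymbol X\sim\max_{1\le i\le n}\boldsymbol X^{(i,n)}$. It is continuous if all its paths are continuous. Its vertex is $h_{\boldsymbol X}(t)=\sup\{x\in\mathbb R:\mathbb P(X_t>x)=1\}$. A continuous max-id process with vertex $\boldsymbol 0$ satisfies $\boldsymbol X\sim\max_{f\in N}f$ (maximum over the atoms of $N$), where $N$ is a PRM on $C_0(T)$ whose locally finite intensity $\mu$ (the exponent measure) satisfies $\mu(\{f:\sup_{k\in K}f(k)>\epsilon\})<\infty$ for all compact $K\subset T$ and $\epsilon>0$. Let $J_0:=\{j\in\{1,\ldots,d\}:\mathbb P(X_{t_j}=0)>0\}$. For $j\in J_0$ let $\mu_j(\cdot)=\mu(\cdot\cap\{f\in C_0(T): f(t_j)>0,\ f(t_k)=0\text{ for all }k<j,k\in J_0\})$. Let $\tilde\mu(\cdot)=\mu(\cdot\cap\{f\in C_0(T):f(t_j)=0\text{ for all }j\in J_0\})$. Let $\tilde{\boldsymbol X}=(\tilde X_t)_{t\in T}$ denote the continuous max-id process with vertex $\boldsymbol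 0$ and exponent measure $\tilde\mu$. (At the locations $t_i$, $i\notin J_0$, the running process produced by the algorithm below ends with this law.) Algorithm 1, executed in top-down fashion: Step 1. For each $j\in J_0$, simulate all atoms of a finite PRM $N_j$ with intensity $\mu_j$ (independently). All these atoms count as simulated functions. Step 2. Start with the running process $\tilde{\boldsymbol X}=\boldsymbol 0$. For $i=1,\ldots,d$ with $i\notin J_0$, successively: consider a fresh PRM $\tilde N^{(i)}=\sum_{j\in\mathbb N}\delta_{f^{(i)}_j}$ with intensity $\tilde\mu$, independent of everything before, whose atoms can be simulated consecutively in the order $f^{(i)}_1(t_i)\ge f^{(i)}_2(t_i)\ge\cdots$ (this is the assumption on the simulation of PRMs with intensity $\tilde\mu$). Simulate $f^{(i)}_1,f^{(i)}_2,\ldots$ one after the other. A simulated $f^{(i)}_j$ is rejected if $f^{(i)}_j(t_k)\ge\tilde X_{t_k}$ for some $k<i$, $k\notin J_0$. A non-rejected $f^{(i)}_j$ whose value at $t_i$ is at least the current value $\tilde X_{t_i}$ is accepted, and $\tilde{\boldsymbol X}$ is replaced by $\max\{f^{(i)}_j,\tilde{\boldsymbol X}\}$. The simulation at location $t_i$ stops at the first subextremal function, i.e. the first $f^{(i)}_j$ with $f^{(i)}_j(t_i)<\tilde X_{t_i}$, where $\tilde X_{t_i}$ is the current (then final) value. Thus the simulated functions counted at location $t_i$ are all $f_j^{(i)}$, accepted or rejected, with $f^{(i)}_j(t_i)\ge\tilde X_{t_i}$ for the final value $\tilde X_{t_i}$, plus the one first subextremal function. Stopping rule for continuous margins: if $(\tilde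 X_{t_i})_{i\notin J_0}$ has continuous marginal distributions, there is almost surely only one extremal function at each $t_i$, $i\notin J_0$. One then stops at $t_i$ as soon as it is found, so that the additional first subextremal function is not simulated and the functions counted at location $t_i$ are exactly the $f_j^{(i)}$ with $f^{(i)}_j(t_i)\ge\tilde X_{t_i}$ for the final value $\tilde X_{t_i}$. Step 3. Return $\max\{\max_{j\in J_0}\max_{f\in N_j}f,\ \tilde{\boldsymbol X}\}$. The number of simulated functions is the total number counted in Steps 1 and 2. *)

theory Defs
  imports "HOL-Probability.Probability"
begin

section \<open>The function spaces\<close>

definition cont_funs :: "('t::metric_space \<Rightarrow> real) set"  where
  "cont_funs = {f. continuous_on UNIV f}"

text \<open>For compact \<open>K\<close> the condition \<open>\<forall>k\<in>K. \<bar>g k - f k\<bar> < e\<close> says that the supremum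
  of \<open>\<bar>g - f\<bar>\<close> over \<open>K\<close> is less than \<open>e\<close>, because it is attained.\<close>

definition compact_convergence :: "('t::metric_space \<Rightarrow> real) topology" where
  "compact_convergence = topology_generated_by
     {{g \<in> cont_funs. \<forall>k\<in>K. \<bar>g k - f k\<bar> < e} | f K e. f \<in> cont_funs \<and> compact K \<and> 0 < e}"

definition C0 :: "('t::metric_space \<Rightarrow> real) set" where
  "C0 = {f \<in> cont_funs. (\<forall>s. 0 \<le> f s) \<and> f \<noteq> (\<lambda>_. 0)}"

definition borel_C :: "('t::metric_space \<Rightarrow> real) measure" where
  "borel_C = sigma cont_funs {U. openin compact_convergence U}"

definition borel_C0 :: "('t::metric_space \<Rightarrow> real) measure" where
  "borel_C0 = restrict_space borel_C C0"


section \<open>Poisson random measures\<close>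

text \<open>The measures on \<open>K\<close>, with the \<open>\<sigma>\<close>-algebra generated by the evaluations; compare
  \<^const>\<open>subprob_algebra\<close>.\<close>

definition measure_algebra :: "'a measure \<Rightarrow> 'a measure measure" where
  "measure_algebra K =
     (SUP A\<in>sets K. vimage_algebra {\<nu>. sets \<nu> = sets K} (\<lambda>\<nu>. emeasure \<nu> A) borel)"

text \<open>\<open>m x\<close> is the multiplicity of the point \<open>x\<close>. Countably many points would not suffice for
  intensities that are not \<open>\<sigma>\<close>-finite, which occur when the index space is not separable.\<close>

definition is_point_measure :: "'a measure \<Rightarrow> bool" where
  "is_point_measure \<nu> \<longleftrightarrow>
     (\<exists>m :: 'a \<Rightarrow> enat. \<forall>A\<in>sets \<nu>. emeasure \<nu> A = (\<integral>\<^sup>+x. ennreal_of_enat (m x) \<partial>count_space A))"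

definition is_PRM :: "'w measure \<Rightarrow> ('w \<Rightarrow> 'a measure) \<Rightarrow> 'a measure \<Rightarrow> bool" where
  "is_PRM P N \<mu> \<longleftrightarrow>
     N \<in> P \<rightarrow>\<^sub>M measure_algebra \<mu> \<and>
     (\<forall>\<omega>\<in>space P. is_point_measure (N \<omega>)) \<and>
     (\<forall>A\<in>sets \<mu>. emeasure \<mu> A < \<infinity> \<longrightarrow>
        (\<forall>k::nat. measure P {\<omega> \<in> space P. emeasure (N \<omega>) A = of_nat k}
           = exp (- measure \<mu> A) * measure \<mu> A ^ k / fact k)) \<and>
     (\<forall>A\<in>sets \<mu>. emeasure \<mu> A = \<infinity> \<longrightarrow> (AE \<omega> in P. emeasure (N \<omega>) A = \<infinity>)) \<and>
     (\<forall>(I :: nat set) A. finite I \<longrightarrow> A ` I \<subseteq> sets \<mu> \<longrightarrow> disjoint_family_on A I \<longrightarrow>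
        prob_space.indep_vars P (\<lambda>_. borel) (\<lambda>i \<omega>. emeasure (N \<omega>) (A i)) I)"

text \<open>Inserting \<open>0\<close> makes the maximum over no atoms equal to \<open>0\<close>; it changes nothing otherwise,
  since all atoms are nonnegative.\<close>

definition max_atoms :: "('t \<Rightarrow> real) measure \<Rightarrow> 't \<Rightarrow> real" where
  "max_atoms \<nu> s = Sup (insert 0 {f s | f. f \<in> space \<nu> \<and> 0 < emeasure \<nu> {f}})"


section \<open>Max-id processes\<close>

abbreviation path_space :: "('t \<Rightarrow> real) measure" where
  "path_space \<equiv> (\<Pi>\<^sub>M s\<in>UNIV. borel)"

definition same_law :: "'a measure \<Rightarrow> ('a \<Rightarrow> 't \<Rightarrow> real) \<Rightarrow> 'b measure \<Rightarrow> ('b \<Rightarrow> 't \<Rightarrow> real) \<Rightarrow> bool"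
  where "same_law M X M' Y \<longleftrightarrow> distr M path_space X = distr M' path_space Y"

text \<open>The \<open>n\<close> processes may be taken on a probability space with sample points in
  \<open>nat \<Rightarrow> 't \<Rightarrow> real\<close>: any other realisation can be replaced by its image under
  \<open>\<omega> \<mapsto> (i \<mapsto> Y i \<omega>)\<close>.\<close>

definition max_id :: "'a measure \<Rightarrow> ('a \<Rightarrow> 't \<Rightarrow> real) \<Rightarrow> bool" where
  "max_id M X \<longleftrightarrow> (\<forall>n\<ge>1. \<exists>(Q :: (nat \<Rightarrow> 't \<Rightarrow> real) measure) (Y :: nat \<Rightarrow> _).
     prob_space Q \<and>
     prob_space.indep_vars Q (\<lambda>_. path_space) Y {1..n} \<and>
     (\<forall>i\<in>{1..n}. \<forall>j\<in>{1..n}. same_law Q (Y i) Q (Y j)) \<and>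
     same_law M X Q (\<lambda>\<omega> s. Max ((\<lambda>i. Y i \<omega> s) ` {1..n})))"

definition vertex :: "'a measure \<Rightarrow> ('a \<Rightarrow> 't \<Rightarrow> real) \<Rightarrow> 't \<Rightarrow> ereal" where
  "vertex M X s = Sup (ereal ` {x. measure M {\<omega> \<in> space M. X \<omega> s > x} = 1})"

text \<open>The last conjunct makes \<open>\<mu>\<close> locally finite: an element of \<^const>\<open>C0\<close> is positive at some
  point \<open>s\<close>, take \<open>K = {s}\<close>. In the first one the sample points of the Poisson random measure may be
  taken to be measures, since the law of \<open>N\<close> is a measure on \<^term>\<open>measure_algebra \<mu>\<close>.\<close>

definition exponent_measure ::
    "'a measure \<Rightarrow> ('a \<Rightarrow> 't::metric_space \<Rightarrow> real) \<Rightarrow> ('t \<Rightarrow> real) measure \<Rightarrow> bool" where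
  "exponent_measure M X \<mu> \<longleftrightarrow>
     (\<exists>(Q :: ('t \<Rightarrow> real) measure measure) N.
        prob_space Q \<and> is_PRM Q N \<mu> \<and> same_law M X Q (\<lambda>\<omega>. max_atoms (N \<omega>))) \<and>
     sets \<mu> = sets borel_C0 \<and>
     (\<forall>K e. compact K \<longrightarrow> K \<noteq> {} \<longrightarrow> 0 < e \<longrightarrow>
        emeasure \<mu> {f \<in> C0. (SUP k\<in>K. f k) > e} < \<infinity>)"

definition cont_max_id_process ::
    "'a measure \<Rightarrow> ('a \<Rightarrow> 't::metric_space \<Rightarrow> real) \<Rightarrow> ('t \<Rightarrow> real) measure \<Rightarrow> bool" where
  "cont_max_id_process M X \<mu> \<longleftrightarrow>
     prob_space M \<and> X \<in> M \<rightarrow>\<^sub>M path_space \<and>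
     (\<forall>\<omega>\<in>space M. continuous_on UNIV (X \<omega>)) \<and>
     max_id M X \<and> (\<forall>s. vertex M X s = 0) \<and> exponent_measure M X \<mu>"

definition zero_locations :: "'a measure \<Rightarrow> ('a \<Rightarrow> 't \<Rightarrow> real) \<Rightarrow> (nat \<Rightarrow> 't) \<Rightarrow> nat \<Rightarrow> nat set" where
  "zero_locations M X t d = {j \<in> {1..d}. 0 < measure M {\<omega> \<in> space M. X \<omega> (t j) = 0}}"

definition first_positive_part ::
    "('t::metric_space \<Rightarrow> real) measure \<Rightarrow> (nat \<Rightarrow> 't) \<Rightarrow> nat set \<Rightarrow> nat \<Rightarrow> ('t \<Rightarrow> real) measure" where
  "first_positive_part \<mu> t J j =
     density \<mu> (indicator {f \<in> C0. 0 < f (t j) \<and> (\<forall>k\<in>J. k < j \<longrightarrow> f (t k) = 0)})"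

definition vanishing_part ::
    "('t::metric_space \<Rightarrow> real) measure \<Rightarrow> (nat \<Rightarrow> 't) \<Rightarrow> nat set \<Rightarrow> ('t \<Rightarrow> real) measure" where
  "vanishing_part \<mu> t J = density \<mu> (indicator {f \<in> C0. \<forall>j\<in>J. f (t j) = 0})"


section \<open>The simulation algorithm\<close>

text \<open>An ordered simulation only ever reaches the points of \<open>\<nu>\<close> which are positive at \<open>s\<close>: there are
  infinitely many of them, with values at \<open>s\<close> decreasing to \<open>0\<close>, in the case of interest. Points of \<open>\<nu>\<close>
  vanishing at \<open>s\<close> may exist, but come after all of these.\<close>

definition ordered_points :: "'t::metric_space \<Rightarrow> ('t \<Rightarrow> real) measure \<Rightarrow> (nat \<Rightarrow> 't \<Rightarrow> real) \<Rightarrow> bool" where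
  "ordered_points s \<nu> f \<longleftrightarrow>
     (\<forall>n. f (Suc n) s \<le> f n s) \<and>
     (\<forall>A\<in>sets \<nu>. emeasure \<nu> {g \<in> A. 0 < g s} = emeasure (count_space UNIV) {n. f n \<in> A})"

text \<open>The running process at location \<open>s\<close> after the functions \<open>f 0, \<dots>, f (n - 1)\<close> have been dealt
  with, if it was \<open>x\<close> before; \<open>S\<close> is the set of locations treated previously.\<close>

primrec running :: "'t set \<Rightarrow> 't \<Rightarrow> ('t \<Rightarrow> real) \<Rightarrow> (nat \<Rightarrow> 't \<Rightarrow> real) \<Rightarrow> nat \<Rightarrow> 't \<Rightarrow> real" where
  "running S s x f 0 = x"
| "running S s x f (Suc n) =
     (let y = running S s x f n;
          rejected = (\<exists>r\<in>S. f n r \<ge> y r)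
      in if \<not> rejected \<and> f n s \<ge> y s then (\<lambda>r. max (f n r) (y r)) else y)"

definition subextremal :: "'t set \<Rightarrow> 't \<Rightarrow> ('t \<Rightarrow> real) \<Rightarrow> (nat \<Rightarrow> 't \<Rightarrow> real) \<Rightarrow> nat \<Rightarrow> bool" where
  "subextremal S s x f n \<longleftrightarrow> f n s < running S s x f n s"

text \<open>If no function is subextremal, which has probability zero in the algorithm, \<open>stopped\<close> has no
  meaning, and infinitely many functions are simulated.\<close>

definition stopped :: "'t set \<Rightarrow> 't \<Rightarrow> ('t \<Rightarrow> real) \<Rightarrow> (nat \<Rightarrow> 't \<Rightarrow> real) \<Rightarrow> 't \<Rightarrow> real" where
  "stopped S s x f = running S s x f (LEAST n. subextremal S s x f n)"

definition simulated :: "'t set \<Rightarrow> 't \<Rightarrow> ('t \<Rightarrow> real) \<Rightarrow> (nat \<Rightarrow> 't \<Rightarrow> real) \<Rightarrow> nat set" where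
  "simulated S s x f = {n. \<forall>m<n. \<not> subextremal S s x f m}"

definition simulated_cont :: "'t set \<Rightarrow> 't \<Rightarrow> ('t \<Rightarrow> real) \<Rightarrow> (nat \<Rightarrow> 't \<Rightarrow> real) \<Rightarrow> nat set" where
  "simulated_cont S s x f = {n. f n s \<ge> stopped S s x f s}"

text \<open>\<open>simulated_cont\<close> belongs to the stopping rule for continuous margins: the simulation stops with
  the (almost surely unique) extremal function at \<open>s\<close>. Compared to the general rule it saves exactly
  the first subextremal function; the final running process is the same.\<close>

lemma simulated_eq_insert:
  assumes dec: "\<And>n. f (Suc n) s \<le> f n s" and ex: "\<exists>n. subextremal S s x f n"
  shows "simulated S s x f = insert (LEAST n. subextremal S s x f n) (simulated_cont S s x f)"
    and "(LEAST n. subextremal S s x f n) \<notin> simulated_cont S s x f"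
proof -
  define L where "L = (LEAST n. subextremal S s x f n)"
  have L: "subextremal S s x f L"
    unfolding L_def using ex by (rule LeastI_ex)
  have before: "\<not> subextremal S s x f m" if "m < L" for m
    using that not_less_Least unfolding L_def by blast
  have mono: "f n s \<le> f m s" if "m \<le> n" for m n
    using lift_Suc_antimono_le[of "\<lambda>n. f n s", OF dec that] .
  have above: "running S s x f L s \<le> f n s" if "n < L" for n
  proof -
    from that obtain m where m: "L = Suc m" "n \<le> m"
      by (cases L) (simp_all add: less_Suc_eq_le)
    have "running S s x f m s \<le> f m s"
      using before[of m] by (simp add: m(1) subextremal_def)
    then have "running S s x f L s \<le> f m s"
      by (simp add: m(1) Let_def)
    then show ?thesis
      using mono[OF m(2)] by linarith
  qed
  have below: "f n s < running S s x f L s" if "L \<le> n" for n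
    using mono[OF that] L unfolding subextremal_def by linarith
  have cont: "n \<in> simulated_cont S s x f \<longleftrightarrow> n < L" for n
    using above[of n] below[of n] unfolding simulated_cont_def stopped_def L_def[symmetric]
    by (cases "n < L") simp_all
  have sim: "n \<in> simulated S s x f \<longleftrightarrow> n \<le> L" for n
  proof
    show "n \<le> L" if "n \<in> simulated S s x f"
      using that L unfolding simulated_def by (auto simp: not_less[symmetric])
    show "n \<in> simulated S s x f" if "n \<le> L"
      using that before unfolding simulated_def by (auto dest: less_le_trans)
  qed
  show "simulated S s x f = insert (LEAST n. subextremal S s x f n) (simulated_cont S s x f)"
    unfolding L_def[symmetric] by (rule set_eqI) (simp add: sim cont le_less disj_commute)
  show "(LEAST n. subextremal S s x f n) \<notin> simulated_cont S s x f"
    unfolding L_def[symmetric] using cont by simp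
qed

definition earlier :: "(nat \<Rightarrow> 't) \<Rightarrow> nat set \<Rightarrow> nat \<Rightarrow> 't set" where
  "earlier t J i = t ` ({1..<i} - J)"

text \<open>The running process after the locations \<open>t 1, \<dots>, t i\<close>; \<open>f i\<close> is the sequence of functions
  offered at location \<open>t i\<close>.\<close>

primrec process_after :: "(nat \<Rightarrow> 't) \<Rightarrow> nat set \<Rightarrow> (nat \<Rightarrow> nat \<Rightarrow> 't \<Rightarrow> real) \<Rightarrow> nat \<Rightarrow> 't \<Rightarrow> real" where
  "process_after t J f 0 = (\<lambda>_. 0)"
| "process_after t J f (Suc i) =
     (if Suc i \<in> J then process_after t J f i
      else stopped (earlier t J (Suc i)) (t (Suc i)) (process_after t J f i) (f (Suc i)))"

definition num_simulated ::
    "(nat \<Rightarrow> 't) \<Rightarrow> nat \<Rightarrow> nat set \<Rightarrow> (nat \<Rightarrow> ('t \<Rightarrow> real) measure) \<Rightarrow> (nat \<Rightarrow> nat \<Rightarrow> 't \<Rightarrow> real) \<Rightarrow> ennreal" where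
  "num_simulated t d J \<nu> f =
     (\<Sum>j\<in>J. emeasure (\<nu> j) (space (\<nu> j))) +
     (\<Sum>i\<in>{1..d} - J. emeasure (count_space UNIV)
        (simulated (earlier t J i) (t i) (process_after t J f (i - 1)) (f i)))"

definition num_simulated_cont ::
    "(nat \<Rightarrow> 't) \<Rightarrow> nat \<Rightarrow> nat set \<Rightarrow> (nat \<Rightarrow> ('t \<Rightarrow> real) measure) \<Rightarrow> (nat \<Rightarrow> nat \<Rightarrow> 't \<Rightarrow> real) \<Rightarrow> ennreal" where
  "num_simulated_cont t d J \<nu> f =
     (\<Sum>j\<in>J. emeasure (\<nu> j) (space (\<nu> j))) +
     (\<Sum>i\<in>{1..d} - J. emeasure (count_space UNIV)
        (simulated_cont (earlier t J i) (t i) (process_after t J f (i - 1)) (f i)))"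

text \<open>The random input of the algorithm on the probability space \<open>P\<close>: \<open>N i\<close> is the Poisson random
  measure used at location \<open>t i\<close>, \<open>F i 0, F i 1, \<dots>\<close> are the consecutively simulated functions. That
  each Poisson random measure is independent of all previous ones amounts to joint independence.\<close>

definition algorithm_input ::
    "'w measure \<Rightarrow> ('t::metric_space \<Rightarrow> real) measure \<Rightarrow> (nat \<Rightarrow> 't) \<Rightarrow> nat \<Rightarrow> nat set \<Rightarrow>
     (nat \<Rightarrow> 'w \<Rightarrow> ('t \<Rightarrow> real) measure) \<Rightarrow> (nat \<Rightarrow> nat \<Rightarrow> 'w \<Rightarrow> 't \<Rightarrow> real) \<Rightarrow> bool" where
  "algorithm_input P \<mu> t d J N F \<longleftrightarrow>
     prob_space P \<and>
     (\<forall>j\<in>J. is_PRM P (N j) (first_positive_part \<mu> t J j)) \<and>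
     (\<forall>i\<in>{1..d} - J. is_PRM P (N i) (vanishing_part \<mu> t J)) \<and>
     prob_space.indep_vars P (\<lambda>_. measure_algebra borel_C0) N {1..d} \<and>
     (\<forall>i\<in>{1..d} - J. (\<forall>n. F i n \<in> P \<rightarrow>\<^sub>M borel_C0) \<and>
        (AE \<omega> in P. ordered_points (t i) (N i \<omega>) (\<lambda>n. F i n \<omega>)))"

end

(* Only the values of the functions at t_1, ..., t_d matter. Let Y be the running process before t_i is
   treated, fix a location s and a level z > 0, and call an offered function free if it lies below Y at
   the locations treated earlier. Then
     E [1{Y(s) <= z} exp (- mu~ {f free, f(s) > z})]
   does not change when t_i is treated. Indeed, let R be the new value at t_i. On the event that the new
   value at s is at most z, R depends only on Y(t_i) and on the free functions with f(s) <= z; given R, no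
   free function with f(s) > z reaches R at t_i with probability exp (- mu~ {f free, f(s) > z, f(t_i) >= R}),
   and this combines with the remaining factor exp (- mu~ {f free, f(s) > z, f(t_i) < R}). Initially the
   expectation is exp (- mu~ {f(s) > z}), and once s itself has been treated the factor is 1, which yields
   the law of the process at s.

   An offered function f satisfies f(t_i) >= R if and only if f(t_i) >= Y(t_i) and no free function
   exceeds f at t_i. This does not involve f itself, so by Mecke's formula the mean number of these
   functions is E [mu~ {f(t_i) >= R}]. In the case of continuous margins mu~ {f(t_i) >= R} is minus the
   logarithm of the distribution function of R, evaluated at R, and has a standard exponential law. *)
theory Submission
  imports Defs
begin

section \<open>The function spaces\<close>

text \<open>The weighted indicator of the overview is the conditional probability, given the run so
  far, that the value at \<open>s\<close> would come out at most \<open>z\<close> if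
  \<open>s\<close> were treated next; its constant mean says that the order of treatment does not
  influence the law at \<open>s\<close>. Two obstacles shape the proof. Independence is given for
  the random measures only, whereas the algorithm reads their points in an enumeration whose ties
  are broken in an arbitrary way. So the values at the locations are first shown to be measurable
  functions of the random measures, expressed through their vanishing on sets with rational
  thresholds; only then may earlier values be frozen while a fresh measure is integrated out.
  Moreover the intensity need not be \<sigma>-finite, and a Poisson random measure is known only
  through its counts on fixed sets, so a random level cannot be inserted directly: levels are
  rounded to a grid of mesh \<open>1 / real (Suc n)\<close>, each cell is handled with a fixed
  level, and \<open>n\<close> tends to infinity.\<close>

lemma openin_compact_convergence_basis:
  assumes "h \<in> cont_funs" "compact K" "0 < e"
  shows "openin compact_convergence {g \<in> cont_funs. \<forall>k\<in>K. \<bar>g k - h k\<bar> < e}"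
  unfolding compact_convergence_def using assms by (intro topology_generated_by_Basis) auto

text \<open>Singletons are compact, so around each \<open>h\<close> there is the basic open set over
  \<open>K = {s}\<close> of radius \<open>h s - x\<close>, which stays above \<open>x\<close> at
  \<open>s\<close>. This makes the evaluations Borel functions.\<close>

lemma openin_evaluation:
  "openin compact_convergence {g \<in> cont_funs. x < g s}"
proof -
  have "{g \<in> cont_funs. x < g s} =
      (\<Union>h\<in>{h \<in> cont_funs. x < h s}. {g \<in> cont_funs. \<forall>k\<in>{s}. \<bar>g k - h k\<bar> < h s - x})" (is "_ = ?R")
    by auto
  moreover have "openin compact_convergence ?R"
  proof (intro openin_Union, elim imageE, clarify)
    fix h assume "h \<in> cont_funs" "x < h s"
    then show "openin compact_convergence {g \<in> cont_funs. \<forall>k\<in>{s}. \<bar>g k - h k\<bar> < h s - x}"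
      by (intro openin_compact_convergence_basis) auto
  qed
  ultimately show ?thesis by simp
qed

lemma openin_Compl_singleton:
  "openin compact_convergence (cont_funs - {f})"
proof (cases "f \<in> cont_funs")
  case True
  have "cont_funs - {f} = (\<Union>(h, s)\<in>{(h, s). h \<in> cont_funs \<and> h s \<noteq> f s}.
      {g \<in> cont_funs. \<forall>k\<in>{s}. \<bar>g k - h k\<bar> < \<bar>h s - f s\<bar>})" (is "_ = ?R")
  proof (intro set_eqI iffI)
    fix g assume g: "g \<in> cont_funs - {f}"
    then obtain s where "g s \<noteq> f s" by auto
    with g show "g \<in> ?R" by (auto intro!: exI[of _ g] exI[of _ s])
  qed (auto simp: abs_minus_commute)
  moreover have "openin compact_convergence ?R"
  proof (intro openin_Union, elim imageE, clarify)
    fix h s assume "h \<in> cont_funs" "h s \<noteq> f s"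
    then show "openin compact_convergence {g \<in> cont_funs. \<forall>k\<in>{s}. \<bar>g k - h k\<bar> < \<bar>h s - f s\<bar>}"
      by (intro openin_compact_convergence_basis) auto
  qed
  ultimately show ?thesis by simp
next
  case False
  \<comment> \<open>Nothing is removed in this case, and the whole space is open because the
    condition over the empty compact set is void.\<close>
  have "cont_funs = (\<Union>h\<in>cont_funs. {g \<in> cont_funs. \<forall>k\<in>{}::'a set. \<bar>g k - h k\<bar> < 1})"
    by auto
  moreover have "openin compact_convergence (\<Union>h\<in>cont_funs. {g \<in> cont_funs. \<forall>k\<in>{}::'a set. \<bar>g k - h k\<bar> < 1})"
    by (intro openin_Union, elim imageE) (simp only: openin_compact_convergence_basis compact_empty zero_less_one)
  ultimately have "openin compact_convergence (cont_funs :: ('a \<Rightarrow> real) set)"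
    by simp
  with False show ?thesis by simp
qed

text \<open>Needed to unfold \<open>sigma\<close>, which generates the expected \<sigma>-algebra
  only from subsets of the space.\<close>

lemma sets_borel_C: "{U. openin compact_convergence U} \<subseteq> Pow cont_funs"
proof -
  have "topspace compact_convergence \<subseteq> (cont_funs :: ('a \<Rightarrow> real) set)"
    unfolding compact_convergence_def topology_generated_by_topspace by auto
  then show ?thesis
    by (auto dest: openin_subset)
qed

lemma space_borel_C [simp]: "space borel_C = cont_funs"
  unfolding borel_C_def by (simp add: space_measure_of sets_borel_C)

lemma openin_in_borel_C: "openin compact_convergence U \<Longrightarrow> U \<in> sets borel_C"
  unfolding borel_C_def by (simp add: sets_measure_of sets_borel_C)

lemma C0_subset_cont_funs: "C0 \<subseteq> cont_funs"
  by (auto simp: C0_def)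

lemma space_borel_C0 [simp]: "space borel_C0 = C0"
  using C0_subset_cont_funs by (auto simp: borel_C0_def space_restrict_space)

lemma measurable_evaluation [measurable]: "(\<lambda>f. f s) \<in> borel_measurable borel_C0"
  unfolding borel_C0_def
proof (rule measurable_restrict_space1, rule borel_measurableI_greater)
  show "{f \<in> space borel_C. x < f s} \<in> sets borel_C" for x
    by (simp add: openin_in_borel_C openin_evaluation)
qed

text \<open>\<open>max_atoms\<close> recognises an atom \<open>f\<close> by the mass of
  \<open>{f}\<close>, so points have to be measurable.\<close>

lemma singleton_in_borel_C0:
  assumes "f \<in> C0"
  shows "{f} \<in> sets borel_C0"
proof -
  have "cont_funs - (cont_funs - {f}) \<in> sets borel_C"
    by (metis openin_in_borel_C openin_Compl_singleton sets.compl_sets space_borel_C)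
  moreover have "cont_funs - (cont_funs - {f}) = {f}"
    using assms C0_subset_cont_funs by auto
  ultimately have "C0 \<inter> {f} \<in> sets borel_C0"
    unfolding borel_C0_def sets_restrict_space by auto
  with assms show ?thesis by auto
qed


section \<open>Poisson random measures\<close>

lemma space_measure_algebra: "space (measure_algebra K) = {\<nu>. sets \<nu> = sets K}"
  by (auto simp add: measure_algebra_def space_Sup_eq_UN)

lemma measurable_emeasure_measure_algebra [measurable]:
  "A \<in> sets K \<Longrightarrow> (\<lambda>\<nu>. emeasure \<nu> A) \<in> borel_measurable (measure_algebra K)"
  by (auto intro!: measurable_Sup1 measurable_vimage_algebra1 simp: measure_algebra_def)

context prob_space
begin

lemma is_PRM_measurable:
  assumes "is_PRM M N \<mu>"
  shows "N \<in> M \<rightarrow>\<^sub>M measure_algebra \<mu>"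
  using assms by (simp add: is_PRM_def)

lemma is_PRM_measurable_emeasure:
  assumes "is_PRM M N \<mu>" "A \<in> sets \<mu>"
  shows "(\<lambda>\<omega>. emeasure (N \<omega>) A) \<in> borel_measurable M"
  using measurable_compose[OF is_PRM_measurable[OF assms(1)] measurable_emeasure_measure_algebra[OF assms(2)]] .

lemma is_PRM_sets:
  assumes "is_PRM M N \<mu>" "\<omega> \<in> space M"
  shows "sets (N \<omega>) = sets \<mu>"
  using measurable_space[OF is_PRM_measurable[OF assms(1)] assms(2)] by (simp add: space_measure_algebra)

lemma is_PRM_prob:
  assumes "is_PRM M N \<mu>" "A \<in> sets \<mu>" "emeasure \<mu> A < \<infinity>"
  shows "prob {\<omega> \<in> space M. emeasure (N \<omega>) A = of_nat k} = exp (- measure \<mu> A) * measure \<mu> A ^ k / fact k"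
  using assms by (simp add: is_PRM_def)

lemma is_PRM_prob_zero:
  assumes "is_PRM M N \<mu>" "A \<in> sets \<mu>" "emeasure \<mu> A < \<infinity>"
  shows "prob {\<omega> \<in> space M. emeasure (N \<omega>) A = 0} = exp (- measure \<mu> A)"
  using is_PRM_prob[OF assms, of 0] by simp

text \<open>The Poisson weights already add up to 1, which leaves no probability for any other value
  of the count, in particular for \<infinity>.\<close>

lemma is_PRM_AE_nat:
  assumes N: "is_PRM M N \<mu>" and A: "A \<in> sets \<mu>" and fin: "emeasure \<mu> A < \<infinity>"
  shows "AE \<omega> in M. \<exists>k::nat. emeasure (N \<omega>) A = of_nat k"
proof -
  note [measurable] = is_PRM_measurable_emeasure[OF N A]
  let ?E = "\<lambda>k::nat. {\<omega> \<in> space M. emeasure (N \<omega>) A = of_nat k}"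
  have "(\<lambda>k. prob (?E k)) sums prob (\<Union>k. ?E k)"
  proof (rule finite_measure_UNION)
    show "disjoint_family ?E"
      by (auto simp: disjoint_family_on_def)
  qed auto
  moreover have "(\<lambda>k. prob (?E k)) sums 1"
  proof -
    have "(\<lambda>k. exp (- measure \<mu> A) * (measure \<mu> A ^ k /\<^sub>R fact k)) sums (exp (- measure \<mu> A) * exp (measure \<mu> A))"
      by (intro sums_mult exp_converges)
    then show ?thesis
      unfolding is_PRM_prob[OF N A fin] by (simp add: exp_minus field_simps)
  qed
  ultimately have "prob (\<Union>k. ?E k) = 1"
    by (rule sums_unique2)
  then have "AE \<omega> in M. \<omega> \<in> (\<Union>k. ?E k)"
    by (intro AE_prob_1)
  then show ?thesis
    by eventually_elim auto
qed

lemma is_PRM_AE_finite: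
  assumes "is_PRM M N \<mu>" "A \<in> sets \<mu>" "emeasure \<mu> A < \<infinity>"
  shows "AE \<omega> in M. emeasure (N \<omega>) A < \<infinity>"
  using is_PRM_AE_nat[OF assms] by eventually_elim (auto simp: of_nat_less_top)

lemma is_PRM_nn_integral:
  assumes N: "is_PRM M N \<mu>" and A: "A \<in> sets \<mu>"
  shows "(\<integral>\<^sup>+\<omega>. emeasure (N \<omega>) A \<partial>M) = emeasure \<mu> A"
proof (cases "emeasure \<mu> A < \<infinity>")
  case fin: True
  note [measurable] = is_PRM_measurable_emeasure[OF N A]
  let ?E = "\<lambda>k::nat. {\<omega> \<in> space M. emeasure (N \<omega>) A = of_nat k}"
  let ?m = "measure \<mu> A"
  have "(\<integral>\<^sup>+\<omega>. emeasure (N \<omega>) A \<partial>M) = (\<integral>\<^sup>+\<omega>. (\<Sum>k. of_nat k * indicator (?E k) \<omega>) \<partial>M)"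
  proof (rule nn_integral_cong_AE)
    show "AE \<omega> in M. emeasure (N \<omega>) A = (\<Sum>k. of_nat k * indicator (?E k) \<omega>)"
      using is_PRM_AE_nat[OF N A fin] AE_space
    proof eventually_elim
      case (elim \<omega>)
      then obtain k :: nat where "emeasure (N \<omega>) A = of_nat k" by auto
      moreover have "(\<Sum>j. of_nat j * indicator (?E j) \<omega> :: ennreal) = (\<Sum>j\<in>{k}. of_nat j * indicator (?E j) \<omega>)"
        using elim(2) calculation by (intro suminf_finite) auto
      ultimately show ?case
        using elim(2) by simp
    qed
  qed
  also have "\<dots> = (\<Sum>k. of_nat k * emeasure M (?E k))"
    by (subst nn_integral_suminf) (auto simp: nn_integral_cmult_indicator)
  also have "\<dots> = (\<Sum>k. ennreal (real k * (exp (- ?m) * ?m ^ k / fact k)))"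
    unfolding emeasure_eq_measure is_PRM_prob[OF N A fin]
    unfolding ennreal_of_nat_eq_real_of_nat
    by (simp only: ennreal_mult'[symmetric] of_nat_0_le_iff)
  also have "\<dots> = ennreal ?m"
  proof (rule suminf_ennreal_eq)
    \<comment> \<open>Cancelling \<open>k\<close> against the factorial turns the mean into the
      exponential series shifted by one; the term for \<open>k = 0\<close> vanishes.\<close>
    have "(\<lambda>k. exp (- ?m) * ?m * (?m ^ k /\<^sub>R fact k)) sums (exp (- ?m) * ?m * exp ?m)"
      by (intro sums_mult exp_converges)
    then have "(\<lambda>k. real (Suc k) * (exp (- ?m) * ?m ^ Suc k / fact (Suc k))) sums ?m"
      by (simp add: exp_minus field_simps del: of_nat_Suc)
    then show "(\<lambda>k. real k * (exp (- ?m) * ?m ^ k / fact k)) sums ?m"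
      by (subst (asm) sums_Suc_iff) simp
  qed simp
  also have "\<dots> = emeasure \<mu> A"
    using fin by (simp add: emeasure_eq_ennreal_measure less_top[symmetric])
  finally show ?thesis .
next
  case False
  then have "AE \<omega> in M. emeasure (N \<omega>) A = \<infinity>"
    using N A by (simp add: is_PRM_def less_top[symmetric])
  then have "(\<integral>\<^sup>+\<omega>. emeasure (N \<omega>) A \<partial>M) = (\<integral>\<^sup>+\<omega>. \<infinity> \<partial>M)"
    by (rule nn_integral_cong_AE)
  then show ?thesis
    using False by (simp add: emeasure_space_1 less_top[symmetric])
qed

text \<open>Two sets form the family \<open>C\<close> over \<open>{0, 1}\<close> in the independence
  clause of \<open>is_PRM\<close>. General \<open>\<phi>\<close> and \<open>\<psi>\<close> cover
  both the count itself and the indicator that it vanishes.\<close>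

lemma is_PRM_disjoint_product:
  fixes \<phi> \<psi> :: "ennreal \<Rightarrow> ennreal"
  assumes N: "is_PRM M N \<mu>" and A: "A \<in> sets \<mu>" and B: "B \<in> sets \<mu>" and disj: "A \<inter> B = {}"
    and [measurable]: "\<phi> \<in> borel_measurable borel" "\<psi> \<in> borel_measurable borel"
  shows "(\<integral>\<^sup>+\<omega>. \<phi> (emeasure (N \<omega>) A) * \<psi> (emeasure (N \<omega>) B) \<partial>M) =
    (\<integral>\<^sup>+\<omega>. \<phi> (emeasure (N \<omega>) A) \<partial>M) * (\<integral>\<^sup>+\<omega>. \<psi> (emeasure (N \<omega>) B) \<partial>M)"
proof -
  define C where "C i = (if i = 0 then A else B)" for i :: nat
  define C' where "C' i = (if i = 0 then \<phi> else \<psi>)" for i :: nat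
  have "indep_vars (\<lambda>_. borel) (\<lambda>i \<omega>. emeasure (N \<omega>) (C i)) {0, 1}"
  proof -
    have "C ` {0, 1} \<subseteq> sets \<mu>" "disjoint_family_on C {0, 1}"
      using A B disj by (auto simp: C_def disjoint_family_on_def)
    with N show ?thesis
      unfolding is_PRM_def by auto
  qed
  then have "indep_vars (\<lambda>_. borel) (\<lambda>i \<omega>. C' i (emeasure (N \<omega>) (C i))) {0, 1}"
    by (rule indep_vars_compose2) (auto simp: C'_def)
  then have "(\<integral>\<^sup>+\<omega>. (\<Prod>i\<in>{0, 1}. C' i (emeasure (N \<omega>) (C i))) \<partial>M) =
      (\<Prod>i\<in>{0, 1}. \<integral>\<^sup>+\<omega>. C' i (emeasure (N \<omega>) (C i)) \<partial>M)"
    by (intro indep_vars_nn_integral) auto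
  then show ?thesis
    by (simp add: C'_def C_def)
qed

end

section \<open>Integral identities for Poisson points and a random level\<close>

lemma real_ceiling_divide_tendsto:
  "(\<lambda>n. of_int \<lceil>real (Suc n) * x\<rceil> / real (Suc n)) \<longlonglongrightarrow> x"
proof (rule tendsto_sandwich)
  show "\<forall>\<^sub>F n in sequentially. of_int \<lceil>real (Suc n) * x\<rceil> / real (Suc n) \<le> x + 1 / real (Suc n)"
  proof (intro always_eventually allI)
    fix n
    have "of_int \<lceil>real (Suc n) * x\<rceil> \<le> real (Suc n) * x + 1"
      by linarith
    then show "of_int \<lceil>real (Suc n) * x\<rceil> / real (Suc n) \<le> x + 1 / real (Suc n)"
      by (simp add: field_simps del: of_nat_Suc)
  qed
  show "\<forall>\<^sub>F n in sequentially. x \<le> of_int \<lceil>real (Suc n) * x\<rceil> / real (Suc n)"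
    by (simp add: field_simps del: of_nat_Suc)
  show "(\<lambda>n. x + 1 / real (Suc n)) \<longlonglongrightarrow> x"
    using LIMSEQ_inverse_real_of_nat_add[of x] by (simp add: inverse_eq_divide)
qed simp

lemma nn_integral_split_index:
  fixes J :: "'a \<Rightarrow> nat"
  assumes [measurable]: "h \<in> borel_measurable M" "J \<in> M \<rightarrow>\<^sub>M count_space UNIV"
  shows "(\<integral>\<^sup>+\<omega>. h \<omega> \<partial>M) = (\<Sum>j. \<integral>\<^sup>+\<omega>. h \<omega> * indicator {\<omega>. J \<omega> = j} \<omega> \<partial>M)"
proof -
  have "h \<omega> = (\<Sum>j. h \<omega> * indicator {\<omega>. J \<omega> = j} \<omega>)" for \<omega>
    by (subst suminf_finite[of "{J \<omega>}"]) auto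
  then have "(\<integral>\<^sup>+\<omega>. h \<omega> \<partial>M) = (\<integral>\<^sup>+\<omega>. (\<Sum>j. h \<omega> * indicator {\<omega>. J \<omega> = j} \<omega>) \<partial>M)"
    by simp
  also have "\<dots> = (\<Sum>j. \<integral>\<^sup>+\<omega>. h \<omega> * indicator {\<omega>. J \<omega> = j} \<omega> \<partial>M)"
    by (intro nn_integral_suminf) measurable
  finally show ?thesis .
qed

context prob_space
begin

lemma is_PRM_prob_zero_product:
  assumes N: "is_PRM M N \<mu>" and A: "A \<in> sets \<mu>" and B: "B \<in> sets \<mu>" and disj: "A \<inter> B = {}"
  shows "prob {\<omega> \<in> space M. emeasure (N \<omega>) A = 0 \<and> emeasure (N \<omega>) B = 0} =
    prob {\<omega> \<in> space M. emeasure (N \<omega>) A = 0} * prob {\<omega> \<in> space M. emeasure (N \<omega>) B = 0}"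
proof -
  note [measurable] = is_PRM_measurable_emeasure[OF N A] is_PRM_measurable_emeasure[OF N B]
  have "(\<integral>\<^sup>+\<omega>. indicator {0} (emeasure (N \<omega>) A) * indicator {0} (emeasure (N \<omega>) B) \<partial>M) =
    (\<integral>\<^sup>+\<omega>. indicator {0} (emeasure (N \<omega>) A) \<partial>M) * (\<integral>\<^sup>+\<omega>. indicator {0} (emeasure (N \<omega>) B) \<partial>M)"
    by (rule is_PRM_disjoint_product[OF N A B disj]) auto
  moreover have "(\<integral>\<^sup>+\<omega>. indicator {0} (emeasure (N \<omega>) C) \<partial>M) = ennreal (prob {\<omega> \<in> space M. emeasure (N \<omega>) C = 0})"
    if [measurable]: "(\<lambda>\<omega>. emeasure (N \<omega>) C) \<in> borel_measurable M" for C
  proof -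
    have "(\<integral>\<^sup>+\<omega>. indicator {0} (emeasure (N \<omega>) C) \<partial>M) =
        (\<integral>\<^sup>+\<omega>. indicator {\<omega> \<in> space M. emeasure (N \<omega>) C = 0} \<omega> \<partial>M)"
      by (intro nn_integral_cong) (auto split: split_indicator)
    then show ?thesis by (simp add: emeasure_eq_measure)
  qed
  moreover have "(\<integral>\<^sup>+\<omega>. indicator {0} (emeasure (N \<omega>) A) * indicator {0} (emeasure (N \<omega>) B) \<partial>M) =
      ennreal (prob {\<omega> \<in> space M. emeasure (N \<omega>) A = 0 \<and> emeasure (N \<omega>) B = 0})"
  proof -
    have "(\<integral>\<^sup>+\<omega>. indicator {0} (emeasure (N \<omega>) A) * indicator {0} (emeasure (N \<omega>) B) \<partial>M) =
        (\<integral>\<^sup>+\<omega>. indicator {\<omega> \<in> space M. emeasure (N \<omega>) A = 0 \<and> emeasure (N \<omega>) B = 0} \<omega> \<partial>M)"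
      by (intro nn_integral_cong) (auto split: split_indicator)
    then show ?thesis by (simp add: emeasure_eq_measure)
  qed
  ultimately show ?thesis
    by (simp add: ennreal_mult''[symmetric] ennreal_inj)
qed

text \<open>Here \<open>R\<close> is the larger of \<open>w\<close> and of the top level of the points in \<open>D\<close>. On the
  event below it is also the larger of \<open>w\<close> and of the top level of the points in \<open>D - B\<close>, hence
  independent of the points in \<open>B\<close>; and whatever its value \<open>r\<close> is, the probability that no point of \<open>B\<close>
  reaches the level \<open>r\<close>, times the exponential factor, is \<open>exp (- \<mu> B)\<close>.\<close>

lemma is_PRM_nn_integral_top_level:
  fixes \<phi> :: "'b \<Rightarrow> real" and R :: "'a \<Rightarrow> real"
  assumes N: "is_PRM M N \<mu>" and [measurable]: "\<phi> \<in> borel_measurable \<mu>" "D \<in> sets \<mu>" "B \<in> sets \<mu>"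
    and BD: "B \<subseteq> D" and fin: "emeasure \<mu> B < \<infinity>" and w: "0 \<le> w"
    and R_meas [measurable]: "R \<in> borel_measurable M"
    and R: "AE \<omega> in M. \<forall>x. R \<omega> \<le> x \<longleftrightarrow> w \<le> x \<and> emeasure (N \<omega>) {f \<in> D. x < \<phi> f} = 0"
  shows "(\<integral>\<^sup>+\<omega>. indicator {\<omega>. \<exists>q\<in>\<rat>. q < R \<omega> \<and> emeasure (N \<omega>) {f \<in> B. q < \<phi> f} = 0} \<omega>
      * ennreal (exp (- measure \<mu> {f \<in> B. \<phi> f < R \<omega>})) \<partial>M) = ennreal (exp (- measure \<mu> B))"
proof -
  have level: "{f \<in> A. x < \<phi> f} \<in> sets \<mu>" "{f \<in> A. \<phi> f \<le> x} \<in> sets \<mu>" "{f \<in> A. \<phi> f < x} \<in> sets \<mu>"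
    if [measurable]: "A \<in> sets \<mu>" for A x
  proof -
    have "{f \<in> A. P f} = {f \<in> space \<mu>. f \<in> A \<and> P f}" for P
      using sets.sets_into_space[OF that] by auto
    then show "{f \<in> A. x < \<phi> f} \<in> sets \<mu>" "{f \<in> A. \<phi> f \<le> x} \<in> sets \<mu>" "{f \<in> A. \<phi> f < x} \<in> sets \<mu>"
      by simp_all
  qed
  have DB: "D - B \<in> sets \<mu>" by simp
  note levelD = level[OF \<open>D \<in> sets \<mu>\<close>] and levelB = level[OF \<open>B \<in> sets \<mu>\<close>] and levelG = level[OF DB]
  note [measurable] = is_PRM_measurable_emeasure[OF N levelD(1)]
    is_PRM_measurable_emeasure[OF N levelB(1)] is_PRM_measurable_emeasure[OF N levelG(1)]
  have finB: "emeasure \<mu> {f \<in> B. P f} < \<infinity>" for P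
    by (rule le_less_trans[OF emeasure_mono fin]) auto
  \<comment> \<open>The distribution function of the level that \<open>w\<close> and the points of
    \<open>D - B\<close> alone would produce.\<close>
  define p where "p x = (if w \<le> x then prob {\<omega> \<in> space M. emeasure (N \<omega>) {f \<in> D - B. x < \<phi> f} = 0} else 0)" for x
  \<comment> \<open>For a fixed level \<open>l\<close>, the mean of \<open>\<tau> l\<close> below is
    \<open>exp (- measure \<mu> B)\<close>: the indicator contributes the part of \<open>B\<close>
    above \<open>l\<close>, the factor \<open>c l\<close> the part up to \<open>l\<close>. The task
    is to insert \<open>R\<close> for \<open>l\<close>.\<close>
  define c where "c l = ennreal (exp (- measure \<mu> {f \<in> B. \<phi> f \<le> l}))" for l
  define \<tau> where "\<tau> l \<omega> = indicator {\<omega>. emeasure (N \<omega>) {f \<in> B. l < \<phi> f} = 0} \<omega> * c l" for l \<omega>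
  have [measurable]: "\<tau> l \<in> borel_measurable M" for l
    unfolding \<tau>_def by measurable
  \<comment> \<open>If \<open>B\<close> has no points above \<open>l \<le> x\<close>, it has no
    influence on whether \<open>R\<close> is at most \<open>x\<close>. What remains concerns
    \<open>D - B\<close>, which is independent of \<open>B\<close>.\<close>
  have joint: "prob {\<omega> \<in> space M. emeasure (N \<omega>) {f \<in> B. l < \<phi> f} = 0 \<and> R \<omega> \<le> x}
      = exp (- measure \<mu> {f \<in> B. l < \<phi> f}) * p x" if "l \<le> x" for l x
  proof -
    have eq: "emeasure (N \<omega>) {f \<in> D. x < \<phi> f} = 0 \<longleftrightarrow> emeasure (N \<omega>) {f \<in> D - B. x < \<phi> f} = 0"
      if "\<omega> \<in> space M" and zero: "emeasure (N \<omega>) {f \<in> B. l < \<phi> f} = 0" for \<omega>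
    proof
      assume *: "emeasure (N \<omega>) {f \<in> D - B. x < \<phi> f} = 0"
      have "{f \<in> D - B. x < \<phi> f} \<in> null_sets (N \<omega>)" "{f \<in> B. l < \<phi> f} \<in> null_sets (N \<omega>)"
        using * zero is_PRM_sets[OF N that(1)] levelB levelG by (auto simp: null_sets_def)
      then have "{f \<in> D - B. x < \<phi> f} \<union> {f \<in> B. l < \<phi> f} \<in> null_sets (N \<omega>)"
        by (rule null_sets.Un)
      then show "emeasure (N \<omega>) {f \<in> D. x < \<phi> f} = 0"
        by (rule null_setsD1[OF null_sets_subset]) (use is_PRM_sets[OF N that(1)] levelD \<open>l \<le> x\<close> in auto)
    next
      assume "emeasure (N \<omega>) {f \<in> D. x < \<phi> f} = 0"
      then show "emeasure (N \<omega>) {f \<in> D - B. x < \<phi> f} = 0"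
        by (rule emeasure_eq_0[rotated]) (use is_PRM_sets[OF N that(1)] levelD in auto)
    qed
    show ?thesis
    proof (cases "w \<le> x")
      case True
      have "prob {\<omega> \<in> space M. emeasure (N \<omega>) {f \<in> B. l < \<phi> f} = 0 \<and> R \<omega> \<le> x} =
        prob {\<omega> \<in> space M. emeasure (N \<omega>) {f \<in> B. l < \<phi> f} = 0 \<and> emeasure (N \<omega>) {f \<in> D - B. x < \<phi> f} = 0}" (is "prob ?S = prob ?S'")
      proof (rule finite_measure_eq_AE)
        show "AE \<omega> in M. (\<omega> \<in> {\<omega> \<in> space M. emeasure (N \<omega>) {f \<in> B. l < \<phi> f} = 0 \<and> R \<omega> \<le> x}) =
          (\<omega> \<in> {\<omega> \<in> space M. emeasure (N \<omega>) {f \<in> B. l < \<phi> f} = 0 \<and> emeasure (N \<omega>) {f \<in> D - B. x < \<phi> f} = 0})"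
          using R AE_space
        proof eventually_elim
          case (elim \<omega>)
          then have "R \<omega> \<le> x \<longleftrightarrow> emeasure (N \<omega>) {f \<in> D. x < \<phi> f} = 0"
            using True by blast
          with eq[of \<omega>] elim(2) show ?case by blast
        qed
      qed measurable
      also have "\<dots> = exp (- measure \<mu> {f \<in> B. l < \<phi> f}) * p x"
        using True unfolding p_def
        by (subst is_PRM_prob_zero_product[OF N levelB(1) levelG(1)])
          (auto simp only: is_PRM_prob_zero[OF N levelB(1) finB] if_True)
      finally show ?thesis .
    next
      case False
      have "AE \<omega> in M. \<not> R \<omega> \<le> x"
        using R by eventually_elim (use False in blast)
      then have "prob {\<omega> \<in> space M. emeasure (N \<omega>) {f \<in> B. l < \<phi> f} = 0 \<and> R \<omega> \<le> x} = prob {}"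
        by (intro finite_measure_eq_AE) auto
      then show ?thesis using False by (simp add: p_def)
    qed
  qed
  have R_ge: "AE \<omega> in M. w \<le> R \<omega>"
    using R by eventually_elim blast
  have p_le: "p x \<le> 1" for x
    by (simp add: p_def)
  have p_ge: "prob {\<omega> \<in> space M. R \<omega> \<le> x} \<le> p x" for x
  proof -
    show ?thesis
    proof (cases "w \<le> x")
      case True
      have "AE \<omega> in M. \<omega> \<in> {\<omega> \<in> space M. R \<omega> \<le> x} \<longrightarrow>
          \<omega> \<in> {\<omega> \<in> space M. emeasure (N \<omega>) {f \<in> D - B. x < \<phi> f} = 0}"
        using R AE_space
      proof eventually_elim
        case (elim \<omega>)
        have "emeasure (N \<omega>) {f \<in> D - B. x < \<phi> f} = 0" if "emeasure (N \<omega>) {f \<in> D. x < \<phi> f} = 0"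
          using that by (rule emeasure_eq_0[rotated]) (use is_PRM_sets[OF N elim(2)] levelD in auto)
        moreover have "R \<omega> \<le> x \<Longrightarrow> emeasure (N \<omega>) {f \<in> D. x < \<phi> f} = 0"
          using elim(1) by simp
        ultimately show ?case using elim(2) by simp
      qed
      then show ?thesis
        unfolding p_def if_P[OF True] by (rule finite_measure_mono_AE) measurable
    next
      case False
      have "AE \<omega> in M. \<not> R \<omega> \<le> x"
        using R by eventually_elim (use False in blast)
      then have "prob {\<omega> \<in> space M. R \<omega> \<le> x} = prob {}"
        by (intro finite_measure_eq_AE) auto
      then show ?thesis using False by (simp add: p_def)
    qed
  qed
  \<comment> \<open>\<open>p\<close> is squeezed between the distribution function of
    \<open>R\<close> and 1.\<close>
  have p_lim: "(\<lambda>j. p (real j / real (Suc n))) \<longlonglongrightarrow> 1" for n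
  proof (rule tendsto_sandwich)
    interpret R: real_distribution "distr M borel R"
      by (rule real_distribution_distr) simp
    have "(cdf (distr M borel R) \<longlongrightarrow> 1) at_top"
      by (rule R.cdf_lim_at_top_prob)
    moreover have "filterlim (\<lambda>j. real j / real (Suc n)) at_top sequentially"
      by (intro filterlim_at_top_mult_tendsto_pos[OF tendsto_const _ filterlim_real_sequentially,
        of "1 / real (Suc n)", simplified mult.commute[of "1 / _"] times_divide_eq_right mult_1_right]) simp
    ultimately have "(\<lambda>j. cdf (distr M borel R) (real j / real (Suc n))) \<longlonglongrightarrow> 1"
      by (rule filterlim_compose)
    also have "cdf (distr M borel R) = (\<lambda>x. prob {\<omega> \<in> space M. R \<omega> \<le> x})"
      by (auto simp: cdf_def measure_distr intro!: ext arg_cong[of _ _ prob])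
    finally show "(\<lambda>j. prob {\<omega> \<in> space M. R \<omega> \<le> real j / real (Suc n)}) \<longlonglongrightarrow> 1" .
  qed (use p_le p_ge in auto)
  \<comment> \<open>The largest grid point strictly below \<open>x\<close>; hence the
    \<open>- 1\<close>. Approaching \<open>R\<close> strictly from the left turns the condition
    \<open>\<phi> f \<le> l\<close> of \<open>c\<close> into \<open>\<phi> f < R\<close> in the
    limit, and grid points are admissible choices of the rational \<open>q\<close> in the
    claim.\<close>
  define l where "l n x = (of_int \<lceil>real (Suc n) * x\<rceil> - 1) / real (Suc n)" for n and x :: real
  have l_Rats: "l n x \<in> \<rat>" for n x
    by (auto simp: l_def)
  have l_less: "l n x < x" for n x
  proof -
    have "of_int \<lceil>real (Suc n) * x\<rceil> - 1 < real (Suc n) * x" by linarith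
    then show ?thesis by (simp add: l_def field_simps del: of_nat_Suc)
  qed
  have l_lim: "(\<lambda>n. l n x) \<longlonglongrightarrow> x" for x
  proof -
    have "(\<lambda>n. of_int \<lceil>real (Suc n) * x\<rceil> / real (Suc n) - inverse (real (Suc n))) \<longlonglongrightarrow> x - 0"
      by (intro tendsto_diff real_ceiling_divide_tendsto LIMSEQ_inverse_real_of_nat)
    then show ?thesis
      by (simp add: l_def diff_divide_distrib inverse_eq_divide)
  qed
  define T where "T n \<omega> = \<tau> (l n (R \<omega>)) \<omega>" for n \<omega>
  have T_meas [measurable]: "T n \<in> borel_measurable M" for n
    unfolding T_def l_def
    by (rule measurable_compose_countable[where f="\<lambda>i. \<tau> ((of_int i - 1) / real (Suc n))"
          and g="\<lambda>\<omega>. \<lceil>real (Suc n) * R \<omega>\<rceil>"]) measurable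
  have T_integral: "(\<integral>\<^sup>+\<omega>. T n \<omega> \<partial>M) = ennreal (exp (- measure \<mu> B))" for n
  proof -
    \<comment> \<open>On the cell \<open>v j < R \<le> u j\<close> the rounded level is the constant
      \<open>v j\<close>, so \<open>joint\<close> applies at both ends of the cell. Since
      \<open>u j = v (Suc j)\<close>, the sum over the cells telescopes. It starts at
      \<open>j = 0\<close> because \<open>R\<close> may be 0, and \<open>p (v 0) = 0\<close> because
      \<open>v 0\<close> is negative while \<open>w\<close> is not.\<close>
    define u where "u j = real j / real (Suc n)" for j
    define v where "v j = (real j - 1) / real (Suc n)" for j
    have vu: "v j \<le> u j" for j
      by (simp add: u_def v_def divide_right_mono)
    have "(\<integral>\<^sup>+\<omega>. T n \<omega> \<partial>M) = (\<Sum>j. \<integral>\<^sup>+\<omega>. T n \<omega> * indicator {\<omega>. nat \<lceil>real (Suc n) * R \<omega>\<rceil> = j} \<omega> \<partial>M)"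
      by (intro nn_integral_split_index) measurable
    also have "\<dots> = (\<Sum>j. ennreal (exp (- measure \<mu> B) * (p (u j) - p (v j))))"
    proof (intro arg_cong[of _ _ suminf] ext)
      fix j
      let ?E = "{\<omega> \<in> space M. emeasure (N \<omega>) {f \<in> B. v j < \<phi> f} = 0 \<and> R \<omega> \<le> u j}"
      let ?E' = "{\<omega> \<in> space M. emeasure (N \<omega>) {f \<in> B. v j < \<phi> f} = 0 \<and> R \<omega> \<le> v j}"
      have "(\<integral>\<^sup>+\<omega>. T n \<omega> * indicator {\<omega>. nat \<lceil>real (Suc n) * R \<omega>\<rceil> = j} \<omega> \<partial>M) =
          (\<integral>\<^sup>+\<omega>. c (v j) * indicator (?E - ?E') \<omega> \<partial>M)"
      proof (rule nn_integral_cong_AE)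
        show "AE \<omega> in M. T n \<omega> * indicator {\<omega>. nat \<lceil>real (Suc n) * R \<omega>\<rceil> = j} \<omega> =
            c (v j) * indicator (?E - ?E') \<omega>"
          using R_ge AE_space
        proof eventually_elim
          case (elim \<omega>)
          have nonneg: "0 \<le> real (Suc n) * R \<omega>"
            using elim w by simp
          have *: "nat \<lceil>real (Suc n) * R \<omega>\<rceil> = j \<longleftrightarrow> v j < R \<omega> \<and> R \<omega> \<le> u j"
          proof -
            have "nat \<lceil>real (Suc n) * R \<omega>\<rceil> = j \<longleftrightarrow> \<lceil>real (Suc n) * R \<omega>\<rceil> = int j"
              using nonneg by linarith
            also have "\<dots> \<longleftrightarrow> real j - 1 < real (Suc n) * R \<omega> \<and> real (Suc n) * R \<omega> \<le> real j"
              by (auto simp: ceiling_eq_iff)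
            finally show ?thesis
              by (simp add: u_def v_def field_simps del: of_nat_Suc)
          qed
          show ?case
          proof (cases "nat \<lceil>real (Suc n) * R \<omega>\<rceil> = j")
            case True
            then have "\<lceil>real (Suc n) * R \<omega>\<rceil> = int j"
              using nonneg by linarith
            then have "l n (R \<omega>) = v j"
              by (simp add: l_def v_def)
            with True * elim(2) show ?thesis
              by (auto simp: T_def \<tau>_def indicator_def)
          next
            case False
            with * show ?thesis by (auto simp: indicator_def)
          qed
        qed
      qed
      also have "\<dots> = c (v j) * emeasure M (?E - ?E')"
        by (rule nn_integral_cmult_indicator) measurable
      also have "emeasure M (?E - ?E') = ennreal (prob ?E - prob ?E')"
        using vu[of j] by (subst emeasure_eq_measure, subst finite_measure_Diff) (auto, measurable)
      also have "prob ?E - prob ?E' = exp (- measure \<mu> {f \<in> B. v j < \<phi> f}) * (p (u j) - p (v j))"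
        using vu[of j] by (simp add: joint right_diff_distrib)
      also have "c (v j) * ennreal (exp (- measure \<mu> {f \<in> B. v j < \<phi> f}) * (p (u j) - p (v j))) =
          ennreal ((exp (- measure \<mu> {f \<in> B. \<phi> f \<le> v j}) * exp (- measure \<mu> {f \<in> B. v j < \<phi> f})) * (p (u j) - p (v j)))"
        unfolding c_def by (subst ennreal_mult'[symmetric]) (simp_all add: mult.assoc)
      also have "exp (- measure \<mu> {f \<in> B. \<phi> f \<le> v j}) * exp (- measure \<mu> {f \<in> B. v j < \<phi> f}) = exp (- measure \<mu> B)"
      proof -
        have "measure \<mu> ({f \<in> B. \<phi> f \<le> v j} \<union> {f \<in> B. v j < \<phi> f}) =
            measure \<mu> {f \<in> B. \<phi> f \<le> v j} + measure \<mu> {f \<in> B. v j < \<phi> f}"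
          by (rule measure_Union) (use finB levelB in \<open>auto simp: less_top\<close>)
        moreover have "{f \<in> B. \<phi> f \<le> v j} \<union> {f \<in> B. v j < \<phi> f} = B" by auto
        ultimately show ?thesis by (simp add: exp_add[symmetric])
      qed
      finally show "(\<integral>\<^sup>+\<omega>. T n \<omega> * indicator {\<omega>. nat \<lceil>real (Suc n) * R \<omega>\<rceil> = j} \<omega> \<partial>M) =
        ennreal (exp (- measure \<mu> B) * (p (u j) - p (v j)))" .
    qed
    also have "\<dots> = ennreal (exp (- measure \<mu> B) * 1)"
    proof (rule suminf_ennreal_eq)
      have mono: "p (v j) \<le> p (u j)" for j
      proof -
        have "exp (- measure \<mu> {f \<in> B. v j < \<phi> f}) * p (v j) \<le> exp (- measure \<mu> {f \<in> B. v j < \<phi> f}) * p (u j)"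
          using vu[of j] unfolding joint[OF order_refl, symmetric] joint[OF vu, symmetric]
          by (intro finite_measure_mono) (auto, measurable)
        then show ?thesis by simp
      qed
      then show "0 \<le> exp (- measure \<mu> B) * (p (u j) - p (v j))" for j by simp
      have "(\<lambda>j. p (u j) - p (v j)) sums (1 - p (v 0))"
      proof -
        have "(\<lambda>j. p (v j)) \<longlonglongrightarrow> 1"
        proof (subst filterlim_sequentially_Suc[symmetric])
          show "(\<lambda>j. p (v (Suc j))) \<longlonglongrightarrow> 1"
            using p_lim[of n] by (simp add: v_def)
        qed
        then have "(\<lambda>j. p (v (Suc j)) - p (v j)) sums (1 - p (v 0))"
          by (rule telescope_sums)
        then show ?thesis by (simp add: u_def v_def)
      qed
      moreover have "p (v 0) = 0"
      proof -
        have "v 0 < 0" by (simp add: v_def field_simps)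
        with w show ?thesis by (simp add: p_def)
      qed
      ultimately show "(\<lambda>j. exp (- measure \<mu> B) * (p (u j) - p (v j))) sums (exp (- measure \<mu> B) * 1)"
        by (intro sums_mult) simp
    qed
    finally show ?thesis by simp
  qed
  define L where "L \<omega> = indicator {\<omega>. \<exists>q\<in>\<rat>. q < R \<omega> \<and> emeasure (N \<omega>) {f \<in> B. q < \<phi> f} = 0} \<omega>
      * ennreal (exp (- measure \<mu> {f \<in> B. \<phi> f < R \<omega>}))" for \<omega>
  have lim: "(\<lambda>n. T n \<omega>) \<longlonglongrightarrow> L \<omega>" if \<omega>: "\<omega> \<in> space M" for \<omega>
  proof (cases "\<exists>q\<in>\<rat>. q < R \<omega> \<and> emeasure (N \<omega>) {f \<in> B. q < \<phi> f} = 0")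
    case True
    then obtain q where q: "q < R \<omega>" "emeasure (N \<omega>) {f \<in> B. q < \<phi> f} = 0" by auto
    have "\<forall>\<^sub>F n in sequentially. q < l n (R \<omega>)"
      using l_lim q(1) by (rule order_tendstoD)
    then have "\<forall>\<^sub>F n in sequentially. c (l n (R \<omega>)) = T n \<omega>"
    proof eventually_elim
      case (elim n)
      have "emeasure (N \<omega>) {f \<in> B. l n (R \<omega>) < \<phi> f} = 0"
        by (rule emeasure_eq_0[OF _ q(2)]) (use elim is_PRM_sets[OF N \<omega>] levelB in auto)
      then show ?case by (simp add: T_def \<tau>_def)
    qed
    moreover have "(\<lambda>n. c (l n (R \<omega>))) \<longlonglongrightarrow> L \<omega>"
    proof -
      have "(\<lambda>n. measure \<mu> {f \<in> B. \<phi> f \<le> l n (R \<omega>)}) \<longlonglongrightarrow> measure \<mu> {f \<in> B. \<phi> f < R \<omega>}"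
      proof -
        have "(\<lambda>n. \<integral>f. indicator {f \<in> B. \<phi> f \<le> l n (R \<omega>)} f \<partial>\<mu>) \<longlonglongrightarrow> (\<integral>f. indicator {f \<in> B. \<phi> f < R \<omega>} f \<partial>\<mu> :: real)"
        proof (rule integral_dominated_convergence[where w="indicator B"])
          show "integrable \<mu> (indicator B :: _ \<Rightarrow> real)"
            using fin by simp
          show "AE f in \<mu>. (\<lambda>n. indicator {f \<in> B. \<phi> f \<le> l n (R \<omega>)} f :: real) \<longlonglongrightarrow> indicator {f \<in> B. \<phi> f < R \<omega>} f"
          proof (rule AE_I2)
            fix f
            show "(\<lambda>n. indicator {f \<in> B. \<phi> f \<le> l n (R \<omega>)} f :: real) \<longlonglongrightarrow> indicator {f \<in> B. \<phi> f < R \<omega>} f"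
            proof (cases "\<phi> f < R \<omega>")
              case True
              have "\<forall>\<^sub>F n in sequentially. \<phi> f < l n (R \<omega>)"
                using l_lim True by (rule order_tendstoD)
              then show ?thesis
                by (rule tendsto_eventually[OF eventually_mono]) (use True in \<open>auto simp: indicator_def\<close>)
            next
              case False
              then have "\<not> \<phi> f \<le> l n (R \<omega>)" for n
                using l_less[of n "R \<omega>"] by linarith
              with False show ?thesis by simp
            qed
          qed
        qed (use levelB in \<open>auto simp: indicator_def\<close>)
        then show ?thesis
          using sets.sets_into_space[OF \<open>B \<in> sets \<mu>\<close>] by (simp add: Int_absorb2 subset_iff)
      qed
      then show ?thesis
        using True by (auto simp: L_def c_def intro!: tendsto_intros)
    qed
    ultimately show ?thesis
      by (rule Lim_transform_eventually[rotated])
  next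
    case False
    \<comment> \<open>Otherwise the rational level \<open>l n (R \<omega>)\<close> would itself
      serve as \<open>q\<close>.\<close>
    then have "T n \<omega> = 0" for n
      using l_less l_Rats by (auto simp: T_def \<tau>_def indicator_def)
    with False show ?thesis by (simp add: L_def)
  qed
  have L_meas [measurable]: "L \<in> borel_measurable M"
    by (rule borel_measurable_LIMSEQ_order[OF lim T_meas])
  have "(\<lambda>n. \<integral>\<^sup>+\<omega>. T n \<omega> \<partial>M) \<longlonglongrightarrow> (\<integral>\<^sup>+\<omega>. L \<omega> \<partial>M)"
  proof (rule nn_integral_dominated_convergence[where w="\<lambda>_. 1"])
    show "AE \<omega> in M. T n \<omega> \<le> 1" for n
      by (auto simp: T_def \<tau>_def c_def indicator_def)
    show "AE \<omega> in M. (\<lambda>n. T n \<omega>) \<longlonglongrightarrow> L \<omega>"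
      using lim by (rule AE_I2)
  qed (auto simp: emeasure_space_1)
  then have "(\<integral>\<^sup>+\<omega>. L \<omega> \<partial>M) = ennreal (exp (- measure \<mu> B))"
    unfolding T_integral by (simp add: LIMSEQ_const_iff)
  then show ?thesis by (simp add: L_def)
qed

text \<open>Whether \<open>R\<close> is at most \<open>u\<close> is decided by the points above
  level \<open>u\<close>, while \<open>A\<close> lies at levels up to \<open>u\<close>; the two sets
  are disjoint, hence their counts independent. For a fixed state of the algorithm this is the
  hypothesis \<open>indep\<close> of the next lemma.\<close>

lemma is_PRM_nn_integral_below_level:
  fixes \<phi> :: "'b \<Rightarrow> real" and R :: "'a \<Rightarrow> real"
  assumes N: "is_PRM M N \<mu>" and [measurable]: "\<phi> \<in> borel_measurable \<mu>" "D \<in> sets \<mu>"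
    and R_meas [measurable]: "R \<in> borel_measurable M"
    and R: "AE \<omega> in M. \<forall>x. R \<omega> \<le> x \<longleftrightarrow> w \<le> x \<and> emeasure (N \<omega>) {f \<in> D. x < \<phi> f} = 0"
    and A: "A \<in> sets \<mu>" and Au: "\<And>f. f \<in> A \<Longrightarrow> \<phi> f \<le> u"
  shows "(\<integral>\<^sup>+\<omega>. emeasure (N \<omega>) A * indicator {..u} (R \<omega>) \<partial>M) = emeasure \<mu> A * (\<integral>\<^sup>+\<omega>. indicator {..u} (R \<omega>) \<partial>M)"
proof -
  have Du: "{f \<in> D. u < \<phi> f} \<in> sets \<mu>"
  proof -
    have "{f \<in> D. u < \<phi> f} = {f \<in> space \<mu>. f \<in> D \<and> u < \<phi> f}"
      using sets.sets_into_space[OF \<open>D \<in> sets \<mu>\<close>] by auto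
    then show ?thesis by simp
  qed
  note [measurable] = is_PRM_measurable_emeasure[OF N A] is_PRM_measurable_emeasure[OF N Du]
  \<comment> \<open>The deterministic part of the event that \<open>R\<close> is at most
    \<open>u\<close>.\<close>
  define b :: ennreal where "b = (if w \<le> u then 1 else 0)"
  have eq: "AE \<omega> in M. indicator {..u} (R \<omega>) = indicator {0} (emeasure (N \<omega>) {f \<in> D. u < \<phi> f}) * b"
    using R
  proof eventually_elim
    case (elim \<omega>)
    then have "R \<omega> \<le> u \<longleftrightarrow> w \<le> u \<and> emeasure (N \<omega>) {f \<in> D. u < \<phi> f} = 0" by simp
    then show ?case by (auto simp: indicator_def b_def)
  qed
  have "(\<integral>\<^sup>+\<omega>. emeasure (N \<omega>) A * indicator {..u} (R \<omega>) \<partial>M) =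
      (\<integral>\<^sup>+\<omega>. (emeasure (N \<omega>) A * indicator {0} (emeasure (N \<omega>) {f \<in> D. u < \<phi> f})) * b \<partial>M)"
    by (rule nn_integral_cong_AE) (use eq in eventually_elim, simp add: mult.assoc)
  also have "\<dots> = (\<integral>\<^sup>+\<omega>. emeasure (N \<omega>) A * indicator {0} (emeasure (N \<omega>) {f \<in> D. u < \<phi> f}) \<partial>M) * b"
    by (rule nn_integral_multc) measurable
  also have "\<dots> = (\<integral>\<^sup>+\<omega>. emeasure (N \<omega>) A \<partial>M) *
      (\<integral>\<^sup>+\<omega>. indicator {0} (emeasure (N \<omega>) {f \<in> D. u < \<phi> f}) \<partial>M) * b"
    by (subst is_PRM_disjoint_product[OF N A Du, where \<phi>="\<lambda>x. x"]) (use Au in \<open>auto dest: leD\<close>)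
  also have "\<dots> = emeasure \<mu> A * ((\<integral>\<^sup>+\<omega>. indicator {0} (emeasure (N \<omega>) {f \<in> D. u < \<phi> f}) \<partial>M) * b)"
    by (simp add: is_PRM_nn_integral[OF N A] mult.assoc)
  also have "(\<integral>\<^sup>+\<omega>. indicator {0} (emeasure (N \<omega>) {f \<in> D. u < \<phi> f}) \<partial>M) * b =
      (\<integral>\<^sup>+\<omega>. indicator {0} (emeasure (N \<omega>) {f \<in> D. u < \<phi> f}) * b \<partial>M)"
    by (rule nn_integral_multc[symmetric]) measurable
  also have "\<dots> = (\<integral>\<^sup>+\<omega>. indicator {..u} (R \<omega>) \<partial>M)"
    by (rule nn_integral_cong_AE) (use eq in eventually_elim, simp)
  finally show ?thesis .
qed

text \<open>A weak form of Mecke's formula: the hypothesis \<open>indep\<close> says that whether \<open>R\<close> is at most \<open>u\<close> does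
  not depend on the points at levels up to \<open>u\<close>. Discretising the levels extends this to \<open>u\<close> being the
  level of the point itself.\<close>

lemma nn_integral_points_above_level:
  fixes \<phi> :: "'b \<Rightarrow> real" and R :: "'a \<Rightarrow> real" and K :: "'a \<Rightarrow> 'b measure"
  assumes sets_K: "\<And>\<omega>. \<omega> \<in> space M \<Longrightarrow> sets (K \<omega>) = sets \<mu>"
    and K_meas: "\<And>A. A \<in> sets \<mu> \<Longrightarrow> (\<lambda>\<omega>. emeasure (K \<omega>) A) \<in> borel_measurable M"
    and K_mean: "\<And>A. A \<in> sets \<mu> \<Longrightarrow> (\<integral>\<^sup>+\<omega>. emeasure (K \<omega>) A \<partial>M) = emeasure \<mu> A"
    and \<phi> [measurable]: "\<phi> \<in> borel_measurable \<mu>"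
    and fin: "\<And>c. 0 < c \<Longrightarrow> emeasure \<mu> {f \<in> space \<mu>. c < \<phi> f} < \<infinity>"
    and R_meas [measurable]: "R \<in> borel_measurable M" and R_pos: "AE \<omega> in M. 0 < R \<omega>"
    and indep: "\<And>A u. A \<in> sets \<mu> \<Longrightarrow> (\<And>f. f \<in> A \<Longrightarrow> \<phi> f \<le> u) \<Longrightarrow>
      (\<integral>\<^sup>+\<omega>. emeasure (K \<omega>) A * indicator {..u} (R \<omega>) \<partial>M) = emeasure \<mu> A * (\<integral>\<^sup>+\<omega>. indicator {..u} (R \<omega>) \<partial>M)"
  shows "(\<integral>\<^sup>+\<omega>. emeasure (K \<omega>) {f \<in> space \<mu>. R \<omega> \<le> \<phi> f} \<partial>M) = (\<integral>\<^sup>+\<omega>. emeasure \<mu> {f \<in> space \<mu>. R \<omega> \<le> \<phi> f} \<partial>M)"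
proof -
  \<comment> \<open>\<open>V\<close> compares \<open>r\<close> with the level rounded up to the
    grid. On the cell \<open>A c n j\<close> this comparison reads
    \<open>r \<le> real j / real (Suc n)\<close>, and all levels in the cell are at most that bound,
    as \<open>indep\<close> demands. The cut-off \<open>c\<close> keeps the intensity finite and is
    sent to 0 at the end.\<close>
  define V where "V c n r = {f \<in> space \<mu>. c < \<phi> f \<and> r \<le> of_int \<lceil>real (Suc n) * \<phi> f\<rceil> / real (Suc n)}"
    for c n and r :: real
  define A where "A c n j = {f \<in> space \<mu>. c < \<phi> f \<and> \<lceil>real (Suc n) * \<phi> f\<rceil> = int j}" for c n j
  have A_sets [measurable]: "A c n j \<in> sets \<mu>" and V_sets: "V c n r \<in> sets \<mu>" for c n j r
    by (simp_all add: A_def V_def)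
  have V_split: "emeasure \<nu> (V c n r) = (\<Sum>j. emeasure \<nu> (A c n j) * indicator {..real j / real (Suc n)} r)"
    if sets: "sets \<nu> = sets \<mu>" and c: "0 < c" for \<nu> c n r
  proof -
    note [measurable_cong] = sets
    have sp: "space \<nu> = space \<mu>" using sets by (rule sets_eq_imp_space_eq)
    have "emeasure \<nu> (V c n r) = (\<integral>\<^sup>+f. indicator (V c n r) f \<partial>\<nu>)"
      using V_sets sets by simp
    also have "\<dots> = (\<Sum>j. \<integral>\<^sup>+f. indicator (V c n r) f * indicator {f. nat \<lceil>real (Suc n) * \<phi> f\<rceil> = j} f \<partial>\<nu>)"
      by (rule nn_integral_split_index) (use V_sets in measurable)
    also have "\<dots> = (\<Sum>j. \<integral>\<^sup>+f. indicator {..real j / real (Suc n)} r * indicator (A c n j) f \<partial>\<nu>)"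
    proof (intro arg_cong[of _ _ suminf] ext nn_integral_cong)
      fix j f assume "f \<in> space \<nu>"
      show "indicator (V c n r) f * indicator {f. nat \<lceil>real (Suc n) * \<phi> f\<rceil> = j} f =
          (indicator {..real j / real (Suc n)} r * indicator (A c n j) f :: ennreal)"
      proof (cases "c < \<phi> f")
        case True
        then have pos: "0 < real (Suc n) * \<phi> f" using c by simp
        show ?thesis
        proof (cases "\<lceil>real (Suc n) * \<phi> f\<rceil> = int j")
          case True
          then show ?thesis by (auto simp: V_def A_def indicator_def)
        next
          case False
          with pos have "nat \<lceil>real (Suc n) * \<phi> f\<rceil> \<noteq> j" by linarith
          with False show ?thesis by (auto simp: A_def indicator_def)
        qed
      qed (simp add: V_def A_def)
    qed
    also have "\<dots> = (\<Sum>j. emeasure \<nu> (A c n j) * indicator {..real j / real (Suc n)} r)"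
    proof (intro arg_cong[of _ _ suminf] ext)
      fix j
      have "A c n j \<in> sets \<nu>" using A_sets sets by simp
      then show "(\<integral>\<^sup>+f. indicator {..real j / real (Suc n)} r * indicator (A c n j) f \<partial>\<nu>) =
          emeasure \<nu> (A c n j) * indicator {..real j / real (Suc n)} r"
        by (simp only: nn_integral_cmult_indicator) (rule mult.commute)
    qed
    finally show ?thesis .
  qed
  have V_lim: "(\<lambda>n. emeasure \<nu> (V c n r)) \<longlonglongrightarrow> emeasure \<nu> {f \<in> space \<mu>. c < \<phi> f \<and> r \<le> \<phi> f}"
    if sets: "sets \<nu> = sets \<mu>" and fin: "emeasure \<nu> {f \<in> space \<mu>. c < \<phi> f} < \<infinity>" for \<nu> c r
  proof -
    note [measurable_cong] = sets
    have sp: "space \<nu> = space \<mu>" using sets by (rule sets_eq_imp_space_eq)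
    \<comment> \<open>Grids for successive \<open>n\<close> are not nested, so the convergence is
      dominated rather than monotone.\<close>
    have "(\<lambda>n. \<integral>\<^sup>+f. indicator (V c n r) f \<partial>\<nu>) \<longlonglongrightarrow> (\<integral>\<^sup>+f. indicator {f \<in> space \<nu>. c < \<phi> f \<and> r \<le> \<phi> f} f \<partial>\<nu>)"
    proof (rule nn_integral_dominated_convergence[where w="indicator {f \<in> space \<nu>. c < \<phi> f}"])
      show "AE f in \<nu>. indicator (V c n r) f \<le> (indicator {f \<in> space \<nu>. c < \<phi> f} f :: ennreal)" for n
        by (auto simp: V_def sp indicator_def)
      show "(\<integral>\<^sup>+f. indicator {f \<in> space \<nu>. c < \<phi> f} f \<partial>\<nu>) < \<infinity>"
        using fin by (simp add: sp[symmetric])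
      show "AE f in \<nu>. (\<lambda>n. indicator (V c n r) f :: ennreal) \<longlonglongrightarrow> indicator {f \<in> space \<nu>. c < \<phi> f \<and> r \<le> \<phi> f} f"
      proof (rule AE_I2)
        fix f assume f: "f \<in> space \<nu>"
        show "(\<lambda>n. indicator (V c n r) f :: ennreal) \<longlonglongrightarrow> indicator {f \<in> space \<nu>. c < \<phi> f \<and> r \<le> \<phi> f} f"
        proof (cases "r \<le> \<phi> f")
          case True
          have "r \<le> of_int \<lceil>real (Suc n) * \<phi> f\<rceil> / real (Suc n)" for n
          proof -
            have "real (Suc n) * r \<le> real (Suc n) * \<phi> f" using True by (intro mult_left_mono) auto
            then have "real (Suc n) * r \<le> of_int \<lceil>real (Suc n) * \<phi> f\<rceil>" by linarith
            then show ?thesis by (simp add: field_simps del: of_nat_Suc)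
          qed
          with True f show ?thesis by (simp add: V_def sp indicator_def)
        next
          case False
          then have "\<forall>\<^sub>F n in sequentially. of_int \<lceil>real (Suc n) * \<phi> f\<rceil> / real (Suc n) < r"
            by (intro order_tendstoD[OF real_ceiling_divide_tendsto]) simp
          then show ?thesis
            by (rule tendsto_eventually[OF eventually_mono]) (use False in \<open>auto simp: V_def\<close>)
        qed
      qed
    qed (use V_sets sets in auto)
    then show ?thesis
      using V_sets sets by (simp add: sp)
  qed
  have V_mean: "(\<integral>\<^sup>+\<omega>. emeasure (K \<omega>) (V c n (R \<omega>)) \<partial>M) = (\<integral>\<^sup>+\<omega>. emeasure \<mu> (V c n (R \<omega>)) \<partial>M)"
    if c: "0 < c" for c n
  proof -
    note [measurable] = K_meas[OF A_sets]
    have "(\<integral>\<^sup>+\<omega>. emeasure (K \<omega>) (V c n (R \<omega>)) \<partial>M) =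
        (\<integral>\<^sup>+\<omega>. (\<Sum>j. emeasure (K \<omega>) (A c n j) * indicator {..real j / real (Suc n)} (R \<omega>)) \<partial>M)"
      by (intro nn_integral_cong V_split[OF sets_K c])
    also have "\<dots> = (\<Sum>j. \<integral>\<^sup>+\<omega>. emeasure (K \<omega>) (A c n j) * indicator {..real j / real (Suc n)} (R \<omega>) \<partial>M)"
      by (intro nn_integral_suminf) measurable
    also have "\<dots> = (\<Sum>j. \<integral>\<^sup>+\<omega>. emeasure \<mu> (A c n j) * indicator {..real j / real (Suc n)} (R \<omega>) \<partial>M)"
    proof (intro arg_cong[of _ _ suminf] ext)
      fix j
      have "\<phi> f \<le> real j / real (Suc n)" if "f \<in> A c n j" for f
      proof -
        have "real (Suc n) * \<phi> f \<le> real j"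
          using that le_of_int_ceiling[of "real (Suc n) * \<phi> f"] by (simp add: A_def)
        then show ?thesis by (simp add: field_simps del: of_nat_Suc)
      qed
      then show "(\<integral>\<^sup>+\<omega>. emeasure (K \<omega>) (A c n j) * indicator {..real j / real (Suc n)} (R \<omega>) \<partial>M) =
          (\<integral>\<^sup>+\<omega>. emeasure \<mu> (A c n j) * indicator {..real j / real (Suc n)} (R \<omega>) \<partial>M)"
        by (subst indep[OF A_sets], simp) (rule nn_integral_cmult[symmetric], measurable)
    qed
    also have "\<dots> = (\<integral>\<^sup>+\<omega>. (\<Sum>j. emeasure \<mu> (A c n j) * indicator {..real j / real (Suc n)} (R \<omega>)) \<partial>M)"
      by (intro nn_integral_suminf[symmetric]) measurable
    also have "\<dots> = (\<integral>\<^sup>+\<omega>. emeasure \<mu> (V c n (R \<omega>)) \<partial>M)"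
      by (intro nn_integral_cong V_split[symmetric] c refl)
    finally show ?thesis .
  qed
  text \<open>Replacing the quantity of interest by a lower limit makes it measurable without further ado.\<close>
  have mean: "(\<integral>\<^sup>+\<omega>. emeasure (L \<omega>) {f \<in> space \<mu>. R \<omega> \<le> \<phi> f} \<partial>M) =
      (SUP p. lim (\<lambda>n. \<integral>\<^sup>+\<omega>. emeasure (L \<omega>) (V (1 / real (Suc p)) n (R \<omega>)) \<partial>M))"
    if sets: "\<And>\<omega>. \<omega> \<in> space M \<Longrightarrow> sets (L \<omega>) = sets \<mu>"
      and L_meas: "\<And>A. A \<in> sets \<mu> \<Longrightarrow> (\<lambda>\<omega>. emeasure (L \<omega>) A) \<in> borel_measurable M"
      and L_mean: "\<And>A. A \<in> sets \<mu> \<Longrightarrow> (\<integral>\<^sup>+\<omega>. emeasure (L \<omega>) A \<partial>M) = emeasure \<mu> A" for L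
  proof -
    define c where "c p = 1 / real (Suc p)" for p
    have c: "0 < c p" for p by (simp add: c_def)
    have level: "{f \<in> space \<mu>. c p < \<phi> f} \<in> sets \<mu>" for p by measurable
    note [measurable] = L_meas[OF level] L_meas[OF A_sets]
    have VL_meas [measurable]: "(\<lambda>\<omega>. emeasure (L \<omega>) (V (c p) n (R \<omega>))) \<in> borel_measurable M" for p n
      by (subst measurable_cong[OF V_split[OF sets c]]) measurable
    have L_fin: "AE \<omega> in M. emeasure (L \<omega>) {f \<in> space \<mu>. c p < \<phi> f} < \<infinity>" for p
      using nn_integral_PInf_AE[OF L_meas[OF level, of p]] L_mean[OF level, of p] fin[OF c, of p]
      by (simp add: less_top)
    define U where "U p \<omega> = liminf (\<lambda>n. emeasure (L \<omega>) (V (c p) n (R \<omega>)))" for p \<omega>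
    have [measurable]: "U p \<in> borel_measurable M" for p
      unfolding U_def by measurable
    have U: "AE \<omega> in M. U p \<omega> = emeasure (L \<omega>) {f \<in> space \<mu>. c p < \<phi> f \<and> R \<omega> \<le> \<phi> f}" for p
      using L_fin[of p] AE_space
    proof eventually_elim
      case (elim \<omega>)
      show ?case
        unfolding U_def using V_lim[OF sets[OF elim(2)] elim(1)] by (intro lim_imp_Liminf) auto
    qed
    have UL: "(\<lambda>n. \<integral>\<^sup>+\<omega>. emeasure (L \<omega>) (V (c p) n (R \<omega>)) \<partial>M) \<longlonglongrightarrow> (\<integral>\<^sup>+\<omega>. U p \<omega> \<partial>M)" for p
    proof (rule nn_integral_dominated_convergence[where w="\<lambda>\<omega>. emeasure (L \<omega>) {f \<in> space \<mu>. c p < \<phi> f}"])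
      show "AE \<omega> in M. emeasure (L \<omega>) (V (c p) n (R \<omega>)) \<le> emeasure (L \<omega>) {f \<in> space \<mu>. c p < \<phi> f}" for n
        by (rule AE_I2, rule emeasure_mono) (use sets level in \<open>auto simp: V_def\<close>)
      show "(\<integral>\<^sup>+\<omega>. emeasure (L \<omega>) {f \<in> space \<mu>. c p < \<phi> f} \<partial>M) < \<infinity>"
        using L_mean[OF level] fin[OF c] by simp
      show "AE \<omega> in M. (\<lambda>n. emeasure (L \<omega>) (V (c p) n (R \<omega>))) \<longlonglongrightarrow> U p \<omega>"
        using L_fin[of p] U[of p] AE_space
      proof eventually_elim
        case (elim \<omega>)
        show ?case
          unfolding elim(2) by (rule V_lim[OF sets[OF elim(3)] elim(1)])
      qed
    qed measurable
    have "(\<integral>\<^sup>+\<omega>. emeasure (L \<omega>) {f \<in> space \<mu>. R \<omega> \<le> \<phi> f} \<partial>M) = (\<integral>\<^sup>+\<omega>. (SUP p. U p \<omega>) \<partial>M)"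
    proof (rule nn_integral_cong_AE)
      have "AE \<omega> in M. \<forall>p. U p \<omega> = emeasure (L \<omega>) {f \<in> space \<mu>. c p < \<phi> f \<and> R \<omega> \<le> \<phi> f}"
        using U by (simp add: AE_all_countable)
      with R_pos AE_space
      show "AE \<omega> in M. emeasure (L \<omega>) {f \<in> space \<mu>. R \<omega> \<le> \<phi> f} = (SUP p. U p \<omega>)"
      proof eventually_elim
        case (elim \<omega>)
        have "(SUP p. emeasure (L \<omega>) {f \<in> space \<mu>. c p < \<phi> f \<and> R \<omega> \<le> \<phi> f}) =
            emeasure (L \<omega>) (\<Union>p. {f \<in> space \<mu>. c p < \<phi> f \<and> R \<omega> \<le> \<phi> f})"
        proof (rule SUP_emeasure_incseq)
          have "{f \<in> space \<mu>. c p < \<phi> f \<and> R \<omega> \<le> \<phi> f} \<in> sets \<mu>" for p by measurable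
          then show "range (\<lambda>p. {f \<in> space \<mu>. c p < \<phi> f \<and> R \<omega> \<le> \<phi> f}) \<subseteq> sets (L \<omega>)"
            unfolding sets[OF elim(2)] by blast
          have "c (Suc p) \<le> c p" for p by (simp add: c_def field_simps)
          then show "incseq (\<lambda>p. {f \<in> space \<mu>. c p < \<phi> f \<and> R \<omega> \<le> \<phi> f})"
            by (intro incseq_SucI) (auto intro: le_less_trans)
        qed
        also have "(\<Union>p. {f \<in> space \<mu>. c p < \<phi> f \<and> R \<omega> \<le> \<phi> f}) = {f \<in> space \<mu>. R \<omega> \<le> \<phi> f}"
        proof -
          \<comment> \<open>Positivity of \<open>R\<close> enters here: once the cut-off is below
            \<open>R \<omega>\<close>, it no longer removes anything.\<close>
          obtain p where "c p < R \<omega>"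
            using elim(1) reals_Archimedean[of "R \<omega>"] by (auto simp: c_def inverse_eq_divide)
          then have "\<exists>p. c p < \<phi> f" if "R \<omega> \<le> \<phi> f" for f
            using that by (intro exI[of _ p]) linarith
          then show ?thesis by blast
        qed
        finally show ?case using elim(3) by simp
      qed
    qed
    also have "\<dots> = (SUP p. \<integral>\<^sup>+\<omega>. U p \<omega> \<partial>M)"
    proof (rule nn_integral_monotone_convergence_SUP_AE)
      show "AE \<omega> in M. U p \<omega> \<le> U (Suc p) \<omega>" for p
        using U[of p] U[of "Suc p"] AE_space
      proof eventually_elim
        case (elim \<omega>)
        have "c (Suc p) \<le> c p" by (simp add: c_def field_simps)
        moreover have "{f \<in> space \<mu>. c (Suc p) < \<phi> f \<and> R \<omega> \<le> \<phi> f} \<in> sets (L \<omega>)"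
          unfolding sets[OF elim(3)] by measurable
        ultimately show ?case
          unfolding elim(1,2) by (intro emeasure_mono) auto
      qed
    qed measurable
    also have "\<dots> = (SUP p. lim (\<lambda>n. \<integral>\<^sup>+\<omega>. emeasure (L \<omega>) (V (c p) n (R \<omega>)) \<partial>M))"
      by (simp add: limI[OF UL])
    finally show ?thesis by (simp add: c_def)
  qed
  have "(\<integral>\<^sup>+\<omega>. emeasure \<mu> {f \<in> space \<mu>. R \<omega> \<le> \<phi> f} \<partial>M) =
      (SUP p. lim (\<lambda>n. \<integral>\<^sup>+\<omega>. emeasure \<mu> (V (1 / real (Suc p)) n (R \<omega>)) \<partial>M))"
    \<comment> \<open>Here \<open>L\<close> is constantly \<open>\<mu>\<close>, next it is
      \<open>K\<close>. Both means become the same limit expression in the mean masses of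
      \<open>V\<close>, which agree by \<open>V_mean\<close>.\<close>
    by (rule mean) (simp_all add: emeasure_space_1)
  moreover have "(\<integral>\<^sup>+\<omega>. emeasure (K \<omega>) {f \<in> space \<mu>. R \<omega> \<le> \<phi> f} \<partial>M) =
      (SUP p. lim (\<lambda>n. \<integral>\<^sup>+\<omega>. emeasure (K \<omega>) (V (1 / real (Suc p)) n (R \<omega>)) \<partial>M))"
    by (rule mean) (fact sets_K K_meas K_mean)+
  moreover have "(\<integral>\<^sup>+\<omega>. emeasure (K \<omega>) (V (1 / real (Suc p)) n (R \<omega>)) \<partial>M) =
      (\<integral>\<^sup>+\<omega>. emeasure \<mu> (V (1 / real (Suc p)) n (R \<omega>)) \<partial>M)" for p n
    by (rule V_mean) simp
  ultimately show ?thesis by simp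
qed

end

section \<open>A single location\<close>

text \<open>The free functions of the overview. Values are indexed by the numbers of the locations,
  so that a state \<open>y\<close> is a point of a countable product of copies of
  \<open>borel\<close>.\<close>

definition below :: "(nat \<Rightarrow> 't::metric_space) \<Rightarrow> nat set \<Rightarrow> (nat \<Rightarrow> real) \<Rightarrow> ('t \<Rightarrow> real) set" where
  "below t S y = {f \<in> C0. \<forall>k\<in>S. f (t k) < y k}"

text \<open>Given the values \<open>y\<close> of the running process at all the locations \<open>t m\<close>, and the points \<open>\<nu>\<close> offered
  at \<open>t i\<close>, the next two functions give its value at \<open>t i\<close>, respectively at \<open>t m\<close>, after \<open>t i\<close> has been treated.
  They are expressed by the vanishing of \<open>\<nu>\<close> on certain sets, indexed by rational numbers, in order to be
  measurable functions of \<open>\<nu>\<close>; the algorithm itself also depends on the order among ties.\<close>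

definition top_level :: "(nat \<Rightarrow> 't::metric_space) \<Rightarrow> nat set \<Rightarrow> nat \<Rightarrow> (nat \<Rightarrow> real) \<Rightarrow> ('t \<Rightarrow> real) measure \<Rightarrow> real" where
  "top_level t S i y \<nu> = Inf {q \<in> \<rat>. y i \<le> q \<and> emeasure \<nu> {f \<in> below t S y. q < f (t i)} = 0}"

definition next_values ::
    "(nat \<Rightarrow> 't::metric_space) \<Rightarrow> nat set \<Rightarrow> nat \<Rightarrow> (nat \<Rightarrow> real) \<Rightarrow> ('t \<Rightarrow> real) measure \<Rightarrow> nat \<Rightarrow> real" where
  "next_values t S i y \<nu> m = Inf {z \<in> \<rat>. y m \<le> z \<and>
     (\<exists>q\<in>\<rat>. q < top_level t S i y \<nu> \<and> emeasure \<nu> {f \<in> below t S y. q < f (t i) \<and> z < f (t m)} = 0)}"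

section \<open>Measurability of the new values in the old values and the offered points\<close>

lemma below_in_sets [measurable]: "finite S \<Longrightarrow> below t S y \<in> sets borel_C0"
proof -
  assume "finite S"
  have "below t S y = {f \<in> space borel_C0. \<forall>k\<in>S. f (t k) < y k}"
    by (simp add: below_def)
  also have "\<dots> \<in> sets borel_C0"
    using \<open>finite S\<close> by measurable
  finally show ?thesis .
qed

lemma Collect_in_borel_C0:
  assumes [measurable]: "A \<in> sets borel_C0" "Measurable.pred borel_C0 P"
  shows "{f \<in> A. P f} \<in> sets borel_C0"
proof -
  have "{f \<in> A. P f} = {f \<in> space borel_C0. f \<in> A \<and> P f}"
    using sets.sets_into_space[OF assms(1)] by auto
  also have "\<dots> \<in> sets borel_C0" by measurable
  finally show ?thesis .
qed

text \<open>The set itself varies with \<open>y\<close>. It is exhausted from inside by the boxes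
  \<open>C r\<close> with rational corners \<open>r\<close> strictly below \<open>y\<close>; there
  are countably many, and the set is null if and only if all these boxes are.\<close>

lemma measurable_below_null:
  assumes S: "finite S" and A [measurable]: "A \<in> sets borel_C0"
  shows "Measurable.pred ((\<Pi>\<^sub>M k\<in>UNIV. borel) \<Otimes>\<^sub>M measure_algebra borel_C0)
    (\<lambda>(y, \<nu>). emeasure \<nu> (below t S y \<inter> A) = 0)"
proof -
  define I where "I = (S \<rightarrow>\<^sub>E (\<rat> :: real set))"
  have I: "countable I"
    unfolding I_def by (intro countable_PiE S countable_rat)
  define C where "C r = {f \<in> A. \<forall>k\<in>S. f (t k) \<le> r k}" for r
  have C [measurable]: "C r \<in> sets borel_C0" for r
    unfolding C_def by (rule Collect_in_borel_C0) (use S in measurable)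
  have "emeasure \<nu> (below t S y \<inter> A) = 0 \<longleftrightarrow>
      (\<forall>r\<in>I. (\<forall>k\<in>S. r k < y k) \<longrightarrow> emeasure \<nu> (C r) = 0)"
    if sets: "sets \<nu> = sets borel_C0" for y \<nu>
  proof
    assume null: "emeasure \<nu> (below t S y \<inter> A) = 0"
    show "\<forall>r\<in>I. (\<forall>k\<in>S. r k < y k) \<longrightarrow> emeasure \<nu> (C r) = 0"
    proof (intro ballI impI)
      fix r assume r: "\<forall>k\<in>S. r k < y k"
      have "C r \<subseteq> below t S y \<inter> A"
        using r sets.sets_into_space[OF A] by (auto simp: C_def below_def intro: le_less_trans)
      then show "emeasure \<nu> (C r) = 0"
        by (intro emeasure_eq_0[OF _ null]) (use S A sets in auto)
    qed
  next
    assume *: "\<forall>r\<in>I. (\<forall>k\<in>S. r k < y k) \<longrightarrow> emeasure \<nu> (C r) = 0"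
    have "below t S y \<inter> A \<subseteq> (\<Union>r\<in>{r \<in> I. \<forall>k\<in>S. r k < y k}. C r)"
    proof
      fix f assume f: "f \<in> below t S y \<inter> A"
      then have "\<forall>k\<in>S. \<exists>q\<in>\<rat>. f (t k) < q \<and> q < y k"
        by (auto simp: below_def intro: Rats_dense_in_real)
      then obtain r where r: "\<forall>k\<in>S. r k \<in> \<rat> \<and> f (t k) < r k \<and> r k < y k"
        by metis
      then have "restrict r S \<in> {r \<in> I. \<forall>k\<in>S. r k < y k}" "f \<in> C (restrict r S)"
        using f by (auto simp: I_def C_def intro: less_imp_le)
      then show "f \<in> (\<Union>r\<in>{r \<in> I. \<forall>k\<in>S. r k < y k}. C r)" by blast
    qed
    moreover have "(\<Union>r\<in>{r \<in> I. \<forall>k\<in>S. r k < y k}. C r) \<in> null_sets \<nu>"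
      using * C sets by (intro null_sets_UN' countable_subset[OF _ I]) (auto simp: null_sets_def)
    ultimately show "emeasure \<nu> (below t S y \<inter> A) = 0"
      using S A sets by (intro null_setsD1[OF null_sets_subset]) auto
  qed
  then have eq: "(\<lambda>(y, \<nu>). emeasure \<nu> (below t S y \<inter> A) = 0) z \<longleftrightarrow>
      (\<lambda>(y, \<nu>). \<forall>r\<in>I. (\<forall>k\<in>S. r k < y k) \<longrightarrow> emeasure \<nu> (C r) = 0) z"
    if "z \<in> space ((\<Pi>\<^sub>M k\<in>UNIV. borel) \<Otimes>\<^sub>M measure_algebra borel_C0)" for z
    using that by (auto simp: space_pair_measure space_measure_algebra)
  have "Measurable.pred ((\<Pi>\<^sub>M k\<in>UNIV. borel) \<Otimes>\<^sub>M measure_algebra borel_C0)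
      (\<lambda>(y, \<nu>). \<forall>r\<in>I. (\<forall>k\<in>S. r k < y k) \<longrightarrow> emeasure \<nu> (C r) = 0)"
    unfolding case_prod_beta
  proof (rule measurable_pred_countable(1)[OF I])
    fix r
    show "Measurable.pred ((\<Pi>\<^sub>M k\<in>UNIV. borel) \<Otimes>\<^sub>M measure_algebra borel_C0)
        (\<lambda>x. (\<forall>k\<in>S. r k < fst x k) \<longrightarrow> emeasure (snd x) (C r) = 0)"
      using S by measurable
  qed
  then show ?thesis
    by (subst measurable_cong[OF eq])
qed

lemma measurable_Inf_Rats:
  fixes b :: "'a \<Rightarrow> real"
  assumes [measurable]: "\<And>q. q \<in> \<rat> \<Longrightarrow> Measurable.pred M (P q)" and bound: "\<And>q x. P q x \<Longrightarrow> b x \<le> q"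
  shows "(\<lambda>x. Inf {q \<in> \<rat>. P q x}) \<in> borel_measurable M"
proof (rule borel_measurableI_less)
  fix a
  \<comment> \<open>\<open>Inf {}\<close> is some fixed but unknown real number, so the empty case
    needs its own disjunct.\<close>
  have "Inf {q \<in> \<rat>. P q x} < a \<longleftrightarrow> (\<exists>q\<in>\<rat>. P q x \<and> q < a) \<or> ((\<forall>q\<in>\<rat>. \<not> P q x) \<and> Inf {} < a)" for x
  proof (cases "{q \<in> \<rat>. P q x} = {}")
    case False
    have "bdd_below {q \<in> \<rat>. P q x}" using bound by (intro bdd_belowI[of _ "b x"]) auto
    then have "Inf {q \<in> \<rat>. P q x} < a \<longleftrightarrow> (\<exists>q\<in>{q \<in> \<rat>. P q x}. q < a)"
      by (intro cInf_less_iff False)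
    with False show ?thesis by auto
  next
    case True
    then have "\<forall>q\<in>\<rat>. \<not> P q x" by auto
    then show ?thesis unfolding True by auto
  qed
  then have "{x \<in> space M. Inf {q \<in> \<rat>. P q x} < a} =
      {x \<in> space M. (\<exists>q\<in>\<rat>. P q x \<and> q < a) \<or> ((\<forall>q\<in>\<rat>. \<not> P q x) \<and> Inf {} < a)}" by simp
  also have "\<dots> \<in> sets M"
  proof -
    have [measurable]: "Measurable.pred M (\<lambda>x. \<exists>q\<in>\<rat>. P q x \<and> q < a)" "Measurable.pred M (\<lambda>x. \<forall>q\<in>\<rat>. \<not> P q x)"
      by (rule measurable_pred_countable[OF countable_rat]; measurable)+
    show ?thesis by measurable
  qed
  finally show "{x \<in> space M. Inf {q \<in> \<rat>. P q x} < a} \<in> sets M" .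
qed

lemma Inf_Rats_atLeast: "Inf {q \<in> \<rat>. x \<le> q} = (x :: real)"
proof (rule antisym)
  have bdd: "bdd_below {q \<in> \<rat>. x \<le> q}" by (rule bdd_belowI[of _ x]) simp
  show "Inf {q \<in> \<rat>. x \<le> q} \<le> x"
  proof (rule dense_ge)
    fix y assume "x < y"
    then obtain q where "q \<in> \<rat>" "x < q" "q < y" using Rats_dense_in_real by blast
    then show "Inf {q \<in> \<rat>. x \<le> q} \<le> y"
      using cInf_lower[OF _ bdd, of q] by simp
  qed
  show "x \<le> Inf {q \<in> \<rat>. x \<le> q}"
  proof (rule cInf_greatest)
    show "{q \<in> \<rat>. x \<le> q} \<noteq> {}"
      using Rats_dense_in_real[of x "x + 1"] by (auto intro: less_imp_le)
  qed simp
qed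

lemma measurable_top_level:
  assumes S: "finite S"
  shows "(\<lambda>(y, \<nu>). top_level t S i y \<nu>) \<in> borel_measurable ((\<Pi>\<^sub>M k\<in>UNIV. borel) \<Otimes>\<^sub>M measure_algebra borel_C0)"
  unfolding top_level_def case_prod_beta
proof (rule measurable_Inf_Rats[where b="\<lambda>x. fst x i"])
  fix q :: real
  have "Measurable.pred ((\<Pi>\<^sub>M k\<in>UNIV. borel) \<Otimes>\<^sub>M measure_algebra borel_C0)
      (\<lambda>(y, \<nu>). emeasure \<nu> (below t S y \<inter> {f \<in> space borel_C0. q < f (t i)}) = 0)"
    by (rule measurable_below_null[OF S]) measurable
  moreover have "below t S y \<inter> {f \<in> space borel_C0. q < f (t i)} = {f \<in> below t S y. q < f (t i)}" for y
    by (auto simp: below_def)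
  ultimately have [measurable]: "Measurable.pred ((\<Pi>\<^sub>M k\<in>UNIV. borel) \<Otimes>\<^sub>M measure_algebra borel_C0)
      (\<lambda>x. emeasure (snd x) {f \<in> below t S (fst x). q < f (t i)} = 0)"
    by (simp add: case_prod_beta)
  show "Measurable.pred ((\<Pi>\<^sub>M k\<in>UNIV. borel) \<Otimes>\<^sub>M measure_algebra borel_C0)
      (\<lambda>x. fst x i \<le> q \<and> emeasure (snd x) {f \<in> below t S (fst x). q < f (t i)} = 0)"
    by measurable
qed simp

lemma measurable_next_values:
  assumes S: "finite S"
  shows "(\<lambda>(y, \<nu>). next_values t S i y \<nu>) \<in>
    (\<Pi>\<^sub>M k\<in>UNIV. borel) \<Otimes>\<^sub>M measure_algebra borel_C0 \<rightarrow>\<^sub>M (\<Pi>\<^sub>M k\<in>UNIV. borel)"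
proof (rule measurable_PiM_single')
  fix m
  note [measurable] = measurable_top_level[OF S, unfolded case_prod_beta]
  show "(\<lambda>x. (case x of (y, \<nu>) \<Rightarrow> next_values t S i y \<nu>) m) \<in>
      borel_measurable ((\<Pi>\<^sub>M k\<in>UNIV. borel) \<Otimes>\<^sub>M measure_algebra borel_C0)"
    unfolding next_values_def case_prod_beta
  proof (rule measurable_Inf_Rats[where b="\<lambda>x. fst x m"])
    fix z :: real
    have [measurable]: "Measurable.pred ((\<Pi>\<^sub>M k\<in>UNIV. borel) \<Otimes>\<^sub>M measure_algebra borel_C0)
        (\<lambda>x. emeasure (snd x) {f \<in> below t S (fst x). q < f (t i) \<and> z < f (t m)} = 0)" for q
    proof -
      have "Measurable.pred ((\<Pi>\<^sub>M k\<in>UNIV. borel) \<Otimes>\<^sub>M measure_algebra borel_C0)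
          (\<lambda>(y, \<nu>). emeasure \<nu> (below t S y \<inter> {f \<in> space borel_C0. q < f (t i) \<and> z < f (t m)}) = 0)"
        by (rule measurable_below_null[OF S]) measurable
      moreover have "below t S y \<inter> {f \<in> space borel_C0. q < f (t i) \<and> z < f (t m)} =
          {f \<in> below t S y. q < f (t i) \<and> z < f (t m)}" for y
        by (auto simp: below_def)
      ultimately show ?thesis
        by (simp add: case_prod_beta)
    qed
    have [measurable]: "Measurable.pred ((\<Pi>\<^sub>M k\<in>UNIV. borel) \<Otimes>\<^sub>M measure_algebra borel_C0)
        (\<lambda>x. \<exists>q\<in>\<rat>. q < top_level t S i (fst x) (snd x) \<and>
          emeasure (snd x) {f \<in> below t S (fst x). q < f (t i) \<and> z < f (t m)} = 0)"
      by (rule measurable_pred_countable(2)[OF countable_rat]) measurable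
    show "Measurable.pred ((\<Pi>\<^sub>M k\<in>UNIV. borel) \<Otimes>\<^sub>M measure_algebra borel_C0)
        (\<lambda>x. fst x m \<le> z \<and> (\<exists>q\<in>\<rat>. q < top_level t S i (fst x) (snd x) \<and>
          emeasure (snd x) {f \<in> below t S (fst x). q < f (t i) \<and> z < f (t m)} = 0))"
      by measurable
  qed simp
qed (simp add: PiE_def)

text \<open>The admissible levels form an up-set, which is nonempty by \<open>ex\<close>. It
  contains its infimum because the strict exceedance set at \<open>x\<close> is the countable union
  of those at rationals above \<open>x\<close>. Hence the rational infimum characterises all real
  \<open>x\<close>.\<close>

lemma top_level_le_iff:
  assumes S: "finite S" and sets: "sets \<nu> = sets borel_C0"
    and ex: "emeasure \<nu> {f \<in> C0. x0 < f (t i)} = 0"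
  shows "top_level t S i y \<nu> \<le> x \<longleftrightarrow> y i \<le> x \<and> emeasure \<nu> {f \<in> below t S y. x < f (t i)} = 0"
proof -
  define P where "P x \<longleftrightarrow> y i \<le> x \<and> emeasure \<nu> {f \<in> below t S y. x < f (t i)} = 0" for x
  have level: "{f \<in> A. x < f (t i)} \<in> sets \<nu>" if "A \<in> sets borel_C0" for A x
    unfolding sets by (rule Collect_in_borel_C0[OF that]) measurable
  note level_below = level[OF below_in_sets[OF S]]
  have P_mono: "P x'" if "P x" "x \<le> x'" for x x'
  proof -
    have "{f \<in> below t S y. x' < f (t i)} \<subseteq> {f \<in> below t S y. x < f (t i)}"
      using that(2) by auto
    then show ?thesis
      using that emeasure_eq_0[OF level_below] unfolding P_def by (meson order_trans)
  qed
  have "P (max x0 (y i))"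
  proof -
    have "{f \<in> below t S y. max x0 (y i) < f (t i)} \<subseteq> {f \<in> C0. x0 < f (t i)}"
      by (auto simp: below_def)
    moreover have "{f \<in> C0. x0 < f (t i)} \<in> sets \<nu>"
      using level[of C0 x0] sets.top[of borel_C0] by simp
    ultimately show ?thesis
      unfolding P_def using emeasure_eq_0[OF _ ex] by simp
  qed
  moreover obtain q where "q \<in> \<rat>" "max x0 (y i) < q"
    using Rats_dense_in_real[of "max x0 (y i)" "max x0 (y i) + 1"] by auto
  ultimately have ne: "{q \<in> \<rat>. P q} \<noteq> {}"
    using P_mono by (auto intro: less_imp_le)
  have bdd: "bdd_below {q \<in> \<rat>. P q}"
    by (rule bdd_belowI[of _ "y i"]) (simp add: P_def)
  have "Inf {q \<in> \<rat>. P q} \<le> x \<longleftrightarrow> P x"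
  proof
    assume Px: "P x"
    show "Inf {q \<in> \<rat>. P q} \<le> x"
    proof (rule dense_ge)
      fix x' assume "x < x'"
      then obtain q where "q \<in> \<rat>" "x < q" "q < x'" using Rats_dense_in_real by blast
      then show "Inf {q \<in> \<rat>. P q} \<le> x'"
        using cInf_lower[OF _ bdd, of q] P_mono[OF Px, of q] by simp
    qed
  next
    assume le: "Inf {q \<in> \<rat>. P q} \<le> x"
    have above: "P x'" if "x < x'" for x'
    proof -
      have "Inf {q \<in> \<rat>. P q} < x'" using le that by simp
      then obtain q where "P q" "q < x'"
        using cInf_less_iff[OF ne bdd] by auto
      then show ?thesis using P_mono by (auto intro: less_imp_le)
    qed
    have "y i \<le> x"
      by (rule dense_ge) (use above in \<open>auto simp: P_def\<close>)
    moreover have "{f \<in> below t S y. x < f (t i)} = (\<Union>q\<in>{q \<in> \<rat>. x < q}. {f \<in> below t S y. q < f (t i)})"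
      using Rats_dense_in_real[of x] by (blast intro: less_trans)
    moreover have "(\<Union>q\<in>{q \<in> \<rat>. x < q}. {f \<in> below t S y. q < f (t i)}) \<in> null_sets \<nu>"
      using above level_below
      by (intro null_sets_UN' countable_subset[OF _ countable_rat]) (auto simp: null_sets_def P_def)
    ultimately show "P x" by (simp add: P_def null_setsD1)
  qed
  then show ?thesis by (simp add: top_level_def P_def)
qed

section \<open>The deterministic run at one location, for a fixed sequence decreasing at
  \<open>s\<close>\<close>

context
  fixes S :: "'t set" and s :: 't and x :: "'t \<Rightarrow> real" and f :: "nat \<Rightarrow> 't \<Rightarrow> real"
  assumes dec: "\<And>n. f (Suc n) s \<le> f n s"
begin

text \<open>Before the stop every function reaches the running value at \<open>s\<close>, so
  acceptance reduces to not being rejected. Accepted functions lie below \<open>x\<close> on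
  \<open>S\<close> and leave the values there unchanged, so every rejection test is made against the
  initial \<open>x\<close>. The running process is thus the maximum of \<open>x\<close> and the free
  functions seen, written through its upper bounds \<open>z\<close>.\<close>

lemma running_before_stop:
  assumes "\<forall>m<n. \<not> subextremal S s x f m"
  shows "(\<forall>r\<in>S. running S s x f n r = x r) \<and>
    (\<forall>r z. running S s x f n r \<le> z \<longleftrightarrow> x r \<le> z \<and> (\<forall>m<n. (\<forall>r\<in>S. f m r < x r) \<longrightarrow> f m r \<le> z))"
  using assms
proof (induction n)
  case (Suc n)
  define y where "y = running S s x f n"
  have IH: "\<forall>r\<in>S. y r = x r"
    "\<And>r z. y r \<le> z \<longleftrightarrow> x r \<le> z \<and> (\<forall>m<n. (\<forall>r\<in>S. f m r < x r) \<longrightarrow> f m r \<le> z)"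
    using Suc by (auto simp: y_def)
  have "y s \<le> f n s"
    using Suc.prems by (auto simp: subextremal_def y_def not_less)
  moreover have "(\<exists>r\<in>S. y r \<le> f n r) = (\<not> (\<forall>r\<in>S. f n r < x r))"
    using IH(1) by (auto simp: not_less)
  ultimately have step: "running S s x f (Suc n) = (if \<forall>r\<in>S. f n r < x r then (\<lambda>r. max (f n r) (y r)) else y)"
    unfolding running.simps(2) y_def[symmetric] Let_def by (simp only: simp_thms if_True)
  show ?case
  proof (cases "\<forall>r\<in>S. f n r < x r")
    case True
    then show ?thesis
      unfolding step using IH by (auto simp: less_Suc_eq max.absorb2 less_imp_le)
  next
    case False
    then show ?thesis
      unfolding step using IH by (auto simp: less_Suc_eq)
  qed
qed simp

text \<open>Once the free function \<open>f n0\<close> has been dealt with, the value at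
  \<open>s\<close> is at least \<open>f n0 s\<close>, and any strictly lower function stops the
  simulation.\<close>

lemma ex_subextremal:
  assumes "\<forall>r\<in>S. f n0 r < x r" "f n1 s < f n0 s"
  shows "\<exists>n. subextremal S s x f n"
proof (rule ccontr)
  assume none: "\<not> (\<exists>n. subextremal S s x f n)"
  have "n0 < n1"
    using assms(2) lift_Suc_antimono_le[of "\<lambda>n. f n s", OF dec, of n1 n0] by (meson leI not_le)
  then have "f n0 s \<le> running S s x f n1 s"
    using running_before_stop[of n1] none assms(1) by blast
  with assms(2) have "subextremal S s x f n1" by (simp add: subextremal_def)
  with none show False by blast
qed

context
  assumes ex: "\<exists>n. subextremal S s x f n"
begin

lemma stopped_unchanged: "r \<in> S \<Longrightarrow> stopped S s x f r = x r"
  unfolding stopped_def using running_before_stop[of "LEAST n. subextremal S s x f n"]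
  by (blast dest: not_less_Least)

text \<open>\<open>L\<close> is the index of the first subextremal function. By monotonicity at
  \<open>s\<close>, the functions preceding it are exactly those that reach the final value.\<close>

lemma stopped_subextremal: "\<exists>L. f L s < stopped S s x f s \<and> (\<forall>n. n < L \<longleftrightarrow> stopped S s x f s \<le> f n s) \<and>
  (\<forall>r z. stopped S s x f r \<le> z \<longleftrightarrow> x r \<le> z \<and> (\<forall>m<L. (\<forall>r\<in>S. f m r < x r) \<longrightarrow> f m r \<le> z))"
proof (intro exI conjI)
  let ?L = "LEAST n. subextremal S s x f n"
  have "subextremal S s x f ?L"
    using ex by (rule LeastI_ex)
  then show sub: "f ?L s < stopped S s x f s"
    by (simp add: subextremal_def stopped_def)
  have "?L \<notin> simulated_cont S s x f" "simulated S s x f = insert ?L (simulated_cont S s x f)"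
    using simulated_eq_insert[OF dec ex] by auto
  have mono: "f n s \<le> f m s" if "m \<le> n" for m n
    using lift_Suc_antimono_le[of "\<lambda>n. f n s", OF dec that] .
  show "\<forall>n. n < ?L \<longleftrightarrow> stopped S s x f s \<le> f n s"
  proof (intro allI iffI)
    fix n assume "n < ?L"
    then have "n \<in> simulated S s x f" "n \<noteq> ?L"
      by (auto simp: simulated_def dest: not_less_Least less_trans)
    then show "stopped S s x f s \<le> f n s"
      using simulated_eq_insert(1)[OF dec ex] by (simp add: simulated_cont_def)
  next
    fix n assume "stopped S s x f s \<le> f n s"
    then show "n < ?L"
      using sub mono[of ?L n] by (meson leD le_less_trans linorder_not_le order_trans)
  qed
  show "\<forall>r z. stopped S s x f r \<le> z \<longleftrightarrow> x r \<le> z \<and> (\<forall>m<?L. (\<forall>r\<in>S. f m r < x r) \<longrightarrow> f m r \<le> z)"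
    unfolding stopped_def using running_before_stop[of ?L] by (blast dest: not_less_Least)
qed

text \<open>At \<open>s\<close> itself the index of the stop disappears: functions from the stop
  onwards lie below the final value anyway.\<close>

lemma stopped_level_le_iff:
  "stopped S s x f s \<le> z \<longleftrightarrow> x s \<le> z \<and> (\<forall>n. (\<forall>r\<in>S. f n r < x r) \<longrightarrow> f n s \<le> z)"
proof -
  obtain L where L: "f L s < stopped S s x f s" "\<And>n. n < L \<longleftrightarrow> stopped S s x f s \<le> f n s"
    "\<And>r z. stopped S s x f r \<le> z \<longleftrightarrow> x r \<le> z \<and> (\<forall>m<L. (\<forall>r\<in>S. f m r < x r) \<longrightarrow> f m r \<le> z)"
    using stopped_subextremal by blast
  show ?thesis
  proof
    assume le: "stopped S s x f s \<le> z"
    have "f n s \<le> z" if "\<forall>r\<in>S. f n r < x r" for n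
      using le L(2)[of n] L(3)[of s z] that by (cases "n < L") auto
    with le L(3) show "x s \<le> z \<and> (\<forall>n. (\<forall>r\<in>S. f n r < x r) \<longrightarrow> f n s \<le> z)" by blast
  qed (use L(3) in blast)
qed

text \<open>At other locations the stop matters, but it can be described by a level: any
  \<open>q\<close> between the value at \<open>s\<close> of the stopping function and the final
  value selects exactly the functions before the stop, irrespective of the order among ties. The
  lower bound \<open>c\<close> permits a positive choice of \<open>q\<close> later.\<close>

lemma stopped_le_iff:
  "stopped S s x f r \<le> z \<longleftrightarrow> x r \<le> z \<and>
    (\<exists>q\<in>\<rat>. c < q \<and> q < stopped S s x f s \<and> (\<forall>n. (\<forall>r\<in>S. f n r < x r) \<longrightarrow> q < f n s \<longrightarrow> f n r \<le> z))"
  if c: "c < stopped S s x f s"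
proof -
  obtain L where L: "f L s < stopped S s x f s" "\<And>n. n < L \<longleftrightarrow> stopped S s x f s \<le> f n s"
    "\<And>r z. stopped S s x f r \<le> z \<longleftrightarrow> x r \<le> z \<and> (\<forall>m<L. (\<forall>r\<in>S. f m r < x r) \<longrightarrow> f m r \<le> z)"
    using stopped_subextremal by blast
  show ?thesis
  proof
    assume le: "stopped S s x f r \<le> z"
    obtain q where q: "q \<in> \<rat>" "max c (f L s) < q" "q < stopped S s x f s"
      using Rats_dense_in_real[of "max c (f L s)" "stopped S s x f s"] c L(1) by auto
    have "f n r \<le> z" if "\<forall>r\<in>S. f n r < x r" "q < f n s" for n
    proof -
      have "n < L"
        using that(2) q(2) lift_Suc_antimono_le[of "\<lambda>n. f n s", OF dec, of L n]
        by (meson leI less_le_trans max_less_iff_conj not_less order_less_imp_le order_trans)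
      then show ?thesis using le L(3)[of r z] that(1) by blast
    qed
    with q le L(3)[of r z] show "x r \<le> z \<and>
      (\<exists>q\<in>\<rat>. c < q \<and> q < stopped S s x f s \<and> (\<forall>n. (\<forall>r\<in>S. f n r < x r) \<longrightarrow> q < f n s \<longrightarrow> f n r \<le> z))"
      by auto
  next
    assume "x r \<le> z \<and>
      (\<exists>q\<in>\<rat>. c < q \<and> q < stopped S s x f s \<and> (\<forall>n. (\<forall>r\<in>S. f n r < x r) \<longrightarrow> q < f n s \<longrightarrow> f n r \<le> z))"
    then obtain q where q: "x r \<le> z" "q < stopped S s x f s"
      "\<And>n. (\<forall>r\<in>S. f n r < x r) \<Longrightarrow> q < f n s \<Longrightarrow> f n r \<le> z" by blast
    have "f m r \<le> z" if "m < L" "\<forall>r\<in>S. f m r < x r" for m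
      using q(3)[OF that(2)] q(2) L(2)[of m] that(1) by linarith
    with q(1) show "stopped S s x f r \<le> z" unfolding L(3) by blast
  qed
qed

end

end

text \<open>The enumeration \<open>f\<close> accounts for the points positive at \<open>t i\<close>
  only, so the mass of a set is a count of indices just for levels \<open>q \<ge> 0\<close>. The
  first function is the highest at \<open>t i\<close>, which bounds the levels of all
  points.\<close>

lemma ordered_points_level_null:
  assumes ord: "ordered_points (t i) \<nu> f" and f: "\<And>n. f n \<in> C0" and sets: "sets \<nu> = sets borel_C0"
  shows "0 < f n (t i)"
    and "A \<in> sets borel_C0 \<Longrightarrow> 0 \<le> q \<Longrightarrow> emeasure \<nu> {g \<in> A. q < g (t i)} =
      emeasure (count_space UNIV) {n. f n \<in> A \<and> q < f n (t i)}"
    and "f n (t i) \<le> f 0 (t i)"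
    and "emeasure \<nu> {g \<in> C0. f 0 (t i) < g (t i)} = 0"
proof -
  have C0: "C0 \<in> sets borel_C0"
    using sets.top[of borel_C0] by simp
  have dec: "f (Suc n) (t i) \<le> f n (t i)" for n
    using ord by (simp add: ordered_points_def)
  show le: "f n (t i) \<le> f 0 (t i)" for n
    using lift_Suc_antimono_le[of "\<lambda>n. f n (t i)", OF dec] by blast
  have count: "emeasure \<nu> {g \<in> A. q < g (t i)} = emeasure (count_space UNIV) {n. f n \<in> A \<and> q < f n (t i)}"
    if A: "A \<in> sets borel_C0" and q: "0 \<le> q" for A q
  proof -
    have "{g \<in> A. q < g (t i)} \<in> sets \<nu>"
      unfolding sets by (rule Collect_in_borel_C0[OF A]) measurable
    then have "emeasure \<nu> {g \<in> {g \<in> A. q < g (t i)}. 0 < g (t i)} =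
        emeasure (count_space UNIV) {n. f n \<in> {g \<in> A. q < g (t i)}}"
      using ord unfolding ordered_points_def by blast
    moreover have "{g \<in> {g \<in> A. q < g (t i)}. 0 < g (t i)} = {g \<in> A. q < g (t i)}"
      using q by auto
    ultimately show ?thesis by simp
  qed
  show "A \<in> sets borel_C0 \<Longrightarrow> 0 \<le> q \<Longrightarrow> emeasure \<nu> {g \<in> A. q < g (t i)} =
      emeasure (count_space UNIV) {n. f n \<in> A \<and> q < f n (t i)}"
    by (rule count)
  show "0 < f n (t i)" for n
  proof (rule ccontr)
    assume "\<not> 0 < f n (t i)"
    \<comment> \<open>On this set \<open>ordered_points\<close> equates an empty mass with the
      number of indices whose function is not positive at \<open>t i\<close>.\<close>
    have "{g \<in> C0. g (t i) \<le> 0} \<in> sets \<nu>"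
      unfolding sets by (rule Collect_in_borel_C0[OF C0]) measurable
    then have "emeasure \<nu> {g \<in> {g \<in> C0. g (t i) \<le> 0}. 0 < g (t i)} =
        emeasure (count_space UNIV) {n. f n \<in> {g \<in> C0. g (t i) \<le> 0}}"
      using ord unfolding ordered_points_def by blast
    moreover have "{g \<in> {g \<in> C0. g (t i) \<le> 0}. 0 < g (t i)} = {}" by auto
    ultimately have "emeasure \<nu> {} = emeasure (count_space UNIV) {n. f n \<in> {g \<in> C0. g (t i) \<le> 0}}"
      by (simp only:)
    then have "emeasure (count_space UNIV) {n. f n \<in> {g \<in> C0. g (t i) \<le> 0}} = 0" by simp
    then have "{n. f n \<in> {g \<in> C0. g (t i) \<le> 0}} = {}"
      by (subst (asm) emeasure_count_space_eq_0) auto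
    with f[of n] \<open>\<not> 0 < f n (t i)\<close> show False by auto
  qed
  then have "0 \<le> f 0 (t i)" by (simp add: less_imp_le)
  moreover have "{n. f n \<in> C0 \<and> f 0 (t i) < f n (t i)} = {}"
    using le by (auto dest: leD)
  ultimately show "emeasure \<nu> {g \<in> C0. f 0 (t i) < g (t i)} = 0"
    unfolding count[OF C0 \<open>0 \<le> f 0 (t i)\<close>] by (simp only: emeasure_empty)
qed

text \<open>Translates the deterministic run into events about \<open>\<nu>\<close> alone, so that
  the enumeration \<open>f\<close> survives only in the counts. Besides the bookkeeping one must
  know that the simulation stops: there are infinitely many functions, but only finite mass above
  each positive level at each location, so some function is free and another one is strictly lower
  at \<open>t i\<close>.\<close>

lemma stopped_values:
  fixes t :: "nat \<Rightarrow> 't::metric_space"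
  assumes S: "finite S" and sets: "sets \<nu> = sets borel_C0"
    and ord: "ordered_points (t i) \<nu> f" and f: "\<And>n. f n \<in> C0"
    and fin: "\<And>k e. 0 < e \<Longrightarrow> emeasure \<nu> {g \<in> C0. e < g (t k)} < \<infinity>"
    and pos: "\<And>k. k \<in> S \<Longrightarrow> 0 < x (t k)"
  defines "y \<equiv> \<lambda>m. x (t m)" and "v \<equiv> stopped (t ` S) (t i) x f"
  shows "0 < v (t i)"
    and "v (t i) = top_level t S i y \<nu>"
    and "v (t m) \<le> z \<longleftrightarrow> y m \<le> z \<and> (\<exists>q\<in>\<rat>. q < top_level t S i y \<nu> \<and>
      emeasure \<nu> {g \<in> below t S y. q < g (t i) \<and> z < g (t m)} = 0)"
    and "v (t m) = next_values t S i y \<nu> m"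
    and "k \<in> S \<Longrightarrow> v (t k) = y k"
    and "simulated_cont (t ` S) (t i) x f = {n. v (t i) \<le> f n (t i)}"
    and "emeasure \<nu> {g \<in> C0. v (t i) \<le> g (t i)} = emeasure (count_space UNIV) {n. v (t i) \<le> f n (t i)}"
    and "emeasure (count_space UNIV) (simulated (t ` S) (t i) x f) =
      1 + emeasure (count_space UNIV) {n. v (t i) \<le> f n (t i)}"
proof -
  note points = ordered_points_level_null[where t=t and i=i and \<nu>=\<nu> and f=f, OF ord f sets]
  have C0: "C0 \<in> sets borel_C0"
    using sets.top[of borel_C0] by simp
  have dec: "f (Suc n) (t i) \<le> f n (t i)" for n
    using ord by (simp add: ordered_points_def)
  have free: "f n \<in> below t S y \<longleftrightarrow> (\<forall>r\<in>t ` S. f n r < x r)" for n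
    using f by (simp add: below_def y_def)
  \<comment> \<open>All \<open>f n\<close> are positive at \<open>t i\<close> and hence counted; if
    all belonged to \<open>A\<close>, its mass would be infinite.\<close>
  have infinitely_many: "\<not> (\<forall>n. f n \<in> A)"
    if A: "A \<in> sets borel_C0" and finA: "emeasure \<nu> A < \<infinity>" for A
  proof
    assume all: "\<forall>n. f n \<in> A"
    have "emeasure \<nu> {g \<in> A. 0 < g (t i)} = \<infinity>"
      using points(2)[OF A, of 0] points(1) all by simp
    moreover have "emeasure \<nu> {g \<in> A. 0 < g (t i)} \<le> emeasure \<nu> A"
      using A sets by (intro emeasure_mono) auto
    ultimately show False using finA by simp
  qed
  have "\<exists>n. f n \<in> below t S y"
  proof (rule ccontr)
    assume none: "\<not> (\<exists>n. f n \<in> below t S y)"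
    \<comment> \<open>A rejected function reaches some \<open>y k\<close>. As \<open>fin\<close>
      speaks of strict exceedance of a positive level, \<open>y k / 2\<close> is used instead; this
      is where positivity at the earlier locations is essential.\<close>
    let ?A = "\<Union>k\<in>S. {g \<in> C0. y k / 2 < g (t k)}"
    have level: "{g \<in> C0. c < g (t k)} \<in> sets borel_C0" for c k
      by (rule Collect_in_borel_C0[OF C0]) measurable
    have "f n \<in> ?A" for n
    proof -
      from none f obtain k where "k \<in> S" "y k \<le> f n (t k)"
        by (auto simp: below_def not_less)
      moreover have "y k / 2 < y k" using pos[OF \<open>k \<in> S\<close>] by (simp add: y_def)
      ultimately have "y k / 2 < f n (t k)" by linarith
      with \<open>k \<in> S\<close> f[of n] show ?thesis by blast
    qed
    moreover have "?A \<in> sets borel_C0"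
      by (intro sets.finite_UN S level)
    moreover have "emeasure \<nu> ?A < \<infinity>"
    proof -
      have "emeasure \<nu> ?A \<le> (\<Sum>k\<in>S. emeasure \<nu> {g \<in> C0. y k / 2 < g (t k)})"
        by (rule emeasure_subadditive_finite[OF S]) (use level sets in blast)
      also have "\<dots> < \<infinity>"
      proof -
        have "emeasure \<nu> {g \<in> C0. y k / 2 < g (t k)} < \<infinity>" if "k \<in> S" for k
          using pos[OF that] by (intro fin) (simp add: y_def)
        then show ?thesis by (simp add: S ennreal_sum_less_top)
      qed
      finally show ?thesis .
    qed
    ultimately show False using infinitely_many by blast
  qed
  then obtain n0 where n0: "f n0 \<in> below t S y" by blast
  \<comment> \<open>Half the value, again to turn the weak inequality into a strict one at a
    positive level.\<close>
  define e where "e = f n0 (t i) / 2"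
  have e: "0 < e" "e < f n0 (t i)"
    using points(1)[of n0] by (simp_all add: e_def)
  have "{g \<in> C0. e < g (t i)} \<in> sets borel_C0"
    by (rule Collect_in_borel_C0[OF C0]) measurable
  then have "\<not> (\<forall>n. f n \<in> {g \<in> C0. e < g (t i)})"
    by (rule infinitely_many) (rule fin[OF e(1)])
  then obtain n1 where "f n1 (t i) < f n0 (t i)"
    using f e(2) by (auto simp: not_less intro: le_less_trans)
  then have ex: "\<exists>n. subextremal (t ` S) (t i) x f n"
    using n0 unfolding free by (intro ex_subextremal[where f=f and s="t i", OF dec])
  note level_le_iff = stopped_level_le_iff[where f=f and s="t i", OF dec ex, folded v_def]
  note le_iff = stopped_le_iff[where f=f and s="t i", OF dec ex, folded v_def]
  obtain L where L: "f L (t i) < v (t i)" "\<And>n. n < L \<longleftrightarrow> v (t i) \<le> f n (t i)"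
    using stopped_subextremal[where f=f and s="t i", OF dec ex, folded v_def] by blast
  show v_pos: "0 < v (t i)"
    using L(1) points(1)[of L] by simp
  have null_iff: "emeasure \<nu> {g \<in> {g \<in> below t S y. P g}. q < g (t i)} = 0 \<longleftrightarrow>
      (\<forall>n. f n \<in> below t S y \<longrightarrow> q < f n (t i) \<longrightarrow> \<not> P (f n))"
    if "0 \<le> q" "Measurable.pred borel_C0 P" for q P
  proof -
    have A: "{g \<in> below t S y. P g} \<in> sets borel_C0"
      by (rule Collect_in_borel_C0[OF below_in_sets[OF S] that(2)])
    show ?thesis
      unfolding points(2)[OF A that(1)]
      by (subst emeasure_count_space_eq_0) auto
  qed
  show top: "v (t i) = top_level t S i y \<nu>"
  proof -
    have top_iff: "top_level t S i y \<nu> \<le> z \<longleftrightarrow> y i \<le> z \<and> emeasure \<nu> {g \<in> below t S y. z < g (t i)} = 0" for z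
      using S sets points(4) by (rule top_level_le_iff)
    have "v (t i) \<le> z \<longleftrightarrow> top_level t S i y \<nu> \<le> z" for z
    proof (cases "0 \<le> z")
      case True
      have "emeasure \<nu> {g \<in> below t S y. z < g (t i)} = 0 \<longleftrightarrow> (\<forall>n. f n \<in> below t S y \<longrightarrow> f n (t i) \<le> z)"
        using null_iff[OF True, of "\<lambda>_. True"] by (auto simp: not_less)
      then show ?thesis
        unfolding level_le_iff top_iff free by (simp add: y_def)
    next
      case False
      \<comment> \<open>Negative levels are outside the scope of \<open>null_iff\<close>; here the
        free function \<open>f n0\<close>, positive at \<open>t i\<close>, keeps the mass from
        vanishing.\<close>
      have "emeasure \<nu> {g \<in> below t S y. z < g (t i)} \<noteq> 0"
      proof
        assume null: "emeasure \<nu> {g \<in> below t S y. z < g (t i)} = 0"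
        have "{g \<in> below t S y. z < g (t i)} \<in> sets \<nu>"
          unfolding sets by (rule Collect_in_borel_C0[OF below_in_sets[OF S]]) measurable
        moreover have "{g \<in> below t S y. 0 < g (t i)} \<subseteq> {g \<in> below t S y. z < g (t i)}"
          using False by auto
        ultimately have "emeasure \<nu> {g \<in> below t S y. 0 < g (t i)} = 0"
          using emeasure_eq_0 null by blast
        then show False
          using null_iff[of 0 "\<lambda>_. True"] n0 points(1)[of n0] by auto
      qed
      then show ?thesis
        unfolding top_iff using False v_pos by simp
    qed
    then show ?thesis by (metis order_antisym order_refl)
  qed
  show v_le: "v (t m) \<le> z \<longleftrightarrow> y m \<le> z \<and> (\<exists>q\<in>\<rat>. q < top_level t S i y \<nu> \<and>
      emeasure \<nu> {g \<in> below t S y. q < g (t i) \<and> z < g (t m)} = 0)" for m z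
  proof -
    have null: "emeasure \<nu> {g \<in> below t S y. q < g (t i) \<and> z < g (t m)} = 0 \<longleftrightarrow>
        (\<forall>n. (\<forall>r\<in>t ` S. f n r < x r) \<longrightarrow> q < f n (t i) \<longrightarrow> f n (t m) \<le> z)" if "0 \<le> q" for q
    proof -
      have "Measurable.pred borel_C0 (\<lambda>g. z < g (t m))" by measurable
      note null_iff[OF that this]
      moreover have "{g \<in> {g \<in> below t S y. z < g (t m)}. q < g (t i)} =
          {g \<in> below t S y. q < g (t i) \<and> z < g (t m)}"
        by auto
      ultimately show ?thesis
        by (simp only: free not_less)
    qed
    have "(\<exists>q\<in>\<rat>. q < v (t i) \<and> emeasure \<nu> {g \<in> below t S y. q < g (t i) \<and> z < g (t m)} = 0) \<longleftrightarrow>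
        (\<exists>q\<in>\<rat>. 0 < q \<and> q < v (t i) \<and> (\<forall>n. (\<forall>r\<in>t ` S. f n r < x r) \<longrightarrow> q < f n (t i) \<longrightarrow> f n (t m) \<le> z))"
      (is "?l \<longleftrightarrow> ?r")
    proof
      assume ?l
      then obtain q where q: "q < v (t i)" "emeasure \<nu> {g \<in> below t S y. q < g (t i) \<and> z < g (t m)} = 0"
        by blast
      obtain q' where q': "q' \<in> \<rat>" "max 0 q < q'" "q' < v (t i)"
        using Rats_dense_in_real[of "max 0 q" "v (t i)"] q(1) v_pos by auto
      have "{g \<in> below t S y. q < g (t i) \<and> z < g (t m)} \<in> sets \<nu>"
        unfolding sets by (rule Collect_in_borel_C0[OF below_in_sets[OF S]]) measurable
      moreover have "{g \<in> below t S y. q' < g (t i) \<and> z < g (t m)} \<subseteq>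
          {g \<in> below t S y. q < g (t i) \<and> z < g (t m)}"
        using q'(2) by auto
      ultimately have "emeasure \<nu> {g \<in> below t S y. q' < g (t i) \<and> z < g (t m)} = 0"
        using emeasure_eq_0 q(2) by blast
      then show ?r
        using q' null[of q'] by auto
    next
      assume ?r
      then obtain q where q: "q \<in> \<rat>" "0 < q" "q < v (t i)"
        "\<forall>n. (\<forall>r\<in>t ` S. f n r < x r) \<longrightarrow> q < f n (t i) \<longrightarrow> f n (t m) \<le> z" by blast
      with null[of q] show ?l by (intro bexI[of _ q]) simp_all
    qed
    then show ?thesis
      unfolding le_iff[OF v_pos] top[symmetric] by (simp add: y_def)
  qed
  have "next_values t S i y \<nu> m = Inf {z \<in> \<rat>. v (t m) \<le> z}" for m
    unfolding next_values_def v_le by simp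
  then show "v (t m) = next_values t S i y \<nu> m"
    by (simp add: Inf_Rats_atLeast)
  show "k \<in> S \<Longrightarrow> v (t k) = y k"
    using stopped_unchanged[where f=f and s="t i", OF dec ex, of "t k"] by (simp add: v_def y_def)
  show cont: "simulated_cont (t ` S) (t i) x f = {n. v (t i) \<le> f n (t i)}"
    by (simp add: simulated_cont_def v_def)
  show "emeasure \<nu> {g \<in> C0. v (t i) \<le> g (t i)} = emeasure (count_space UNIV) {n. v (t i) \<le> f n (t i)}"
  proof -
    have A: "{g \<in> C0. v (t i) \<le> g (t i)} \<in> sets borel_C0"
      by (rule Collect_in_borel_C0[OF C0]) measurable
    have "{g \<in> {g \<in> C0. v (t i) \<le> g (t i)}. 0 < g (t i)} = {g \<in> C0. v (t i) \<le> g (t i)}"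
      using v_pos by auto
    moreover have "{n. f n \<in> {g \<in> C0. v (t i) \<le> g (t i)} \<and> 0 < f n (t i)} = {n. v (t i) \<le> f n (t i)}"
      using v_pos f by auto
    ultimately show ?thesis
      using points(2)[OF A, of 0] by simp
  qed
  show "emeasure (count_space UNIV) (simulated (t ` S) (t i) x f) =
      1 + emeasure (count_space UNIV) {n. v (t i) \<le> f n (t i)}"
  proof -
    have "{n. v (t i) \<le> f n (t i)} = {..<L}" using L(2) by auto
    then have fin: "finite {n. v (t i) \<le> f n (t i)}" by simp
    then show ?thesis
      using simulated_eq_insert[where f=f and s="t i", OF dec ex] unfolding cont by simp
  qed
qed

section \<open>The running process\<close>

text \<open>Freezing of the first variable, with both integrals taken over the original space so
  that no image measure appears in later computations.\<close>

lemma (in prob_space) nn_integral_indep_var: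
  assumes "indep_var S Y T Z" "\<Phi> \<in> borel_measurable (S \<Otimes>\<^sub>M T)"
  shows "(\<integral>\<^sup>+\<omega>. \<Phi> (Y \<omega>, Z \<omega>) \<partial>M) = (\<integral>\<^sup>+\<omega>'. \<integral>\<^sup>+\<omega>. \<Phi> (Y \<omega>', Z \<omega>) \<partial>M \<partial>M)"
proof -
  from assms(1) have Y [measurable]: "random_variable S Y" and Z [measurable]: "random_variable T Z"
    and eq: "distr M S Y \<Otimes>\<^sub>M distr M T Z = distr M (S \<Otimes>\<^sub>M T) (\<lambda>x. (Y x, Z x))"
    by (simp_all add: indep_var_distribution_eq)
  note [measurable] = assms(2)
  interpret Z: prob_space "distr M T Z"
    using Z by (rule prob_space_distr)
  have "(\<integral>\<^sup>+\<omega>. \<Phi> (Y \<omega>, Z \<omega>) \<partial>M) = (\<integral>\<^sup>+x. \<Phi> x \<partial>(distr M S Y \<Otimes>\<^sub>M distr M T Z))"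
    unfolding eq by (rule nn_integral_distr[symmetric]) measurable
  also have "\<dots> = (\<integral>\<^sup>+y. \<integral>\<^sup>+z. \<Phi> (y, z) \<partial>distr M T Z \<partial>distr M S Y)"
    by (rule Z.nn_integral_fst[symmetric]) measurable
  also have "\<dots> = (\<integral>\<^sup>+\<omega>'. \<integral>\<^sup>+z. \<Phi> (Y \<omega>', z) \<partial>distr M T Z \<partial>M)"
  proof (rule nn_integral_distr[OF Y])
    have "\<Phi> \<in> borel_measurable (distr M S Y \<Otimes>\<^sub>M distr M T Z)" by measurable
    then show "(\<lambda>y. \<integral>\<^sup>+z. \<Phi> (y, z) \<partial>distr M T Z) \<in> borel_measurable (distr M S Y)"
      by measurable
  qed
  also have "\<dots> = (\<integral>\<^sup>+\<omega>'. \<integral>\<^sup>+\<omega>. \<Phi> (Y \<omega>', Z \<omega>) \<partial>M \<partial>M)"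
  proof (rule nn_integral_cong)
    fix \<omega>' assume "\<omega>' \<in> space M"
    then have [measurable]: "Y \<omega>' \<in> space S" using Y by (rule measurable_space[rotated])
    show "(\<integral>\<^sup>+z. \<Phi> (Y \<omega>', z) \<partial>distr M T Z) = (\<integral>\<^sup>+\<omega>. \<Phi> (Y \<omega>', Z \<omega>) \<partial>M)"
      by (rule nn_integral_distr) measurable
  qed
  finally show ?thesis .
qed

text \<open>Models the second step of the algorithm: \<open>\<mu>\<close> stands for its intensity,
  so the theorem instantiates it with \<open>\<mu>t\<close>, while \<open>N\<close> and
  \<open>F\<close> are those of the whole algorithm.\<close>

locale top_down = prob_space P
  for P :: "'w measure" +
  fixes \<mu> :: "('t::metric_space \<Rightarrow> real) measure" and t :: "nat \<Rightarrow> 't" and d :: nat and J :: "nat set"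
    and N :: "nat \<Rightarrow> 'w \<Rightarrow> ('t \<Rightarrow> real) measure" and F :: "nat \<Rightarrow> nat \<Rightarrow> 'w \<Rightarrow> 't \<Rightarrow> real"
  assumes sets_\<mu>: "sets \<mu> = sets borel_C0"
    and fin: "\<And>k e. 0 < e \<Longrightarrow> emeasure \<mu> {f \<in> C0. e < f (t k)} < \<infinity>"
    and PRM: "\<And>i. i \<in> {1..d} - J \<Longrightarrow> is_PRM P (N i) \<mu>"
    and indep: "indep_vars (\<lambda>_. measure_algebra borel_C0) N {1..d}"
    and F_meas: "\<And>i n. i \<in> {1..d} - J \<Longrightarrow> F i n \<in> P \<rightarrow>\<^sub>M borel_C0"
    and ordered: "\<And>i. i \<in> {1..d} - J \<Longrightarrow> AE \<omega> in P. ordered_points (t i) (N i \<omega>) (\<lambda>n. F i n \<omega>)"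
begin

lemma level_in_sets:
  assumes "finite S"
  shows "{f \<in> below t S y. q < f (t i)} \<in> sets \<mu>" "{f \<in> C0. q < f (t i)} \<in> sets \<mu>" "{f \<in> C0. q \<le> f (t i)} \<in> sets \<mu>"
    "{f \<in> below t S y. q < f (t i) \<and> z < f (t m)} \<in> sets \<mu>"
  unfolding sets_\<mu> using sets.top[of borel_C0] by (intro Collect_in_borel_C0 below_in_sets assms; simp)+

lemma space_\<mu>: "space \<mu> = C0"
  using sets_eq_imp_space_eq[OF sets_\<mu>] by simp

lemma N_measurable: "i \<in> {1..d} \<Longrightarrow> N i \<in> P \<rightarrow>\<^sub>M measure_algebra borel_C0"
  using indep by (simp add: indep_vars_def)

lemma sets_N: "i \<in> {1..d} \<Longrightarrow> \<omega> \<in> space P \<Longrightarrow> sets (N i \<omega>) = sets borel_C0"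
  using measurable_space[OF N_measurable] by (simp add: space_measure_algebra)

definition process :: "nat \<Rightarrow> 'w \<Rightarrow> 't \<Rightarrow> real" where
  "process i \<omega> = process_after t J (\<lambda>i n. F i n \<omega>) i"

text \<open>The sample points at which the deterministic analysis applies at every location of the
  second step simultaneously.\<close>

definition regular :: "'w \<Rightarrow> bool" where
  "regular \<omega> \<longleftrightarrow> \<omega> \<in> space P \<and> (\<forall>i\<in>{1..d} - J. ordered_points (t i) (N i \<omega>) (\<lambda>n. F i n \<omega>) \<and>
     (\<forall>k. \<forall>e>0. emeasure (N i \<omega>) {f \<in> C0. e < f (t k)} < \<infinity>))"

lemma AE_regular: "AE \<omega> in P. regular \<omega>"
proof -
  have "AE \<omega> in P. \<forall>k e. 0 < e \<longrightarrow> emeasure (N i \<omega>) {f \<in> C0. e < f (t k)} < \<infinity>" if i: "i \<in> {1..d} - J" for i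
  proof -
    \<comment> \<open>Countably many levels suffice, since the mass above a level decreases with the
      level.\<close>
    have "AE \<omega> in P. \<forall>k p. emeasure (N i \<omega>) {f \<in> C0. 1 / real (Suc p) < f (t k)} < \<infinity>"
      unfolding AE_all_countable
      using is_PRM_AE_finite[OF PRM[OF i] level_in_sets(2)[OF finite.emptyI] fin] by simp
    then show ?thesis
      using AE_space
    proof eventually_elim
      case (elim \<omega>)
      show ?case
      proof (intro allI impI)
        fix k and e :: real assume "0 < e"
        then obtain p where p: "1 / real (Suc p) < e"
          using reals_Archimedean[of e] by (auto simp: inverse_eq_divide)
        have "emeasure (N i \<omega>) {f \<in> C0. e < f (t k)} \<le> emeasure (N i \<omega>) {f \<in> C0. 1 / real (Suc p) < f (t k)}"
        proof (rule emeasure_mono)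
          show "{f \<in> C0. 1 / real (Suc p) < f (t k)} \<in> sets (N i \<omega>)"
            using level_in_sets(2)[OF finite.emptyI] sets_N[of i] i elim(2) sets_\<mu> by simp
          show "{f \<in> C0. e < f (t k)} \<subseteq> {f \<in> C0. 1 / real (Suc p) < f (t k)}"
            using p by (auto intro: less_trans)
        qed
        with elim(1) show "emeasure (N i \<omega>) {f \<in> C0. e < f (t k)} < \<infinity>"
          by (meson le_less_trans)
      qed
    qed
  qed
  then have "AE \<omega> in P. \<forall>i\<in>{1..d} - J. \<forall>k e. 0 < e \<longrightarrow> emeasure (N i \<omega>) {f \<in> C0. e < f (t k)} < \<infinity>"
    by (intro AE_ball_countable[THEN iffD2]) auto
  moreover have "AE \<omega> in P. \<forall>i\<in>{1..d} - J. ordered_points (t i) (N i \<omega>) (\<lambda>n. F i n \<omega>)"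
    using ordered by (intro AE_ball_countable[THEN iffD2]) auto
  ultimately show ?thesis
    using AE_space by eventually_elim (simp add: regular_def)
qed

definition treated :: "nat \<Rightarrow> nat set" where
  "treated i = {1..i} - J"

lemma finite_treated [simp]: "finite (treated i)"
  by (simp add: treated_def)

lemma treated_Suc: "treated (Suc i) = (if Suc i \<in> J then treated i else insert (Suc i) (treated i))"
  by (auto simp: treated_def le_Suc_eq)

lemma earlier_Suc: "earlier t J (Suc i) = t ` treated i"
  by (simp add: earlier_def treated_def atLeastLessThanSuc_atLeastAtMost)

lemma process_Suc:
  "process (Suc i) \<omega> = (if Suc i \<in> J then process i \<omega>
     else stopped (t ` treated i) (t (Suc i)) (process i \<omega>) (\<lambda>n. F (Suc i) n \<omega>))"
  by (simp add: process_def earlier_Suc)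

abbreviation val :: "nat \<Rightarrow> 'w \<Rightarrow> nat \<Rightarrow> real" where
  "val i \<omega> \<equiv> \<lambda>m. process i \<omega> (t m)"

lemma regular_stopped_values:
  assumes reg: "regular \<omega>" and i: "Suc i \<le> d" "Suc i \<notin> J" and pos: "\<And>k. k \<in> treated i \<Longrightarrow> 0 < val i \<omega> k"
  shows "0 < val (Suc i) \<omega> (Suc i)"
    and "val (Suc i) \<omega> (Suc i) = top_level t (treated i) (Suc i) (val i \<omega>) (N (Suc i) \<omega>)"
    and "val (Suc i) \<omega> m \<le> z \<longleftrightarrow> val i \<omega> m \<le> z \<and>
      (\<exists>q\<in>\<rat>. q < top_level t (treated i) (Suc i) (val i \<omega>) (N (Suc i) \<omega>) \<and>
      emeasure (N (Suc i) \<omega>) {g \<in> below t (treated i) (val i \<omega>). q < g (t (Suc i)) \<and> z < g (t m)} = 0)"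
    and "val (Suc i) \<omega> m = next_values t (treated i) (Suc i) (val i \<omega>) (N (Suc i) \<omega>) m"
    and "k \<in> treated i \<Longrightarrow> val (Suc i) \<omega> k = val i \<omega> k"
    and "simulated_cont (t ` treated i) (t (Suc i)) (process i \<omega>) (\<lambda>n. F (Suc i) n \<omega>) =
      {n. val (Suc i) \<omega> (Suc i) \<le> F (Suc i) n \<omega> (t (Suc i))}"
    and "emeasure (N (Suc i) \<omega>) {g \<in> C0. val (Suc i) \<omega> (Suc i) \<le> g (t (Suc i))} =
      emeasure (count_space UNIV) {n. val (Suc i) \<omega> (Suc i) \<le> F (Suc i) n \<omega> (t (Suc i))}"
    and "emeasure (count_space UNIV) (simulated (t ` treated i) (t (Suc i)) (process i \<omega>) (\<lambda>n. F (Suc i) n \<omega>)) =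
      1 + emeasure (count_space UNIV) {n. val (Suc i) \<omega> (Suc i) \<le> F (Suc i) n \<omega> (t (Suc i))}"
proof -
  have Suc_i: "Suc i \<in> {1..d} - J" using i by simp
  have \<omega>: "\<omega> \<in> space P" using reg by (simp add: regular_def)
  have F_C0: "F (Suc i) n \<omega> \<in> C0" for n
    using measurable_space[OF F_meas[OF Suc_i] \<omega>] by simp
  have ord: "ordered_points (t (Suc i)) (N (Suc i) \<omega>) (\<lambda>n. F (Suc i) n \<omega>)"
    using reg Suc_i by (simp add: regular_def)
  have fin': "emeasure (N (Suc i) \<omega>) {f \<in> C0. e < f (t k)} < \<infinity>" if "0 < e" for k e
    using reg Suc_i that by (simp add: regular_def)
  have "sets (N (Suc i) \<omega>) = sets borel_C0"
    using sets_N \<omega> Suc_i by simp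
  note * = stopped_values[where t=t and i="Suc i" and \<nu>="N (Suc i) \<omega>" and x="process i \<omega>" and
      f="\<lambda>n. F (Suc i) n \<omega>", OF finite_treated[of i] this ord F_C0 fin' pos]
  have proc: "process (Suc i) \<omega> = stopped (t ` treated i) (t (Suc i)) (process i \<omega>) (\<lambda>n. F (Suc i) n \<omega>)"
    using i by (simp add: process_Suc)
  show "0 < val (Suc i) \<omega> (Suc i)"
    unfolding proc by (rule *(1))
  show "val (Suc i) \<omega> (Suc i) = top_level t (treated i) (Suc i) (val i \<omega>) (N (Suc i) \<omega>)"
    unfolding proc by (rule *(2))
  show "val (Suc i) \<omega> m \<le> z \<longleftrightarrow> val i \<omega> m \<le> z \<and>
      (\<exists>q\<in>\<rat>. q < top_level t (treated i) (Suc i) (val i \<omega>) (N (Suc i) \<omega>) \<and>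
      emeasure (N (Suc i) \<omega>) {g \<in> below t (treated i) (val i \<omega>). q < g (t (Suc i)) \<and> z < g (t m)} = 0)"
    unfolding proc by (rule *(3))
  show "val (Suc i) \<omega> m = next_values t (treated i) (Suc i) (val i \<omega>) (N (Suc i) \<omega>) m"
    unfolding proc by (rule *(4))
  show "k \<in> treated i \<Longrightarrow> val (Suc i) \<omega> k = val i \<omega> k"
    unfolding proc by (rule *(5))
  show "simulated_cont (t ` treated i) (t (Suc i)) (process i \<omega>) (\<lambda>n. F (Suc i) n \<omega>) =
      {n. val (Suc i) \<omega> (Suc i) \<le> F (Suc i) n \<omega> (t (Suc i))}"
    unfolding proc by (rule *(6))
  show "emeasure (N (Suc i) \<omega>) {g \<in> C0. val (Suc i) \<omega> (Suc i) \<le> g (t (Suc i))} =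
      emeasure (count_space UNIV) {n. val (Suc i) \<omega> (Suc i) \<le> F (Suc i) n \<omega> (t (Suc i))}"
    unfolding proc by (rule *(7))
  show "emeasure (count_space UNIV) (simulated (t ` treated i) (t (Suc i)) (process i \<omega>) (\<lambda>n. F (Suc i) n \<omega>)) =
      1 + emeasure (count_space UNIV) {n. val (Suc i) \<omega> (Suc i) \<le> F (Suc i) n \<omega> (t (Suc i))}"
    unfolding proc by (rule *(8))
qed

text \<open>Any final value exceeds the positive value of the first subextremal function, and later
  locations do not alter it. This supplies the positivity that the analysis of the next location
  presupposes.\<close>

lemma values_pos:
  assumes "regular \<omega>" "i \<le> d" "k \<in> treated i"
  shows "0 < val i \<omega> k"
  using assms(2,3)
proof (induction i arbitrary: k)
  case (Suc i)
  show ?case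
  proof (cases "Suc i \<in> J")
    case True
    with Suc show ?thesis by (simp add: process_Suc treated_Suc)
  next
    case False
    note * = regular_stopped_values[OF assms(1) Suc.prems(1) False Suc.IH]
    show ?thesis
    proof (cases "k = Suc i")
      case True
      show ?thesis unfolding True by (rule *(1)) (use Suc.prems in auto)
    next
      case ne: False
      with Suc.prems False have "k \<in> treated i" by (simp add: treated_Suc)
      with *(5)[of k] Suc show ?thesis by simp
    qed
  qed
qed (simp add: treated_def)

lemma values_nonneg:
  assumes "regular \<omega>" "i \<le> d"
  shows "0 \<le> val i \<omega> m"
  using assms(2)
proof (induction i)
  case (Suc i)
  show ?case
  proof (cases "Suc i \<in> J")
    case False
    have "val i \<omega> m \<le> val (Suc i) \<omega> m"
      using regular_stopped_values(3)[OF assms(1) Suc.prems False values_pos[OF assms(1) Suc_leD[OF Suc.prems]],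
          of m "val (Suc i) \<omega> m"] by blast
    with Suc show ?thesis by simp
  qed (use Suc in \<open>simp add: process_Suc\<close>)
qed (simp add: process_def)

text \<open>Joint independence is assumed of the random measures, not of their enumerations.
  Recovering the values from the first \<open>i\<close> measures, by iterating
  \<open>next_values\<close>, makes this independence usable for the values.\<close>

lemma values_eq_measurable_function:
  assumes "i \<le> d"
  shows "\<exists>c\<in>(\<Pi>\<^sub>M j\<in>{1..i}. measure_algebra borel_C0) \<rightarrow>\<^sub>M (\<Pi>\<^sub>M k\<in>UNIV. borel).
    \<forall>\<omega>. regular \<omega> \<longrightarrow> val i \<omega> = c (\<lambda>j\<in>{1..i}. N j \<omega>)"
  using assms
proof (induction i)
  case 0
  show ?case
    by (intro bexI[of _ "\<lambda>_ _. 0"] measurable_const) (simp_all add: process_def space_PiM)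
next
  case (Suc i)
  obtain c where c: "c \<in> (\<Pi>\<^sub>M j\<in>{1..i}. measure_algebra borel_C0) \<rightarrow>\<^sub>M (\<Pi>\<^sub>M k\<in>UNIV. borel)"
    and "\<forall>\<omega>. regular \<omega> \<longrightarrow> val i \<omega> = c (\<lambda>j\<in>{1..i}. N j \<omega>)"
    using Suc.IH[OF Suc_leD[OF Suc.prems]] by (rule bexE)
  then have eq: "regular \<omega> \<Longrightarrow> val i \<omega> = c (\<lambda>j\<in>{1..i}. N j \<omega>)" for \<omega> by blast
  have restr: "(\<lambda>x. restrict x {1..i}) \<in>
      (\<Pi>\<^sub>M j\<in>{1..Suc i}. measure_algebra borel_C0) \<rightarrow>\<^sub>M (\<Pi>\<^sub>M j\<in>{1..i}. measure_algebra borel_C0)"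
    by (rule measurable_restrict_subset) auto
  have restr_eq: "restrict (\<lambda>j\<in>{1..Suc i}. N j \<omega>) {1..i} = (\<lambda>j\<in>{1..i}. N j \<omega>)" for \<omega>
    by (auto simp: restrict_def)
  show ?case
  proof (cases "Suc i \<in> J")
    case True
    have meas: "(\<lambda>x. c (restrict x {1..i})) \<in> (\<Pi>\<^sub>M j\<in>{1..Suc i}. measure_algebra borel_C0) \<rightarrow>\<^sub>M (\<Pi>\<^sub>M k\<in>UNIV. borel)"
      using restr c by (rule measurable_compose)
    have "val (Suc i) \<omega> = c (restrict (\<lambda>j\<in>{1..Suc i}. N j \<omega>) {1..i})" if "regular \<omega>" for \<omega>
      unfolding restr_eq eq[OF that, symmetric] using True by (simp add: process_Suc)
    then show ?thesis
      by (intro bexI[OF _ meas] allI impI)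
  next
    case False
    have comp: "(\<lambda>x. x (Suc i)) \<in> (\<Pi>\<^sub>M j\<in>{1..Suc i}. measure_algebra borel_C0) \<rightarrow>\<^sub>M measure_algebra borel_C0"
      by (rule measurable_component_singleton) simp
    have meas: "(\<lambda>x. (\<lambda>(y, \<nu>). next_values t (treated i) (Suc i) y \<nu>) (c (restrict x {1..i}), x (Suc i))) \<in>
        (\<Pi>\<^sub>M j\<in>{1..Suc i}. measure_algebra borel_C0) \<rightarrow>\<^sub>M (\<Pi>\<^sub>M k\<in>UNIV. borel)"
      by (rule measurable_compose[OF measurable_Pair[OF measurable_compose[OF restr c] comp]
            measurable_next_values[OF finite_treated]])
    have "val (Suc i) \<omega> = (\<lambda>(y, \<nu>). next_values t (treated i) (Suc i) y \<nu>)
        (c (restrict (\<lambda>j\<in>{1..Suc i}. N j \<omega>) {1..i}), (\<lambda>j\<in>{1..Suc i}. N j \<omega>) (Suc i))" if "regular \<omega>" for \<omega>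
      unfolding restr_eq eq[OF that, symmetric]
      using regular_stopped_values(4)[OF that Suc.prems False values_pos[OF that Suc_leD[OF Suc.prems]]]
      by (intro ext) simp
    then show ?thesis
      by (intro bexI[OF _ meas] allI impI)
  qed
qed

text \<open>The values before location \<open>Suc i\<close> depend only on earlier measures, so they
  may be frozen at \<open>\<omega>'\<close> while the fresh measure is averaged over.\<close>

lemma nn_integral_values_indep:
  assumes i: "Suc i \<le> d" and \<Phi> [measurable]: "\<Phi> \<in> borel_measurable ((\<Pi>\<^sub>M k\<in>UNIV. borel) \<Otimes>\<^sub>M measure_algebra borel_C0)"
  shows "(\<integral>\<^sup>+\<omega>. \<Phi> (val i \<omega>, N (Suc i) \<omega>) \<partial>P) = (\<integral>\<^sup>+\<omega>'. \<integral>\<^sup>+\<omega>. \<Phi> (val i \<omega>', N (Suc i) \<omega>) \<partial>P \<partial>P)"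
proof -
  obtain c where c: "c \<in> (\<Pi>\<^sub>M j\<in>{1..i}. measure_algebra borel_C0) \<rightarrow>\<^sub>M (\<Pi>\<^sub>M k\<in>UNIV. borel)"
    and "\<forall>\<omega>. regular \<omega> \<longrightarrow> val i \<omega> = c (\<lambda>j\<in>{1..i}. N j \<omega>)"
    using values_eq_measurable_function[OF Suc_leD[OF i]] by (rule bexE)
  then have eq: "regular \<omega> \<Longrightarrow> val i \<omega> = c (\<lambda>j\<in>{1..i}. N j \<omega>)" for \<omega> by blast
  have "indep_var (\<Pi>\<^sub>M j\<in>{1..i}. measure_algebra borel_C0) (\<lambda>\<omega>. \<lambda>j\<in>{1..i}. N j \<omega>)
      (\<Pi>\<^sub>M j\<in>{Suc i}. measure_algebra borel_C0) (\<lambda>\<omega>. \<lambda>j\<in>{Suc i}. N j \<omega>)"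
    by (rule indep_var_restrict[OF indep]) (use i in auto)
  moreover have "(\<lambda>(x, x'). \<Phi> (c x, x' (Suc i))) \<in>
      borel_measurable ((\<Pi>\<^sub>M j\<in>{1..i}. measure_algebra borel_C0) \<Otimes>\<^sub>M (\<Pi>\<^sub>M j\<in>{Suc i}. measure_algebra borel_C0))"
  proof -
    note [measurable] = c
    have [measurable]: "(\<lambda>x. x (Suc i)) \<in> (\<Pi>\<^sub>M j\<in>{Suc i}. measure_algebra borel_C0) \<rightarrow>\<^sub>M measure_algebra borel_C0"
      by (rule measurable_component_singleton) simp
    show ?thesis by measurable
  qed
  ultimately have "(\<integral>\<^sup>+\<omega>. (\<lambda>(x, x'). \<Phi> (c x, x' (Suc i))) (\<lambda>j\<in>{1..i}. N j \<omega>, \<lambda>j\<in>{Suc i}. N j \<omega>) \<partial>P) =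
      (\<integral>\<^sup>+\<omega>'. \<integral>\<^sup>+\<omega>. (\<lambda>(x, x'). \<Phi> (c x, x' (Suc i))) (\<lambda>j\<in>{1..i}. N j \<omega>', \<lambda>j\<in>{Suc i}. N j \<omega>) \<partial>P \<partial>P)"
    by (rule nn_integral_indep_var)
  then have "(\<integral>\<^sup>+\<omega>. \<Phi> (c (\<lambda>j\<in>{1..i}. N j \<omega>), N (Suc i) \<omega>) \<partial>P) =
      (\<integral>\<^sup>+\<omega>'. \<integral>\<^sup>+\<omega>. \<Phi> (c (\<lambda>j\<in>{1..i}. N j \<omega>'), N (Suc i) \<omega>) \<partial>P \<partial>P)" by simp
  moreover have "(\<integral>\<^sup>+\<omega>. \<Phi> (val i \<omega>, N (Suc i) \<omega>) \<partial>P) = (\<integral>\<^sup>+\<omega>. \<Phi> (c (\<lambda>j\<in>{1..i}. N j \<omega>), N (Suc i) \<omega>) \<partial>P)"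
    by (rule nn_integral_cong_AE) (use AE_regular in eventually_elim, simp add: eq)
  moreover have "(\<integral>\<^sup>+\<omega>'. \<integral>\<^sup>+\<omega>. \<Phi> (val i \<omega>', N (Suc i) \<omega>) \<partial>P \<partial>P) =
      (\<integral>\<^sup>+\<omega>'. \<integral>\<^sup>+\<omega>. \<Phi> (c (\<lambda>j\<in>{1..i}. N j \<omega>'), N (Suc i) \<omega>) \<partial>P \<partial>P)"
    by (rule nn_integral_cong_AE) (use AE_regular in eventually_elim, simp add: eq)
  ultimately show ?thesis by simp
qed

text \<open>The state \<open>y\<close> is a constant here, as required inside the inner integral
  with frozen values.\<close>

lemma AE_top_level_le_iff:
  assumes i: "i \<in> {1..d} - J" and S: "finite S"
  shows "AE \<omega> in P. \<forall>x. top_level t S i y (N i \<omega>) \<le> x \<longleftrightarrow>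
    y i \<le> x \<and> emeasure (N i \<omega>) {f \<in> below t S y. x < f (t i)} = 0"
  using AE_regular
proof eventually_elim
  case (elim \<omega>)
  then have \<omega>: "\<omega> \<in> space P" and ord: "ordered_points (t i) (N i \<omega>) (\<lambda>n. F i n \<omega>)"
    using i by (auto simp: regular_def)
  have F_C0: "F i n \<omega> \<in> C0" for n
    using measurable_space[OF F_meas[OF i] \<omega>] by simp
  have sets: "sets (N i \<omega>) = sets borel_C0"
    using sets_N \<omega> i by simp
  have "emeasure (N i \<omega>) {g \<in> C0. F i 0 \<omega> (t i) < g (t i)} = 0"
    by (rule ordered_points_level_null(4)[where t=t and i=i and f="\<lambda>n. F i n \<omega>", OF ord F_C0 sets])
  then show ?case
    using top_level_le_iff[where \<nu>="N i \<omega>", OF S sets] by simp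
qed

text \<open>Restricted to the functions above \<open>z > 0\<close> at \<open>t m\<close>, the
  intensity is finite. The quantity is then the mass of the sections of a measurable set in a
  product space.\<close>

lemma measurable_measure_below:
  assumes S: "finite S" and z: "0 < z"
  shows "(\<lambda>(y, r). measure \<mu> {f \<in> below t S y. z < f (t m) \<and> f (t i) < r}) \<in>
    borel_measurable ((\<Pi>\<^sub>M k\<in>UNIV. borel) \<Otimes>\<^sub>M borel)"
proof -
  let ?A = "{f \<in> C0. z < f (t m)}"
  let ?K = "(\<Pi>\<^sub>M k\<in>UNIV. borel) \<Otimes>\<^sub>M (borel :: real measure)"
  have A: "?A \<in> sets \<mu>" by (rule level_in_sets(2)[OF finite.emptyI])
  note [measurable_cong] = sets_\<mu>
  interpret A: finite_measure "density \<mu> (indicator ?A)"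
    using fin[OF z, of m] A sets.top[of \<mu>] by (intro finite_measureI) (simp add: emeasure_restricted)
  define Q where "Q = {x \<in> space (?K \<Otimes>\<^sub>M density \<mu> (indicator ?A)).
    (\<forall>k\<in>S. snd x (t k) < fst (fst x) k) \<and> snd x (t i) < snd (fst x)}"
  have Q: "Q \<in> sets (?K \<Otimes>\<^sub>M density \<mu> (indicator ?A))"
    unfolding Q_def using S by measurable
  have "emeasure (density \<mu> (indicator ?A)) (Pair x -` Q) =
      emeasure \<mu> {f \<in> below t S (fst x). z < f (t m) \<and> f (t i) < snd x}" for x
  proof -
    have Qx: "Pair x -` Q = {f \<in> C0. (\<forall>k\<in>S. f (t k) < fst x k) \<and> f (t i) < snd x}"
      by (auto simp: Q_def space_pair_measure space_PiM space_\<mu>)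
    have "Pair x -` Q \<in> sets \<mu>"
      unfolding Qx sets_\<mu> using sets.top[of borel_C0] S by (intro Collect_in_borel_C0) simp_all
    then have "emeasure (density \<mu> (indicator ?A)) (Pair x -` Q) = emeasure \<mu> (?A \<inter> (Pair x -` Q))"
      using A by (simp add: emeasure_restricted)
    also have "?A \<inter> (Pair x -` Q) = {f \<in> below t S (fst x). z < f (t m) \<and> f (t i) < snd x}"
      unfolding Qx by (auto simp: below_def)
    finally show ?thesis .
  qed
  then have "(\<lambda>x. measure \<mu> {f \<in> below t S (fst x). z < f (t m) \<and> f (t i) < snd x}) \<in> borel_measurable ?K"
    using A.measurable_emeasure_Pair[OF Q] unfolding measure_def by simp
  then show ?thesis by (simp add: case_prod_beta)
qed

section \<open>Invariance of the weighted law, and the counts at one location\<close>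

lemma nn_integral_values_law:
  assumes "i \<le> d" and z: "0 < z"
  shows "(\<integral>\<^sup>+\<omega>. indicator {..z} (val i \<omega> m) *
      ennreal (exp (- measure \<mu> {f \<in> below t (treated i) (val i \<omega>). z < f (t m)})) \<partial>P) =
    ennreal (exp (- measure \<mu> {f \<in> C0. z < f (t m)}))"
  using assms(1)
proof (induction i)
  case 0
  have "below t (treated 0) y = C0" for y
    by (simp add: below_def treated_def)
  then show ?case
    using z by (simp add: process_def emeasure_space_1)
next
  case (Suc i)
  show ?case
  proof (cases "Suc i \<in> J")
    case True
    with Suc show ?thesis by (simp add: process_Suc treated_Suc)
  next
    case False
    then have i: "Suc i \<in> {1..d} - J" using Suc.prems by simp
    let ?S = "treated i" and ?i = "Suc i"
    let ?B = "\<lambda>y. {f \<in> below t ?S y. z < f (t m)}"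
    let ?K = "(\<Pi>\<^sub>M k\<in>UNIV. borel) \<Otimes>\<^sub>M measure_algebra borel_C0"
    \<comment> \<open>The integrand of \<open>is_PRM_nn_integral_top_level\<close> for
      \<open>D = below t ?S y\<close>, \<open>B = ?B y\<close>, \<open>w = y ?i\<close> and
      evaluation at \<open>t ?i\<close> as \<open>\<phi>\<close>. Its first factor says that no
      accepted function exceeds \<open>z\<close> at \<open>t m\<close>.\<close>
    define h where "h y \<nu> = (if \<exists>q\<in>\<rat>. q < top_level t ?S ?i y \<nu> \<and>
        emeasure \<nu> {f \<in> ?B y. q < f (t ?i)} = 0 then 1 else 0) *
      ennreal (exp (- measure \<mu> {f \<in> ?B y. f (t ?i) < top_level t ?S ?i y \<nu>}))" for y and \<nu> :: "('t \<Rightarrow> real) measure"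
    define \<Phi> where "\<Phi> x = indicator {..z} (fst x m) * h (fst x) (snd x)" for x :: "(nat \<Rightarrow> real) \<times> ('t \<Rightarrow> real) measure"
    have [measurable]: "(\<lambda>x. top_level t ?S ?i (fst x) (snd x)) \<in> borel_measurable ?K"
      by (rule measurable_top_level[OF finite_treated, unfolded case_prod_beta])
    have [measurable]: "Measurable.pred ?K (\<lambda>x. emeasure (snd x) {f \<in> ?B (fst x). q < f (t ?i)} = 0)" for q
    proof -
      have "Measurable.pred ?K (\<lambda>(y, \<nu>). emeasure \<nu> (below t ?S y \<inter> {f \<in> space borel_C0. z < f (t m) \<and> q < f (t ?i)}) = 0)"
        by (rule measurable_below_null[OF finite_treated]) measurable
      moreover have "below t ?S y \<inter> {f \<in> space borel_C0. z < f (t m) \<and> q < f (t ?i)} = {f \<in> ?B y. q < f (t ?i)}" for y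
        by (auto simp: below_def)
      ultimately show ?thesis by (simp add: case_prod_beta)
    qed
    have [measurable]: "(\<lambda>x. measure \<mu> {f \<in> ?B (fst x). f (t ?i) < top_level t ?S ?i (fst x) (snd x)}) \<in> borel_measurable ?K"
    proof -
      have "(\<lambda>x. (\<lambda>(y, r). measure \<mu> {f \<in> below t ?S y. z < f (t m) \<and> f (t ?i) < r})
          (fst x, top_level t ?S ?i (fst x) (snd x))) \<in> borel_measurable ?K"
        by (rule measurable_compose[OF _ measurable_measure_below[OF finite_treated z]]) measurable
      then show ?thesis by (simp add: conj_assoc)
    qed
    have [measurable]: "Measurable.pred ?K (\<lambda>x. \<exists>q\<in>\<rat>. q < top_level t ?S ?i (fst x) (snd x) \<and>
        emeasure (snd x) {f \<in> ?B (fst x). q < f (t ?i)} = 0)"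
      by (rule measurable_pred_countable(2)[OF countable_rat]) measurable
    have \<Phi>_meas: "\<Phi> \<in> borel_measurable ?K"
      unfolding \<Phi>_def h_def by measurable
    have "(\<integral>\<^sup>+\<omega>. indicator {..z} (val ?i \<omega> m) *
        ennreal (exp (- measure \<mu> {f \<in> below t (treated ?i) (val ?i \<omega>). z < f (t m)})) \<partial>P) =
        (\<integral>\<^sup>+\<omega>. \<Phi> (val i \<omega>, N ?i \<omega>) \<partial>P)"
    proof (rule nn_integral_cong_AE)
      show "AE \<omega> in P. indicator {..z} (val ?i \<omega> m) *
          ennreal (exp (- measure \<mu> {f \<in> below t (treated ?i) (val ?i \<omega>). z < f (t m)})) = \<Phi> (val i \<omega>, N ?i \<omega>)"
        using AE_regular
      proof eventually_elim
        case (elim \<omega>)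
        note * = regular_stopped_values[OF elim Suc.prems False values_pos[OF elim Suc_leD[OF Suc.prems]]]
        have top: "val ?i \<omega> ?i = top_level t ?S ?i (val i \<omega>) (N ?i \<omega>)"
          by (rule *(2))
        have "val ?i \<omega> k = val i \<omega> k" if "k \<in> ?S" for k
          using *(5)[of k] that by simp
        \<comment> \<open>Treating \<open>t ?i\<close> adds one constraint to being free, namely to
          lie below the new value there; the earlier constraints are unchanged.\<close>
        then have "{f \<in> below t (treated ?i) (val ?i \<omega>). z < f (t m)} =
            {f \<in> ?B (val i \<omega>). f (t ?i) < top_level t ?S ?i (val i \<omega>) (N ?i \<omega>)}"
          unfolding top[symmetric] using False by (auto simp: below_def treated_Suc)
        moreover have "val ?i \<omega> m \<le> z \<longleftrightarrow> val i \<omega> m \<le> z \<and>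
            (\<exists>q\<in>\<rat>. q < top_level t ?S ?i (val i \<omega>) (N ?i \<omega>) \<and> emeasure (N ?i \<omega>) {f \<in> ?B (val i \<omega>). q < f (t ?i)} = 0)"
        proof -
          have "{f \<in> ?B (val i \<omega>). q < f (t ?i)} = {g \<in> below t ?S (val i \<omega>). q < g (t ?i) \<and> z < g (t m)}" for q
            by auto
          then show ?thesis
            using *(3)[of m z] by simp
        qed
        ultimately show ?case
          by (simp add: \<Phi>_def h_def indicator_def)
      qed
    qed
    also have "\<dots> = (\<integral>\<^sup>+\<omega>'. \<integral>\<^sup>+\<omega>. \<Phi> (val i \<omega>', N ?i \<omega>) \<partial>P \<partial>P)"
      by (rule nn_integral_values_indep[OF Suc.prems \<Phi>_meas])
    also have "\<dots> = (\<integral>\<^sup>+\<omega>'. indicator {..z} (val i \<omega>' m) * ennreal (exp (- measure \<mu> (?B (val i \<omega>')))) \<partial>P)"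
    proof (rule nn_integral_cong_AE)
      show "AE \<omega>' in P. (\<integral>\<^sup>+\<omega>. \<Phi> (val i \<omega>', N ?i \<omega>) \<partial>P) =
          indicator {..z} (val i \<omega>' m) * ennreal (exp (- measure \<mu> (?B (val i \<omega>'))))"
        using AE_regular
      proof eventually_elim
        case (elim \<omega>')
        \<comment> \<open>With \<open>y\<close> frozen, averaging over the fresh measure removes the
          new constraint and returns the weight as it was before this location.\<close>
        define y where "y = val i \<omega>'"
        have y: "0 \<le> y ?i"
          unfolding y_def using values_nonneg[OF elim] Suc.prems by simp
        have N_i: "N ?i \<in> P \<rightarrow>\<^sub>M measure_algebra borel_C0"
          using N_measurable i by simp
        have pair: "(\<lambda>\<omega>. (y, N ?i \<omega>)) \<in> P \<rightarrow>\<^sub>M ?K"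
          by (rule measurable_Pair[OF _ N_i]) (simp add: space_PiM)
        have top_meas: "(\<lambda>\<omega>. top_level t ?S ?i y (N ?i \<omega>)) \<in> borel_measurable P"
          using measurable_compose[OF pair measurable_top_level[OF finite_treated]] by simp
        have h_meas: "(\<lambda>\<omega>. h y (N ?i \<omega>)) \<in> borel_measurable P"
        proof -
          have "(\<lambda>x. h (fst x) (snd x)) \<in> borel_measurable ?K"
            unfolding h_def by measurable
          from measurable_compose[OF pair this] show ?thesis by simp
        qed
        have eval: "(\<lambda>f. f (t ?i)) \<in> borel_measurable \<mu>"
          using measurable_evaluation sets_\<mu> measurable_cong_sets by blast
        have D: "below t ?S y \<in> sets \<mu>" unfolding sets_\<mu> by simp
        have B: "?B y \<in> sets \<mu>"
          using level_in_sets(1)[OF finite_treated] .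
        have Bfin: "emeasure \<mu> (?B y) < \<infinity>"
          by (rule le_less_trans[OF emeasure_mono fin[OF z, of m]])
            (use level_in_sets(2)[OF finite_treated] in \<open>auto simp: below_def\<close>)
        have "(\<integral>\<^sup>+\<omega>. h y (N ?i \<omega>) \<partial>P) = ennreal (exp (- measure \<mu> (?B y)))"
        proof -
          have "(\<integral>\<^sup>+\<omega>. h y (N ?i \<omega>) \<partial>P) = (\<integral>\<^sup>+\<omega>. indicator {\<omega>. \<exists>q\<in>\<rat>. q < top_level t ?S ?i y (N ?i \<omega>) \<and>
              emeasure (N ?i \<omega>) {f \<in> ?B y. q < f (t ?i)} = 0} \<omega>
              * ennreal (exp (- measure \<mu> {f \<in> ?B y. f (t ?i) < top_level t ?S ?i y (N ?i \<omega>)})) \<partial>P)"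
            unfolding h_def indicator_def by (intro nn_integral_cong arg_cong2[of _ _ _ _ "(*)"]) simp_all
          also have "\<dots> = ennreal (exp (- measure \<mu> (?B y)))"
            by (rule is_PRM_nn_integral_top_level[OF PRM[OF i] eval D B _ Bfin y top_meas
                AE_top_level_le_iff[OF i finite_treated]]) auto
          finally show ?thesis .
        qed
        then show ?case
          using h_meas by (simp add: \<Phi>_def y_def nn_integral_cmult)
      qed
    qed
    also have "\<dots> = ennreal (exp (- measure \<mu> {f \<in> C0. z < f (t m)}))"
      using Suc by simp
    finally show ?thesis .
  qed
qed

text \<open>\<open>R\<close> and \<open>C\<close> are measurable versions of the final value at
  \<open>t (Suc i)\<close> and of the number of functions reaching it. The law of \<open>R\<close>
  is the weighted law after the location has been treated, when the weight has become 1; the mean of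
  \<open>C\<close> comes from the weak Mecke formula
  \<open>nn_integral_points_above_level\<close>.\<close>

lemma top_level_law_and_counts:
  assumes i: "Suc i \<in> {1..d} - J"
  obtains R :: "'w \<Rightarrow> real" and C :: "'w \<Rightarrow> ennreal"
  where "R \<in> borel_measurable P" "AE \<omega> in P. 0 < R \<omega>"
    "\<And>z. 0 < z \<Longrightarrow> prob {\<omega> \<in> space P. R \<omega> \<le> z} = exp (- measure \<mu> {f \<in> C0. z < f (t (Suc i))})"
    "C \<in> borel_measurable P"
    "AE \<omega> in P. emeasure (count_space UNIV) (simulated_cont (t ` treated i) (t (Suc i)) (process i \<omega>) (\<lambda>n. F (Suc i) n \<omega>)) = C \<omega>"
    "AE \<omega> in P. emeasure (count_space UNIV) (simulated (t ` treated i) (t (Suc i)) (process i \<omega>) (\<lambda>n. F (Suc i) n \<omega>)) = 1 + C \<omega>"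
    "(\<integral>\<^sup>+\<omega>. C \<omega> \<partial>P) = (\<integral>\<^sup>+\<omega>. emeasure \<mu> {f \<in> C0. R \<omega> \<le> f (t (Suc i))} \<partial>P)"
proof -
  let ?S = "treated i" and ?i = "Suc i"
  let ?K = "(\<Pi>\<^sub>M k\<in>UNIV. borel) \<Otimes>\<^sub>M measure_algebra borel_C0"
  have id: "?i \<le> d" "?i \<notin> J" using i by auto
  have id': "i \<le> d" using id by simp
  obtain c where c: "c \<in> (\<Pi>\<^sub>M j\<in>{1..i}. measure_algebra borel_C0) \<rightarrow>\<^sub>M (\<Pi>\<^sub>M k\<in>UNIV. borel)"
    and "\<forall>\<omega>. regular \<omega> \<longrightarrow> val i \<omega> = c (\<lambda>j\<in>{1..i}. N j \<omega>)"
    using values_eq_measurable_function[OF id'] by (rule bexE)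
  then have eq: "regular \<omega> \<Longrightarrow> val i \<omega> = c (\<lambda>j\<in>{1..i}. N j \<omega>)" for \<omega> by blast
  have N_i: "N ?i \<in> P \<rightarrow>\<^sub>M measure_algebra borel_C0"
    using N_measurable i by simp
  have top_meas: "(\<lambda>x. top_level t ?S ?i (fst x) (snd x)) \<in> borel_measurable ?K"
    by (rule measurable_top_level[OF finite_treated, unfolded case_prod_beta])
  define R where "R \<omega> = top_level t ?S ?i (c (\<lambda>j\<in>{1..i}. N j \<omega>)) (N ?i \<omega>)" for \<omega>
  have restr: "(\<lambda>\<omega>. \<lambda>j\<in>{1..i}. N j \<omega>) \<in> P \<rightarrow>\<^sub>M (\<Pi>\<^sub>M j\<in>{1..i}. measure_algebra borel_C0)"
    by (rule measurable_restrict) (use N_measurable id' in auto)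
  have R_meas [measurable]: "R \<in> borel_measurable P"
    using measurable_compose[OF measurable_Pair[OF measurable_compose[OF restr c] N_i] top_meas]
    by (simp add: R_def[abs_def])
  have R_eq: "R \<omega> = val ?i \<omega> ?i" if "regular \<omega>" for \<omega>
    unfolding R_def eq[OF that, symmetric] using regular_stopped_values(2)[OF that id values_pos[OF that id']] by simp
  have R_pos: "AE \<omega> in P. 0 < R \<omega>"
    using AE_regular by eventually_elim (use R_eq values_pos id in \<open>simp add: treated_Suc\<close>)
  have R_law: "prob {\<omega> \<in> space P. R \<omega> \<le> z} = exp (- measure \<mu> {f \<in> C0. z < f (t ?i)})" if z: "0 < z" for z
  proof -
    have "ennreal (prob {\<omega> \<in> space P. R \<omega> \<le> z}) = (\<integral>\<^sup>+\<omega>. indicator {\<omega> \<in> space P. R \<omega> \<le> z} \<omega> \<partial>P)"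
      by (simp add: emeasure_eq_measure)
    also have "\<dots> = (\<integral>\<^sup>+\<omega>. indicator {..z} (val ?i \<omega> ?i) *
        ennreal (exp (- measure \<mu> {f \<in> below t (treated ?i) (val ?i \<omega>). z < f (t ?i)})) \<partial>P)"
    proof (rule nn_integral_cong_AE)
      show "AE \<omega> in P. indicator {\<omega> \<in> space P. R \<omega> \<le> z} \<omega> = indicator {..z} (val ?i \<omega> ?i) *
          ennreal (exp (- measure \<mu> {f \<in> below t (treated ?i) (val ?i \<omega>). z < f (t ?i)}))"
        using AE_regular AE_space
      proof eventually_elim
        case (elim \<omega>)
        \<comment> \<open>Free functions now also lie below the value at \<open>t ?i\<close> itself,
          which is at most \<open>z\<close>.\<close>
        have empty: "{f \<in> below t (treated ?i) (val ?i \<omega>). z < f (t ?i)} = {}" if "val ?i \<omega> ?i \<le> z"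
        proof -
          have "f (t ?i) < val ?i \<omega> ?i" if "f \<in> below t (treated ?i) (val ?i \<omega>)" for f
            using that id by (simp add: below_def treated_Suc)
          with that have "\<not> z < f (t ?i)" if "f \<in> below t (treated ?i) (val ?i \<omega>)" for f
            using that by fastforce
          then show ?thesis by blast
        qed
        show ?case
        proof (cases "val ?i \<omega> ?i \<le> z")
          case True
          then show ?thesis unfolding empty[OF True] using elim by (simp add: R_eq)
        next
          case False
          then show ?thesis using elim by (simp add: R_eq)
        qed
      qed
    qed
    also have "\<dots> = ennreal (exp (- measure \<mu> {f \<in> C0. z < f (t ?i)}))"
      by (rule nn_integral_values_law[OF id(1) z])
    finally show ?thesis by (simp add: ennreal_inj)
  qed
  define C where "C \<omega> = (\<Sum>n. indicator {\<omega>. R \<omega> \<le> F ?i n \<omega> (t ?i)} \<omega> :: ennreal)" for \<omega>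
  have [measurable]: "(\<lambda>\<omega>. F ?i n \<omega> (t ?i)) \<in> borel_measurable P" for n
    by (rule measurable_compose[OF F_meas[OF i] measurable_evaluation])
  have C_meas: "C \<in> borel_measurable P"
    unfolding C_def by measurable
  have C_eq: "C \<omega> = emeasure (count_space UNIV) {n. val ?i \<omega> ?i \<le> F ?i n \<omega> (t ?i)}" if "regular \<omega>" for \<omega>
  proof -
    have "C \<omega> = (\<integral>\<^sup>+n. indicator {n. val ?i \<omega> ?i \<le> F ?i n \<omega> (t ?i)} n \<partial>count_space UNIV)"
      unfolding C_def R_eq[OF that, symmetric]
      by (subst nn_integral_count_space_nat) (auto simp: indicator_def intro!: suminf_cong)
    then show ?thesis by simp
  qed
  have sim_cont: "AE \<omega> in P. emeasure (count_space UNIV)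
      (simulated_cont (t ` ?S) (t ?i) (process i \<omega>) (\<lambda>n. F ?i n \<omega>)) = C \<omega>"
    using AE_regular
  proof eventually_elim
    case (elim \<omega>)
    show ?case
      using regular_stopped_values(6)[OF elim id values_pos[OF elim id']] elim by (simp add: C_eq)
  qed
  have sim: "AE \<omega> in P. emeasure (count_space UNIV)
      (simulated (t ` ?S) (t ?i) (process i \<omega>) (\<lambda>n. F ?i n \<omega>)) = 1 + C \<omega>"
    using AE_regular
  proof eventually_elim
    case (elim \<omega>)
    show ?case
      using regular_stopped_values(8)[OF elim id values_pos[OF elim id']] elim by (simp add: C_eq)
  qed
  have eval: "(\<lambda>f. f (t ?i)) \<in> borel_measurable \<mu>"
    using measurable_evaluation sets_\<mu> measurable_cong_sets by blast
  have "(\<integral>\<^sup>+\<omega>. C \<omega> \<partial>P) = (\<integral>\<^sup>+\<omega>. emeasure (N ?i \<omega>) {f \<in> space \<mu>. R \<omega> \<le> f (t ?i)} \<partial>P)"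
  proof (rule nn_integral_cong_AE)
    show "AE \<omega> in P. C \<omega> = emeasure (N ?i \<omega>) {f \<in> space \<mu>. R \<omega> \<le> f (t ?i)}"
      using AE_regular
    proof eventually_elim
      case (elim \<omega>)
      show ?case
        using regular_stopped_values(7)[OF elim id values_pos[OF elim id']] elim by (simp add: C_eq R_eq space_\<mu>)
    qed
  qed
  also have "\<dots> = (\<integral>\<^sup>+\<omega>. emeasure \<mu> {f \<in> space \<mu>. R \<omega> \<le> f (t ?i)} \<partial>P)"
  proof (rule nn_integral_points_above_level)
    show "sets (N ?i \<omega>) = sets \<mu>" if "\<omega> \<in> space P" for \<omega>
      by (rule is_PRM_sets[OF PRM[OF i] that])
    show "(\<lambda>\<omega>. emeasure (N ?i \<omega>) A) \<in> borel_measurable P" if "A \<in> sets \<mu>" for A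
      by (rule is_PRM_measurable_emeasure[OF PRM[OF i] that])
    show "(\<integral>\<^sup>+\<omega>. emeasure (N ?i \<omega>) A \<partial>P) = emeasure \<mu> A" if "A \<in> sets \<mu>" for A
      by (rule is_PRM_nn_integral[OF PRM[OF i] that])
    show "emeasure \<mu> {f \<in> space \<mu>. c < f (t ?i)} < \<infinity>" if "0 < c" for c
      using fin[OF that] by (simp add: space_\<mu>)
    show "(\<integral>\<^sup>+\<omega>. emeasure (N ?i \<omega>) A * indicator {..u} (R \<omega>) \<partial>P) =
        emeasure \<mu> A * (\<integral>\<^sup>+\<omega>. indicator {..u} (R \<omega>) \<partial>P)"
      if A: "A \<in> sets \<mu>" and Au: "\<And>f. f \<in> A \<Longrightarrow> f (t ?i) \<le> u" for A u
    proof -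
      define \<Psi> where "\<Psi> x = (indicator {..u} (top_level t ?S ?i (fst x) (snd x)) :: ennreal)"
        for x :: "(nat \<Rightarrow> real) \<times> ('t \<Rightarrow> real) measure"
      define \<Phi> where "\<Phi> x = emeasure (snd x) A * \<Psi> x" for x
      note [measurable] = top_meas
      have A': "A \<in> sets borel_C0" using A sets_\<mu> by simp
      have \<Psi>_meas [measurable]: "\<Psi> \<in> borel_measurable ?K"
        unfolding \<Psi>_def by measurable
      have "(\<lambda>x. emeasure (snd x) A) \<in> borel_measurable ?K"
        using A' by measurable
      then have \<Phi>_meas: "\<Phi> \<in> borel_measurable ?K"
        unfolding \<Phi>_def by measurable
      \<comment> \<open>For a frozen state, the fresh points at levels up to \<open>u\<close> are
        independent of whether the top level is at most \<open>u\<close>, so their mean factors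
        out.\<close>
      have inner: "(\<integral>\<^sup>+\<omega>. \<Phi> (y, N ?i \<omega>) \<partial>P) = emeasure \<mu> A * (\<integral>\<^sup>+\<omega>. \<Psi> (y, N ?i \<omega>) \<partial>P)" for y
      proof -
        have pair: "(\<lambda>\<omega>. (y, N ?i \<omega>)) \<in> P \<rightarrow>\<^sub>M ?K"
          by (rule measurable_Pair[OF _ N_i]) (simp add: space_PiM)
        have R'_meas: "(\<lambda>\<omega>. top_level t ?S ?i y (N ?i \<omega>)) \<in> borel_measurable P"
          using measurable_compose[OF pair top_meas] by simp
        have D: "below t ?S y \<in> sets \<mu>" unfolding sets_\<mu> by simp
        show ?thesis
          unfolding \<Phi>_def \<Psi>_def fst_conv snd_conv
          by (rule is_PRM_nn_integral_below_level[OF PRM[OF i] eval D R'_meas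
              AE_top_level_le_iff[OF i finite_treated] A]) (rule Au)
      qed
      have R_val: "AE \<omega> in P. R \<omega> = top_level t ?S ?i (val i \<omega>) (N ?i \<omega>)"
        using AE_regular by eventually_elim (simp add: R_def eq)
      have "(\<integral>\<^sup>+\<omega>. emeasure (N ?i \<omega>) A * indicator {..u} (R \<omega>) \<partial>P) = (\<integral>\<^sup>+\<omega>. \<Phi> (val i \<omega>, N ?i \<omega>) \<partial>P)"
        by (rule nn_integral_cong_AE) (use R_val in eventually_elim, simp add: \<Phi>_def \<Psi>_def)
      also have "\<dots> = (\<integral>\<^sup>+\<omega>'. emeasure \<mu> A * (\<integral>\<^sup>+\<omega>. \<Psi> (val i \<omega>', N ?i \<omega>) \<partial>P) \<partial>P)"
        unfolding nn_integral_values_indep[OF id(1) \<Phi>_meas] inner ..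
      \<comment> \<open>Passing to the version given by \<open>c\<close> makes the inner integral a
        measurable function of \<open>\<omega>'\<close>, so that the constant may be pulled
        out.\<close>
      also have "\<dots> = (\<integral>\<^sup>+\<omega>'. emeasure \<mu> A * (\<integral>\<^sup>+\<omega>. \<Psi> (c (\<lambda>j\<in>{1..i}. N j \<omega>'), N ?i \<omega>) \<partial>P) \<partial>P)"
        by (rule nn_integral_cong_AE) (use AE_regular in eventually_elim, simp add: eq)
      also have "\<dots> = emeasure \<mu> A * (\<integral>\<^sup>+\<omega>'. (\<integral>\<^sup>+\<omega>. \<Psi> (c (\<lambda>j\<in>{1..i}. N j \<omega>'), N ?i \<omega>) \<partial>P) \<partial>P)"
      proof (rule nn_integral_cmult)
        have "(\<lambda>x. \<Psi> (c (\<lambda>j\<in>{1..i}. N j (fst x)), N ?i (snd x))) \<in> borel_measurable (P \<Otimes>\<^sub>M P)"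
          using measurable_compose[OF measurable_Pair[OF measurable_compose[OF measurable_fst measurable_compose[OF restr c]]
                measurable_compose[OF measurable_snd N_i]] \<Psi>_meas] by simp
        then show "(\<lambda>\<omega>'. \<integral>\<^sup>+\<omega>. \<Psi> (c (\<lambda>j\<in>{1..i}. N j \<omega>'), N ?i \<omega>) \<partial>P) \<in> borel_measurable P"
          by (intro borel_measurable_nn_integral) (simp add: case_prod_beta)
      qed
      also have "(\<integral>\<^sup>+\<omega>'. (\<integral>\<^sup>+\<omega>. \<Psi> (c (\<lambda>j\<in>{1..i}. N j \<omega>'), N ?i \<omega>) \<partial>P) \<partial>P) =
          (\<integral>\<^sup>+\<omega>'. (\<integral>\<^sup>+\<omega>. \<Psi> (val i \<omega>', N ?i \<omega>) \<partial>P) \<partial>P)"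
        by (rule nn_integral_cong_AE) (use AE_regular in eventually_elim, simp add: eq)
      also have "\<dots> = (\<integral>\<^sup>+\<omega>. \<Psi> (val i \<omega>, N ?i \<omega>) \<partial>P)"
        by (rule nn_integral_values_indep[OF id(1) \<Psi>_meas, symmetric])
      also have "\<dots> = (\<integral>\<^sup>+\<omega>. indicator {..u} (R \<omega>) \<partial>P)"
        by (rule nn_integral_cong_AE) (use R_val in eventually_elim, simp add: \<Psi>_def)
      finally show ?thesis .
    qed
  qed (fact eval R_meas R_pos)+
  finally have "(\<integral>\<^sup>+\<omega>. C \<omega> \<partial>P) = (\<integral>\<^sup>+\<omega>. emeasure \<mu> {f \<in> C0. R \<omega> \<le> f (t ?i)} \<partial>P)"
    by (simp add: space_\<mu>)
  with R_meas R_pos R_law C_meas sim_cont sim show thesis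
    by (rule that)
qed

end

section \<open>The law of the process at one location\<close>

text \<open>The mass is a sum of multiplicities over a possibly uncountable set; such a sum of
  nonnegative terms vanishes exactly when each term does.\<close>

lemma point_measure_zero_iff:
  assumes "is_point_measure \<nu>" and A: "A \<in> sets \<nu>" and single: "\<And>f. f \<in> A \<Longrightarrow> {f} \<in> sets \<nu>"
  shows "emeasure \<nu> A = 0 \<longleftrightarrow> (\<forall>f\<in>A. emeasure \<nu> {f} = 0)"
proof -
  obtain m :: "'a \<Rightarrow> enat" where m: "\<And>A. A \<in> sets \<nu> \<Longrightarrow>
      emeasure \<nu> A = (\<integral>\<^sup>+x. ennreal_of_enat (m x) \<partial>count_space A)"
    using assms(1) unfolding is_point_measure_def by blast
  have "emeasure \<nu> B = 0 \<longleftrightarrow> (\<forall>x\<in>B. ennreal_of_enat (m x) = 0)" if "B \<in> sets \<nu>" for B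
    unfolding m[OF that] by (subst nn_integral_0_iff_AE) (simp_all add: AE_count_space)
  with A single show ?thesis by simp
qed

text \<open>The hypothesis \<open>bound\<close> makes the set of atom values bounded above, so that
  its real supremum is meaningful; \<open>0 \<le> z\<close> takes care of the inserted 0.\<close>

lemma max_atoms_le_iff:
  assumes \<nu>: "is_point_measure \<nu>" and sets: "sets \<nu> = sets borel_C0" and z: "0 \<le> z"
    and bound: "emeasure \<nu> {f \<in> C0. c < f s} = 0"
  shows "max_atoms \<nu> s \<le> z \<longleftrightarrow> emeasure \<nu> {f \<in> C0. z < f s} = 0"
proof -
  have sp: "space \<nu> = C0" using sets_eq_imp_space_eq[OF sets] by simp
  have zero_iff: "emeasure \<nu> {f \<in> C0. x < f s} = 0 \<longleftrightarrow> (\<forall>f\<in>C0. 0 < emeasure \<nu> {f} \<longrightarrow> f s \<le> x)" for x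
  proof -
    have "{f \<in> C0. x < f s} \<in> sets \<nu>"
      unfolding sets using sets.top[of borel_C0] by (intro Collect_in_borel_C0) simp_all
    then have "emeasure \<nu> {f \<in> C0. x < f s} = 0 \<longleftrightarrow> (\<forall>f\<in>{f \<in> C0. x < f s}. emeasure \<nu> {f} = 0)"
      by (rule point_measure_zero_iff[OF \<nu>]) (simp add: sets singleton_in_borel_C0)
    then show ?thesis by (auto simp: not_less[symmetric] zero_less_iff_neq_zero)
  qed
  let ?X = "insert 0 {f s | f. f \<in> space \<nu> \<and> 0 < emeasure \<nu> {f}}"
  have "bdd_above ?X"
  proof (rule bdd_aboveI)
    fix x assume "x \<in> ?X"
    then show "x \<le> max 0 c"
      using bound zero_iff[of c] by (auto simp: sp le_max_iff_disj)
  qed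
  then have "max_atoms \<nu> s \<le> z \<longleftrightarrow> (\<forall>x\<in>?X. x \<le> z)"
    unfolding max_atoms_def by (intro cSup_le_iff) auto
  then show ?thesis
    using z zero_iff[of z] by (auto simp: sp)
qed

text \<open>\<open>same_law\<close> compares results of \<open>distr\<close>, which is also defined
  for maps not known to be measurable, such as a pointwise maximum of atoms. Because the other side
  is a genuine probability law, the preimages under \<open>g\<close> must nevertheless be
  measurable.\<close>

lemma same_law_emeasure:
  fixes X :: "'a \<Rightarrow> 't \<Rightarrow> real"
  assumes "prob_space M" "X \<in> M \<rightarrow>\<^sub>M path_space" "prob_space Q" and same: "same_law M X Q g"
    and A: "A \<in> sets path_space"
  shows "g -` A \<inter> space Q \<in> sets Q" "emeasure M (X -` A \<inter> space M) = emeasure Q (g -` A \<inter> space Q)"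
proof -
  interpret M: prob_space M by fact
  interpret Q: prob_space Q by fact
  interpret D: prob_space "distr M path_space X"
    using assms(2) by (rule M.prob_space_distr)
  \<comment> \<open>\<open>distr\<close> falls back to the zero measure when the masses of the
    preimages do not define a measure.\<close>
  have conv: "emeasure (distr M path_space X) B =
      (if B \<in> sets path_space \<and> measure_space UNIV (sets path_space) (\<lambda>A. emeasure Q (g -` A \<inter> space Q))
       then emeasure Q (g -` B \<inter> space Q) else 0)" for B
    using same[unfolded same_law_def] sets.sigma_sets_eq[of "path_space :: ('t \<Rightarrow> real) measure"]
    by (simp add: distr_def[of Q] emeasure_measure_of_conv space_PiM)
  have eq: "emeasure M (X -` B \<inter> space M) = emeasure Q (g -` B \<inter> space Q)" if "B \<in> sets path_space" for B
  proof -
    \<comment> \<open>Total mass 1 excludes the fallback.\<close>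
    have "measure_space UNIV (sets path_space) (\<lambda>A. emeasure Q (g -` A \<inter> space Q))"
      using conv[of UNIV] D.emeasure_space_1 by (auto simp: space_PiM split: if_splits)
    then show ?thesis
      using conv[of B] that assms(2) by (simp add: emeasure_distr)
  qed
  show "emeasure M (X -` A \<inter> space M) = emeasure Q (g -` A \<inter> space Q)" by (rule eq[OF A])
  text \<open>Nonmeasurable sets get the junk value \<open>0\<close>, but the preimages of \<open>A\<close> and of its complement have total mass \<open>1\<close>.\<close>
  show "g -` A \<inter> space Q \<in> sets Q"
  proof (rule ccontr)
    assume not_meas: "g -` A \<inter> space Q \<notin> sets Q"
    have A': "- A \<in> sets path_space"
      using sets.compl_sets[OF A] by (simp add: space_PiM Compl_eq_Diff_UNIV)
    have compl: "g -` (- A) \<inter> space Q = space Q - (g -` A \<inter> space Q)" by auto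
    have "g -` (- A) \<inter> space Q \<notin> sets Q"
    proof
      assume "g -` (- A) \<inter> space Q \<in> sets Q"
      then have "space Q - (g -` (- A) \<inter> space Q) \<in> sets Q" by (rule sets.compl_sets)
      moreover have "space Q - (g -` (- A) \<inter> space Q) = g -` A \<inter> space Q" by auto
      ultimately show False using not_meas by simp
    qed
    with not_meas have "emeasure M (X -` A \<inter> space M) = 0" "emeasure M (X -` (- A) \<inter> space M) = 0"
      using eq[OF A] eq[OF A'] by (simp_all add: emeasure_notin_sets)
    moreover have "emeasure M (X -` A \<inter> space M) + emeasure M (X -` (- A) \<inter> space M) = emeasure M (space M)"
    proof -
      have "(X -` A \<inter> space M) \<union> (X -` (- A) \<inter> space M) = space M" by auto
      moreover have "X -` A \<inter> space M \<in> sets M" "X -` (- A) \<inter> space M \<in> sets M"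
        using assms(2) A A' by (auto intro: measurable_sets)
      ultimately show ?thesis
        using plus_emeasure[of "X -` A \<inter> space M" M "X -` (- A) \<inter> space M"] by auto
    qed
    ultimately show False using M.emeasure_space_1 by simp
  qed
qed

lemma level_tendsto_zero:
  assumes sets: "sets \<mu> = sets borel_C0" and fin: "emeasure \<mu> {f \<in> C0. 1 < f s} < \<infinity>"
  shows "(\<lambda>n. measure \<mu> {f \<in> C0. real (Suc n) < f s}) \<longlonglongrightarrow> 0"
proof -
  have meas: "{f \<in> C0. x < f s} \<in> sets \<mu>" for x
    unfolding sets using sets.top[of borel_C0] by (intro Collect_in_borel_C0) simp_all
  have "(\<lambda>n. measure \<mu> {f \<in> C0. real (Suc n) < f s}) \<longlonglongrightarrow> measure \<mu> (\<Inter>n. {f \<in> C0. real (Suc n) < f s})"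
  proof (rule Lim_measure_decseq)
    show "decseq (\<lambda>n. {f \<in> C0. real (Suc n) < f s})"
      by (auto simp: decseq_def)
    show "emeasure \<mu> {f \<in> C0. real (Suc n) < f s} \<noteq> \<infinity>" for n
    proof -
      have "emeasure \<mu> {f \<in> C0. real (Suc n) < f s} \<le> emeasure \<mu> {f \<in> C0. 1 < f s}"
        by (rule emeasure_mono[OF _ meas]) auto
      with fin show ?thesis by (auto simp: top_unique)
    qed
  qed (use meas in auto)
  moreover have "(\<Inter>n. {f \<in> C0. real (Suc n) < f s}) = {}"
  proof (rule equals0I)
    fix f assume f: "f \<in> (\<Inter>n. {f \<in> C0. real (Suc n) < f s})"
    obtain n where "f s < real n" using reals_Archimedean2 by blast
    moreover have "real (Suc n) < f s" using f by blast
    ultimately show False by simp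
  qed
  ultimately show ?thesis by simp
qed

text \<open>The probability of finding no point above level \<open>real (Suc n)\<close> at
  \<open>s\<close> tends to 1, because the intensity of these functions tends to 0.\<close>

lemma (in prob_space) is_PRM_AE_bounded:
  assumes N: "is_PRM M N \<mu>" and sets: "sets \<mu> = sets borel_C0" and fin: "emeasure \<mu> {f \<in> C0. 1 < f s} < \<infinity>"
  shows "AE \<omega> in M. \<exists>c. emeasure (N \<omega>) {f \<in> C0. c < f s} = 0"
proof -
  have meas: "{f \<in> C0. x < f s} \<in> sets \<mu>" for x
    unfolding sets using sets.top[of borel_C0] by (intro Collect_in_borel_C0) simp_all
  note [measurable] = is_PRM_measurable_emeasure[OF N meas]
  let ?E = "\<lambda>n. {\<omega> \<in> space M. emeasure (N \<omega>) {f \<in> C0. real (Suc n) < f s} = 0}"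
  have "exp (- measure \<mu> {f \<in> C0. real (Suc n) < f s}) \<le> prob (\<Union>n. ?E n)" for n
  proof -
    have "emeasure \<mu> {f \<in> C0. real (Suc n) < f s} \<le> emeasure \<mu> {f \<in> C0. 1 < f s}"
      by (rule emeasure_mono[OF _ meas]) auto
    then have "emeasure \<mu> {f \<in> C0. real (Suc n) < f s} < \<infinity>"
      using fin by (rule le_less_trans)
    then have "exp (- measure \<mu> {f \<in> C0. real (Suc n) < f s}) = prob (?E n)"
      by (rule is_PRM_prob_zero[OF N meas, symmetric])
    also have "\<dots> \<le> prob (\<Union>n. ?E n)"
      by (rule finite_measure_mono) auto
    finally show ?thesis .
  qed
  moreover have "(\<lambda>n. exp (- measure \<mu> {f \<in> C0. real (Suc n) < f s})) \<longlonglongrightarrow> exp (- 0)"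
    by (intro tendsto_intros level_tendsto_zero sets fin)
  ultimately have "exp (- 0) \<le> prob (\<Union>n. ?E n)"
    by (intro LIMSEQ_le_const2) auto
  then have "prob (\<Union>n. ?E n) = 1"
    by (simp add: antisym)
  then have "AE \<omega> in M. \<omega> \<in> (\<Union>n. ?E n)"
    by (rule AE_prob_1)
  then show ?thesis
    by eventually_elim auto
qed

text \<open>The process is at most \<open>z\<close> at \<open>s\<close> exactly when its Poisson
  random measure has no point above \<open>z\<close> there, up to a null event. The result is a void
  probability of the same form as in the law of the algorithm's final value.\<close>

lemma cont_max_id_process_prob_le:
  fixes X :: "'a \<Rightarrow> 't::metric_space \<Rightarrow> real"
  assumes X: "cont_max_id_process M X \<mu>" and z: "0 < z"
  shows "measure M {\<omega> \<in> space M. X \<omega> s \<le> z} = exp (- measure \<mu> {f \<in> C0. z < f s})"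
    and "emeasure \<mu> {f \<in> C0. z < f s} < \<infinity>"
proof -
  from X have M: "prob_space M" and X_meas: "X \<in> M \<rightarrow>\<^sub>M path_space" and "exponent_measure M X \<mu>"
    by (auto simp: cont_max_id_process_def)
  note ex = \<open>exponent_measure M X \<mu>\<close>[unfolded exponent_measure_def]
  obtain Q :: "('t \<Rightarrow> real) measure measure" and N where Q: "prob_space Q" and N: "is_PRM Q N \<mu>"
    and same: "same_law M X Q (\<lambda>\<omega>. max_atoms (N \<omega>))"
    using conjunct1[OF ex] by (elim exE conjE) (rule that)
  have sets: "sets \<mu> = sets borel_C0"
    using ex by (elim conjE)
  have fin: "emeasure \<mu> {f \<in> C0. (SUP k\<in>K. f k) > e} < \<infinity>" if "compact K" "K \<noteq> {}" "0 < e" for K e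
    using conjunct2[OF conjunct2[OF ex]] that by simp
  interpret M: prob_space M by fact
  interpret Q: prob_space Q by fact
  have fin': "emeasure \<mu> {f \<in> C0. e < f s} < \<infinity>" if "0 < e" for e
    using fin[of "{s}" e] that by simp
  show "emeasure \<mu> {f \<in> C0. z < f s} < \<infinity>" by (rule fin'[OF z])
  have meas: "{f \<in> C0. z < f s} \<in> sets \<mu>"
    unfolding sets using sets.top[of borel_C0] by (intro Collect_in_borel_C0) simp_all
  define A where "A = {x \<in> space (path_space :: ('t \<Rightarrow> real) measure). x s \<le> z}"
  have A: "A \<in> sets path_space" unfolding A_def by measurable
  note law = same_law_emeasure[OF M X_meas Q same A]
  have "emeasure M {\<omega> \<in> space M. X \<omega> s \<le> z} = emeasure Q ((\<lambda>\<omega>. max_atoms (N \<omega>)) -` A \<inter> space Q)"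
    unfolding law(2)[symmetric] by (rule arg_cong[of _ _ "emeasure M"]) (auto simp: A_def space_PiM)
  also have "\<dots> = emeasure Q {\<omega> \<in> space Q. emeasure (N \<omega>) {f \<in> C0. z < f s} = 0}"
  proof (rule emeasure_eq_AE)
    show "AE \<omega> in Q. \<omega> \<in> (\<lambda>\<omega>. max_atoms (N \<omega>)) -` A \<inter> space Q \<longleftrightarrow>
        \<omega> \<in> {\<omega> \<in> space Q. emeasure (N \<omega>) {f \<in> C0. z < f s} = 0}"
      using Q.is_PRM_AE_bounded[OF N sets fin'[OF zero_less_one]] AE_space
    proof eventually_elim
      case (elim \<omega>)
      then obtain c where c: "emeasure (N \<omega>) {f \<in> C0. c < f s} = 0" by blast
      have "is_point_measure (N \<omega>)" using N elim(2) by (simp add: is_PRM_def)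
      moreover have "sets (N \<omega>) = sets borel_C0"
        using Q.is_PRM_sets[OF N elim(2)] sets by simp
      ultimately have "max_atoms (N \<omega>) s \<le> z \<longleftrightarrow> emeasure (N \<omega>) {f \<in> C0. z < f s} = 0"
        using less_imp_le[OF z] c by (rule max_atoms_le_iff)
      then show ?case using elim(2) by (simp add: A_def space_PiM)
    qed
    show "{\<omega> \<in> space Q. emeasure (N \<omega>) {f \<in> C0. z < f s} = 0} \<in> sets Q"
      using Q.is_PRM_measurable_emeasure[OF N meas] by measurable
  qed (fact law)
  also have "\<dots> = ennreal (exp (- measure \<mu> {f \<in> C0. z < f s}))"
    using Q.is_PRM_prob_zero[OF N meas fin'[OF z]] by (simp add: Q.emeasure_eq_measure)
  finally show "measure M {\<omega> \<in> space M. X \<omega> s \<le> z} = exp (- measure \<mu> {f \<in> C0. z < f s})"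
    by (simp add: M.emeasure_eq_measure ennreal_inj)
qed

section \<open>Comparison of the laws, and the standard exponential variable for continuous
  margins\<close>

lemma distr_eq_of_positive:
  fixes R :: "'w \<Rightarrow> real" and Y :: "'b \<Rightarrow> real"
  assumes P: "prob_space P" and R: "R \<in> borel_measurable P" and R_pos: "AE \<omega> in P. 0 < R \<omega>"
    and Q: "prob_space Q" and Y: "Y \<in> borel_measurable Q"
    and eq: "\<And>z. 0 < z \<Longrightarrow> measure P {\<omega> \<in> space P. R \<omega> \<le> z} = measure Q {\<omega> \<in> space Q. Y \<omega> \<le> z}"
  shows "distr P borel R = distr Q borel Y"
proof -
  interpret P: prob_space P by fact
  interpret Q: prob_space Q by fact
  interpret R: real_distribution "distr P borel R" using R by (rule P.real_distribution_distr)
  interpret Y: real_distribution "distr Q borel Y" using Y by (rule Q.real_distribution_distr)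
  have cdf_R: "cdf (distr P borel R) z = measure P {\<omega> \<in> space P. R \<omega> \<le> z}" for z
    using R by (auto simp: cdf_def measure_distr intro!: arg_cong[of _ _ "measure P"])
  have cdf_Y: "cdf (distr Q borel Y) z = measure Q {\<omega> \<in> space Q. Y \<omega> \<le> z}" for z
    using Y by (auto simp: cdf_def measure_distr intro!: arg_cong[of _ _ "measure Q"])
  have R0: "cdf (distr P borel R) 0 = 0"
  proof -
    have "measure P {\<omega> \<in> space P. R \<omega> \<le> 0} = measure P {}"
      by (rule P.finite_measure_eq_AE) (use R_pos R in \<open>auto elim!: eventually_mono\<close>)
    then show ?thesis by (simp add: cdf_R)
  qed
  \<comment> \<open>The distribution functions are known to agree on positive arguments only. Right
    continuity carries the value 0 of the first one at 0 over to the second, and monotonicity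
    settles the negative arguments.\<close>
  have "(cdf (distr P borel R) \<longlongrightarrow> cdf (distr P borel R) 0) (at_right 0)"
    using R.cdf_is_right_cont by (simp add: continuous_within)
  then have "(cdf (distr Q borel Y) \<longlongrightarrow> 0) (at_right 0)"
    unfolding R0 by (rule Lim_transform_within[OF _ zero_less_one]) (simp add: cdf_R cdf_Y eq)
  moreover have "(cdf (distr Q borel Y) \<longlongrightarrow> cdf (distr Q borel Y) 0) (at_right 0)"
    using Y.cdf_is_right_cont by (simp add: continuous_within)
  ultimately have Y0: "cdf (distr Q borel Y) 0 = 0"
    using tendsto_unique[OF trivial_limit_at_right_real] by blast
  have "cdf (distr P borel R) z = cdf (distr Q borel Y) z" for z
  proof (cases "0 < z")
    case True
    then show ?thesis by (simp add: cdf_R cdf_Y eq)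
  next
    case False
    then have "cdf (distr P borel R) z \<le> 0" "cdf (distr Q borel Y) z \<le> 0"
      using R.cdf_nondecreasing[of z 0] Y.cdf_nondecreasing[of z 0] R0 Y0 by auto
    then show ?thesis
      using R.cdf_nonneg[of z] Y.cdf_nonneg[of z] by simp
  qed
  then show ?thesis
    by (intro cdf_unique R.real_distribution_axioms Y.real_distribution_axioms ext)
qed

text \<open>Probability integral transform: a continuous distribution function evaluated at its own
  variable is uniform, so minus its logarithm is standard exponential and has mean 1.\<close>

lemma (in prob_space) nn_integral_log_cdf:
  fixes R :: "'a \<Rightarrow> real"
  assumes R [measurable]: "R \<in> borel_measurable M" and G_pos: "AE \<omega> in M. 0 < cdf (distr M borel R) (R \<omega>)"
    and cont: "continuous_on UNIV (cdf (distr M borel R))"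
  shows "(\<integral>\<^sup>+\<omega>. ennreal (- ln (cdf (distr M borel R) (R \<omega>))) \<partial>M) = 1"
proof -
  interpret R: real_distribution "distr M borel R" by (rule real_distribution_distr) simp
  define G where "G = cdf (distr M borel R)"
  have G: "G x = prob {\<omega> \<in> space M. R \<omega> \<le> x}" for x
    by (auto simp: G_def cdf_def measure_distr intro!: arg_cong[of _ _ prob])
  have G_cont: "continuous_on UNIV G" using cont by (simp add: G_def)
  then have [measurable]: "G \<in> borel_measurable borel" by (rule borel_measurable_continuous_onI)
  have G_mono: "G x \<le> G y" if "x \<le> y" for x y
    unfolding G_def using that by (rule R.cdf_nondecreasing)
  have quantile: "\<exists>x. G x = p" if p: "0 < p" "p < 1" for p
  proof -
    have "eventually (\<lambda>x. G x < p) at_bot"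
      using R.cdf_lim_at_bot p(1) unfolding G_def by (rule order_tendstoD)
    then obtain a where a: "G a < p" by (auto simp: eventually_at_bot_linorder)
    have "eventually (\<lambda>x. p < G x) at_top"
      using R.cdf_lim_at_top_prob p(2) unfolding G_def by (rule order_tendstoD)
    then obtain b where b: "p < G b" by (auto simp: eventually_at_top_linorder)
    have "a \<le> b" using a b G_mono[of b a] by (meson leI less_le_not_le less_trans)
    then show ?thesis
      using IVT'[of G a p b] a b continuous_on_subset[OF G_cont] by auto
  qed
  \<comment> \<open>\<open>G\<close> may have flat pieces and no inverse; some solution of
    \<open>G x = p\<close> from the intermediate value theorem and monotonicity suffice. The case
    \<open>p = 1\<close> serves \<open>a = 0\<close> below.\<close>
  have G_less: "prob {\<omega> \<in> space M. G (R \<omega>) < p} = p" if p: "0 < p" "p \<le> 1" for p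
  proof (rule antisym)
    show "prob {\<omega> \<in> space M. G (R \<omega>) < p} \<le> p"
    proof (cases "p = 1")
      case False
      with p obtain x where x: "G x = p" using quantile[of p] by auto
      have "prob {\<omega> \<in> space M. G (R \<omega>) < p} \<le> prob {\<omega> \<in> space M. R \<omega> \<le> x}"
        using G_mono x by (intro finite_measure_mono) (auto, meson leD linear)
      then show ?thesis using x G by simp
    qed simp
    show "p \<le> prob {\<omega> \<in> space M. G (R \<omega>) < p}"
    proof (rule dense_le_bounded[OF p(1)])
      fix p' assume p': "0 < p'" "p' < p"
      with p obtain x where x: "G x = p'" using quantile[of p'] by auto
      have "prob {\<omega> \<in> space M. R \<omega> \<le> x} \<le> prob {\<omega> \<in> space M. G (R \<omega>) < p}"
        using G_mono x p'(2) by (intro finite_measure_mono) (auto intro: le_less_trans)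
      then show "p' \<le> prob {\<omega> \<in> space M. G (R \<omega>) < p}" using x G by simp
    qed
  qed
  define U where "U \<omega> = - ln (G (R \<omega>))" for \<omega>
  have U_meas [measurable]: "U \<in> borel_measurable M" unfolding U_def by measurable
  have "distributed M lborel U (exponential_density 1)"
  proof (subst exponential_distributed_iff)
    show "U \<in> borel_measurable M \<and> (\<forall>a\<ge>0. \<P>(x in M. U x \<le> a) = 1 - exp (- a * 1))"
    proof (intro conjI allI impI)
      fix a :: real assume a: "0 \<le> a"
      have "prob {\<omega> \<in> space M. U \<omega> \<le> a} = prob (space M - {\<omega> \<in> space M. G (R \<omega>) < exp (- a)})"
      proof (rule finite_measure_eq_AE)
        show "AE \<omega> in M. \<omega> \<in> {\<omega> \<in> space M. U \<omega> \<le> a} \<longleftrightarrow> \<omega> \<in> space M - {\<omega> \<in> space M. G (R \<omega>) < exp (- a)}"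
          using G_pos
        proof eventually_elim
          case (elim \<omega>)
          then have "U \<omega> \<le> a \<longleftrightarrow> exp (- a) \<le> G (R \<omega>)"
            by (auto simp: U_def G_def ln_ge_iff[symmetric])
          then show ?case by auto
        qed
      qed measurable
      also have "\<dots> = 1 - exp (- a)"
        using a by (subst prob_compl) (simp_all add: G_less)
      finally show "prob {\<omega> \<in> space M. U \<omega> \<le> a} = 1 - exp (- a * 1)" by simp
    qed measurable
  qed simp
  then have E: "expectation U = 1"
    using exponential_distributed_expectation[of 1 U] by simp
  \<comment> \<open>The Bochner integral of a nonintegrable function is 0 by convention, so the
    value 1 proves integrability.\<close>
  then have "integrable M U"
    using not_integrable_integral_eq by force
  moreover have "AE \<omega> in M. 0 \<le> U \<omega>"
    using G_pos by eventually_elim (simp add: U_def G_def R.cdf_bounded_prob)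
  ultimately have "(\<integral>\<^sup>+\<omega>. ennreal (U \<omega>) \<partial>M) = ennreal (expectation U)"
    by (rule nn_integral_eq_integral)
  then show ?thesis by (simp add: E U_def G_def)
qed

text \<open>By monotonicity in \<open>x\<close>, the superlevel sets are intervals.\<close>

lemma measurable_emeasure_level:
  assumes sets: "sets \<mu> = sets borel_C0"
  shows "(\<lambda>x. emeasure \<mu> {f \<in> C0. x \<le> f s}) \<in> borel_measurable borel"
proof (rule borel_measurableI_greater)
  fix a
  have meas: "{f \<in> C0. x \<le> f s} \<in> sets \<mu>" for x
    unfolding sets using sets.top[of borel_C0] by (intro Collect_in_borel_C0) simp_all
  have "emeasure \<mu> {f \<in> C0. y \<le> f s} \<le> emeasure \<mu> {f \<in> C0. x \<le> f s}" if "x \<le> y" for x y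
    using that by (intro emeasure_mono meas) auto
  then have "is_interval {x. a < emeasure \<mu> {f \<in> C0. x \<le> f s}}"
    unfolding is_interval_1 by (auto intro: less_le_trans)
  then show "{x \<in> space borel. a < emeasure \<mu> {f \<in> C0. x \<le> f s}} \<in> sets borel"
    by (simp add: real_interval_borel_measurable)
qed

text \<open>\<open>G\<close> determines the mass of strict exceedances, whereas the count concerns
  weak ones. Left continuity of \<open>G\<close> closes this gap: exceedances of \<open>y\<close>
  increase the set \<open>{f \<in> C0. x \<le> f s}\<close> for every \<open>y < x\<close>.\<close>

lemma emeasure_level_eq_log_cdf:
  assumes sets: "sets \<mu> = sets borel_C0" and fin: "\<And>e. 0 < e \<Longrightarrow> emeasure \<mu> {f \<in> C0. e < f s} < \<infinity>"
    and G: "\<And>z. 0 < z \<Longrightarrow> G z = exp (- measure \<mu> {f \<in> C0. z < f s})"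
    and cont: "continuous_on UNIV G" and x: "0 < x"
  shows "emeasure \<mu> {f \<in> C0. x \<le> f s} = ennreal (- ln (G x))"
proof -
  have meas: "{f \<in> C0. y < f s} \<in> sets \<mu>" "{f \<in> C0. y \<le> f s} \<in> sets \<mu>" for y
    unfolding sets using sets.top[of borel_C0] by (intro Collect_in_borel_C0; simp)+
  have finx: "emeasure \<mu> {f \<in> C0. x \<le> f s} < \<infinity>"
  proof (rule le_less_trans[OF emeasure_mono fin])
    show "{f \<in> C0. x \<le> f s} \<subseteq> {f \<in> C0. x / 2 < f s}" using x by auto
    show "{f \<in> C0. x / 2 < f s} \<in> sets \<mu>" by (rule meas)
    show "0 < x / 2" using x by simp
  qed
  have "exp (- measure \<mu> {f \<in> C0. x \<le> f s}) \<le> G x"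
    unfolding G[OF x] using finx meas by (auto intro!: measure_mono_fmeasurable fmeasurableI)
  moreover have "G x \<le> exp (- measure \<mu> {f \<in> C0. x \<le> f s})"
  proof (rule tendsto_upperbound)
    show "(G \<longlongrightarrow> G x) (at_left x)"
      using cont by (simp add: continuous_on_eq_continuous_at continuous_at_imp_continuous_at_within continuous_within[symmetric])
    have "eventually (\<lambda>y. y \<in> {0<..<x}) (at_left x)"
      using x by (rule eventually_at_leftI[rotated]) simp
    then show "eventually (\<lambda>y. G y \<le> exp (- measure \<mu> {f \<in> C0. x \<le> f s})) (at_left x)"
    proof eventually_elim
      case (elim y)
      then have "measure \<mu> {f \<in> C0. x \<le> f s} \<le> measure \<mu> {f \<in> C0. y < f s}"
        using fin[of y] meas by (intro measure_mono_fmeasurable fmeasurableI) auto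
      then show ?case using elim G[of y] by simp
    qed
  qed simp
  ultimately have "G x = exp (- measure \<mu> {f \<in> C0. x \<le> f s})" by simp
  then show ?thesis
    using finx by (simp add: emeasure_eq_ennreal_measure less_top[symmetric])
qed

text \<open>Moves the mean from the algorithm's own final value \<open>R\<close> to the process
  \<open>Xt\<close>: both have the same void probabilities on positive levels, hence the same law at
  \<open>t i\<close>.\<close>

lemma (in top_down) expected_counts:
  fixes Xt :: "'b \<Rightarrow> 't \<Rightarrow> real"
  assumes X: "cont_max_id_process M' Xt \<mu>" and i: "i \<in> {1..d} - J"
  shows "\<exists>C\<in>borel_measurable P.
    (AE \<omega> in P. emeasure (count_space UNIV) (simulated_cont (earlier t J i) (t i)
      (process_after t J (\<lambda>i n. F i n \<omega>) (i - 1)) (\<lambda>n. F i n \<omega>)) = C \<omega>) \<and>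
    (AE \<omega> in P. emeasure (count_space UNIV) (simulated (earlier t J i) (t i)
      (process_after t J (\<lambda>i n. F i n \<omega>) (i - 1)) (\<lambda>n. F i n \<omega>)) = 1 + C \<omega>) \<and>
    (\<integral>\<^sup>+\<omega>. C \<omega> \<partial>P) = (\<integral>\<^sup>+\<omega>. emeasure \<mu> {f \<in> C0. f (t i) \<in> {Xt \<omega> (t i)..}} \<partial>M') \<and>
    (continuous_on UNIV (cdf (distr M' borel (\<lambda>\<omega>. Xt \<omega> (t i)))) \<longrightarrow> (\<integral>\<^sup>+\<omega>. C \<omega> \<partial>P) = 1)"
proof -
  from i obtain i' where Suc: "i = Suc i'" by (cases i) auto
  have M': "prob_space M'" and Xt: "Xt \<in> M' \<rightarrow>\<^sub>M path_space"
    using X by (auto simp: cont_max_id_process_def)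
  have Y: "(\<lambda>\<omega>. Xt \<omega> (t i)) \<in> borel_measurable M'"
    by (rule measurable_compose[OF Xt measurable_component_singleton]) simp
  obtain R C where R: "R \<in> borel_measurable P" "AE \<omega> in P. 0 < R \<omega>"
    "\<And>z. 0 < z \<Longrightarrow> prob {\<omega> \<in> space P. R \<omega> \<le> z} = exp (- measure \<mu> {f \<in> C0. z < f (t i)})"
    and C: "C \<in> borel_measurable P"
    "AE \<omega> in P. emeasure (count_space UNIV) (simulated_cont (t ` treated i') (t i) (process i' \<omega>) (\<lambda>n. F i n \<omega>)) = C \<omega>"
    "AE \<omega> in P. emeasure (count_space UNIV) (simulated (t ` treated i') (t i) (process i' \<omega>) (\<lambda>n. F i n \<omega>)) = 1 + C \<omega>"
    "(\<integral>\<^sup>+\<omega>. C \<omega> \<partial>P) = (\<integral>\<^sup>+\<omega>. emeasure \<mu> {f \<in> C0. R \<omega> \<le> f (t i)} \<partial>P)"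
    by (rule top_level_law_and_counts[OF i[unfolded Suc], folded Suc]) (rule that; assumption)
  have law: "distr P borel R = distr M' borel (\<lambda>\<omega>. Xt \<omega> (t i))"
    using prob_space_axioms R(1,2) M' Y
    by (rule distr_eq_of_positive) (simp add: R(3) cont_max_id_process_prob_le(1)[OF X])
  note h = measurable_emeasure_level[OF sets_\<mu>, of "t i"]
  have "(\<integral>\<^sup>+\<omega>. C \<omega> \<partial>P) = (\<integral>\<^sup>+x. emeasure \<mu> {f \<in> C0. x \<le> f (t i)} \<partial>distr P borel R)"
    unfolding C(4) using R(1) h by (simp add: nn_integral_distr)
  also have "\<dots> = (\<integral>\<^sup>+\<omega>. emeasure \<mu> {f \<in> C0. f (t i) \<in> {Xt \<omega> (t i)..}} \<partial>M')"
    unfolding law using Y h by (simp add: nn_integral_distr)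
  finally have mean: "(\<integral>\<^sup>+\<omega>. C \<omega> \<partial>P) = (\<integral>\<^sup>+\<omega>. emeasure \<mu> {f \<in> C0. f (t i) \<in> {Xt \<omega> (t i)..}} \<partial>M')" .
  have one: "(\<integral>\<^sup>+\<omega>. C \<omega> \<partial>P) = 1" if "continuous_on UNIV (cdf (distr M' borel (\<lambda>\<omega>. Xt \<omega> (t i))))"
  proof -
    let ?G = "cdf (distr P borel R)"
    have cont: "continuous_on UNIV ?G" using that by (simp add: law)
    have G: "?G z = exp (- measure \<mu> {f \<in> C0. z < f (t i)})" if "0 < z" for z
    proof -
      have "?G z = prob {\<omega> \<in> space P. R \<omega> \<le> z}"
        using R(1) by (auto simp: cdf_def measure_distr intro!: arg_cong[of _ _ prob])
      then show ?thesis by (simp add: R(3) that)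
    qed
    have "(\<integral>\<^sup>+\<omega>. C \<omega> \<partial>P) = (\<integral>\<^sup>+\<omega>. ennreal (- ln (?G (R \<omega>))) \<partial>P)"
      unfolding C(4)
    proof (rule nn_integral_cong_AE)
      show "AE \<omega> in P. emeasure \<mu> {f \<in> C0. R \<omega> \<le> f (t i)} = ennreal (- ln (?G (R \<omega>)))"
        using R(2) by eventually_elim (rule emeasure_level_eq_log_cdf[OF sets_\<mu> fin G cont])
    qed
    also have "\<dots> = 1"
    proof (rule nn_integral_log_cdf[OF R(1) _ cont])
      show "AE \<omega> in P. 0 < ?G (R \<omega>)"
        using R(2) by eventually_elim (simp add: G)
    qed
    finally show ?thesis .
  qed
  have "earlier t J i = t ` treated i'" "process_after t J (\<lambda>i n. F i n \<omega>) (i - 1) = process i' \<omega>" for \<omega>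
    by (simp_all add: Suc earlier_Suc process_def)
  with C mean one show ?thesis
    by (intro bexI[of _ C]) simp_all
qed

section \<open>Assembly of the two steps\<close>

lemma first_positive_part_total:
  assumes sets: "sets \<mu> = sets borel_C0" and J: "finite J"
  shows "(\<Sum>j\<in>J. emeasure (first_positive_part \<mu> t J j) C0) = emeasure \<mu> {f \<in> C0. \<exists>j\<in>J. 0 < f (t j)}"
proof -
  \<comment> \<open>These sets sort the functions by the first location of \<open>J\<close> at which
    they are positive, so they are disjoint and nothing positive on \<open>J\<close> is
    missed.\<close>
  let ?A = "\<lambda>j. {f \<in> C0. 0 < f (t j) \<and> (\<forall>k\<in>J. k < j \<longrightarrow> f (t k) = 0)}"
  have meas: "?A j \<in> sets \<mu>" for j
  proof -
    have "?A j = {f \<in> space borel_C0. 0 < f (t j) \<and> (\<forall>k\<in>J. k < j \<longrightarrow> f (t k) = 0)}" by simp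
    also have "\<dots> \<in> sets \<mu>" unfolding sets using J by measurable
    finally show ?thesis .
  qed
  have C0: "C0 \<in> sets \<mu>" using sets.top[of borel_C0] sets by simp
  have "emeasure (first_positive_part \<mu> t J j) C0 = emeasure \<mu> (?A j)" for j
  proof -
    have "?A j \<inter> C0 = ?A j" by auto
    then show ?thesis
      unfolding first_positive_part_def emeasure_restricted[OF meas C0] by simp
  qed
  then have "(\<Sum>j\<in>J. emeasure (first_positive_part \<mu> t J j) C0) = (\<Sum>j\<in>J. emeasure \<mu> (?A j))"
    by simp
  also have "\<dots> = emeasure \<mu> (\<Union>j\<in>J. ?A j)"
  proof (rule sum_emeasure)
    show "disjoint_family_on ?A J"
      unfolding disjoint_family_on_def
    proof (intro ballI impI equals0I)
      fix j k f assume "j \<in> J" "k \<in> J" "j \<noteq> k" "f \<in> ?A j \<inter> ?A k"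
      then show False by (cases j k rule: linorder_cases) auto
    qed
  qed (use meas J in auto)
  also have "(\<Union>j\<in>J. ?A j) = {f \<in> C0. \<exists>j\<in>J. 0 < f (t j)}"
  proof (intro equalityI subsetI)
    fix f assume "f \<in> {f \<in> C0. \<exists>j\<in>J. 0 < f (t j)}"
    then have f: "f \<in> C0" and ex: "\<exists>j. j \<in> J \<and> 0 < f (t j)" by auto
    let ?j = "LEAST j. j \<in> J \<and> 0 < f (t j)"
    have "f (t k) = 0" if "k \<in> J" "k < ?j" for k
    proof -
      have "\<not> 0 < f (t k)" using not_less_Least[OF that(2)] that(1) by simp
      moreover have "0 \<le> f (t k)" using f by (simp add: C0_def)
      ultimately show ?thesis by simp
    qed
    then show "f \<in> (\<Union>j\<in>J. ?A j)"
      using LeastI_ex[OF ex] f by blast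
  qed auto
  finally show ?thesis .
qed

theorem theorem3:
  fixes t :: "nat \<Rightarrow> 't::metric_space" and d :: nat
    and M :: "'a measure" and X :: "'a \<Rightarrow> 't \<Rightarrow> real"
    and M' :: "'b measure" and Xt :: "'b \<Rightarrow> 't \<Rightarrow> real"
    and \<mu> \<mu>t :: "('t \<Rightarrow> real) measure" and J0 :: "nat set"
    and P :: "'w measure" and N :: "nat \<Rightarrow> 'w \<Rightarrow> ('t \<Rightarrow> real) measure"
    and F :: "nat \<Rightarrow> nat \<Rightarrow> 'w \<Rightarrow> 't \<Rightarrow> real"
  assumes "locally compact (UNIV :: 't set)"
    and "cont_max_id_process M X \<mu>"
    and "J0 = zero_locations M X t d"
    and "\<mu>t = vanishing_part \<mu> t J0"
    and "cont_max_id_process M' Xt \<mu>t"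
    and "algorithm_input P \<mu> t d J0 N F"
  shows "(\<integral>\<^sup>+\<omega>. num_simulated t d J0 (\<lambda>i. N i \<omega>) (\<lambda>i n. F i n \<omega>) \<partial>P)
        = of_nat (d - card J0) + emeasure \<mu> {f \<in> C0. \<exists>j\<in>J0. f (t j) > 0}
          + (\<Sum>i\<in>{1..d} - J0. \<integral>\<^sup>+\<omega>. emeasure \<mu>t {f \<in> C0. f (t i) \<in> {Xt \<omega> (t i)..}} \<partial>M')
      \<and> ((\<forall>i\<in>{1..d} - J0. continuous_on UNIV (cdf (distr M' borel (\<lambda>\<omega>. Xt \<omega> (t i))))) \<longrightarrow>
        (\<integral>\<^sup>+\<omega>. num_simulated_cont t d J0 (\<lambda>i. N i \<omega>) (\<lambda>i n. F i n \<omega>) \<partial>P)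
        = of_nat (d - card J0) + emeasure \<mu> {f \<in> C0. \<exists>j\<in>J0. f (t j) > 0})"
proof -
  let ?I = "{1..d} - J0"
  have J0: "J0 \<subseteq> {1..d}" "finite J0"
    unfolding assms(3) zero_locations_def by auto
  have sets_M: "sets \<mu> = sets borel_C0"
    using assms(2) unfolding cont_max_id_process_def exponent_measure_def by (elim conjE)
  have sets_\<mu>t: "sets \<mu>t = sets borel_C0"
    by (simp add: assms(4) vanishing_part_def sets_M)
  note input = assms(6)[unfolded algorithm_input_def]
  interpret top_down P \<mu>t t d J0 N F
  proof (intro top_down.intro top_down_axioms.intro)
    show "emeasure \<mu>t {f \<in> C0. e < f (t k)} < \<infinity>" if "0 < e" for k e
      by (rule cont_max_id_process_prob_le(2)[OF assms(5) that])
    show "prob_space P" "prob_space.indep_vars P (\<lambda>_. measure_algebra borel_C0) N {1..d}"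
      using input by blast+
    show "sets \<mu>t = sets borel_C0" by (rule sets_\<mu>t)
    show "is_PRM P (N i) \<mu>t" "F i n \<in> P \<rightarrow>\<^sub>M borel_C0" "AE \<omega> in P. ordered_points (t i) (N i \<omega>) (\<lambda>n. F i n \<omega>)"
      if "i \<in> ?I" for i n
      using input that unfolding assms(4) by blast+
  qed
  have PRM_J0: "is_PRM P (N j) (first_positive_part \<mu> t J0 j)" if "j \<in> J0" for j
    using input that by blast
  have sets_first: "sets (first_positive_part \<mu> t J0 j) = sets borel_C0" for j
    by (simp add: first_positive_part_def sets_M)
  have C0: "C0 \<in> sets (first_positive_part \<mu> t J0 j)" for j
    using sets.top[of borel_C0] sets_first[of j] by simp
  define A where "A \<omega> = (\<Sum>j\<in>J0. emeasure (N j \<omega>) (space (N j \<omega>)))" for \<omega>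
  have A_eq: "A \<omega> = (\<Sum>j\<in>J0. emeasure (N j \<omega>) C0)" if "\<omega> \<in> space P" for \<omega>
  proof -
    have "space (N j \<omega>) = C0" if "j \<in> J0" for j
      using sets_eq_imp_space_eq[OF sets_N[OF _ \<open>\<omega> \<in> space P\<close>]] that J0 by auto
    then show ?thesis by (simp add: A_def)
  qed
  have N_C0: "(\<lambda>\<omega>. emeasure (N j \<omega>) C0) \<in> borel_measurable P" if "j \<in> J0" for j
    by (rule is_PRM_measurable_emeasure[OF PRM_J0[OF that] C0])
  then have "(\<lambda>\<omega>. \<Sum>j\<in>J0. emeasure (N j \<omega>) C0) \<in> borel_measurable P"
    by (rule borel_measurable_sum)
  then have A_meas [measurable]: "A \<in> borel_measurable P"
    by (subst measurable_cong[OF A_eq])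
  have "(\<integral>\<^sup>+\<omega>. A \<omega> \<partial>P) = (\<integral>\<^sup>+\<omega>. (\<Sum>j\<in>J0. emeasure (N j \<omega>) C0) \<partial>P)"
    by (rule nn_integral_cong) (rule A_eq)
  also have "\<dots> = (\<Sum>j\<in>J0. \<integral>\<^sup>+\<omega>. emeasure (N j \<omega>) C0 \<partial>P)"
    by (rule nn_integral_sum) (rule N_C0)
  also have "\<dots> = (\<Sum>j\<in>J0. emeasure (first_positive_part \<mu> t J0 j) C0)"
    by (intro sum.cong refl is_PRM_nn_integral[OF PRM_J0 C0])
  also have "\<dots> = emeasure \<mu> {f \<in> C0. \<exists>j\<in>J0. 0 < f (t j)}"
    by (rule first_positive_part_total[OF sets_M J0(2)])
  finally have A: "(\<integral>\<^sup>+\<omega>. A \<omega> \<partial>P) = emeasure \<mu> {f \<in> C0. \<exists>j\<in>J0. 0 < f (t j)}" .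
  obtain C where "\<forall>i\<in>?I. C i \<in> borel_measurable P \<and>
    (AE \<omega> in P. emeasure (count_space UNIV) (simulated_cont (earlier t J0 i) (t i)
      (process_after t J0 (\<lambda>i n. F i n \<omega>) (i - 1)) (\<lambda>n. F i n \<omega>)) = C i \<omega>) \<and>
    (AE \<omega> in P. emeasure (count_space UNIV) (simulated (earlier t J0 i) (t i)
      (process_after t J0 (\<lambda>i n. F i n \<omega>) (i - 1)) (\<lambda>n. F i n \<omega>)) = 1 + C i \<omega>) \<and>
    (\<integral>\<^sup>+\<omega>. C i \<omega> \<partial>P) = (\<integral>\<^sup>+\<omega>. emeasure \<mu>t {f \<in> C0. f (t i) \<in> {Xt \<omega> (t i)..}} \<partial>M') \<and>
    (continuous_on UNIV (cdf (distr M' borel (\<lambda>\<omega>. Xt \<omega> (t i)))) \<longrightarrow> (\<integral>\<^sup>+\<omega>. C i \<omega> \<partial>P) = 1)"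
    using bchoice[OF ballI, OF expected_counts[OF assms(5), unfolded Bex_def]] by (rule exE)
  note bspec[OF this]
  then have C: "C i \<in> borel_measurable P"
    and sim_cont: "AE \<omega> in P. emeasure (count_space UNIV) (simulated_cont (earlier t J0 i) (t i)
      (process_after t J0 (\<lambda>i n. F i n \<omega>) (i - 1)) (\<lambda>n. F i n \<omega>)) = C i \<omega>"
    and sim: "AE \<omega> in P. emeasure (count_space UNIV) (simulated (earlier t J0 i) (t i)
      (process_after t J0 (\<lambda>i n. F i n \<omega>) (i - 1)) (\<lambda>n. F i n \<omega>)) = 1 + C i \<omega>"
    and mean: "(\<integral>\<^sup>+\<omega>. C i \<omega> \<partial>P) = (\<integral>\<^sup>+\<omega>. emeasure \<mu>t {f \<in> C0. f (t i) \<in> {Xt \<omega> (t i)..}} \<partial>M')"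
    and one: "continuous_on UNIV (cdf (distr M' borel (\<lambda>\<omega>. Xt \<omega> (t i)))) \<Longrightarrow> (\<integral>\<^sup>+\<omega>. C i \<omega> \<partial>P) = 1"
    if "i \<in> ?I" for i
    using that by blast+
  \<comment> \<open>Additivity of the integral requires measurable summands, which is why the counts
    enter through their measurable versions \<open>C i\<close>.\<close>
  have integral_sum: "(\<integral>\<^sup>+\<omega>. A \<omega> + (\<Sum>i\<in>?I. D i \<omega>) \<partial>P) = (\<integral>\<^sup>+\<omega>. A \<omega> \<partial>P) + (\<Sum>i\<in>?I. \<integral>\<^sup>+\<omega>. D i \<omega> \<partial>P)"
    if "\<And>i. i \<in> ?I \<Longrightarrow> D i \<in> borel_measurable P" for D
  proof -
    have "(\<lambda>\<omega>. \<Sum>i\<in>?I. D i \<omega>) \<in> borel_measurable P"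
      by (rule borel_measurable_sum) (rule that)
    then have "(\<integral>\<^sup>+\<omega>. A \<omega> + (\<Sum>i\<in>?I. D i \<omega>) \<partial>P) = (\<integral>\<^sup>+\<omega>. A \<omega> \<partial>P) + (\<integral>\<^sup>+\<omega>. (\<Sum>i\<in>?I. D i \<omega>) \<partial>P)"
      by (rule nn_integral_add[OF A_meas])
    also have "(\<integral>\<^sup>+\<omega>. (\<Sum>i\<in>?I. D i \<omega>) \<partial>P) = (\<Sum>i\<in>?I. \<integral>\<^sup>+\<omega>. D i \<omega> \<partial>P)"
      by (rule nn_integral_sum) (rule that)
    finally show ?thesis .
  qed
  have card: "card ?I = d - card J0"
    using J0 by (simp add: card_Diff_subset)
  have "(\<integral>\<^sup>+\<omega>. num_simulated t d J0 (\<lambda>i. N i \<omega>) (\<lambda>i n. F i n \<omega>) \<partial>P) =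
      (\<integral>\<^sup>+\<omega>. A \<omega> + (\<Sum>i\<in>?I. 1 + C i \<omega>) \<partial>P)"
  proof (rule nn_integral_cong_AE)
    have "AE \<omega> in P. \<forall>i\<in>?I. emeasure (count_space UNIV) (simulated (earlier t J0 i) (t i)
        (process_after t J0 (\<lambda>i n. F i n \<omega>) (i - 1)) (\<lambda>n. F i n \<omega>)) = 1 + C i \<omega>"
      using sim by (intro AE_ball_countable[THEN iffD2]) auto
    then show "AE \<omega> in P. num_simulated t d J0 (\<lambda>i. N i \<omega>) (\<lambda>i n. F i n \<omega>) = A \<omega> + (\<Sum>i\<in>?I. 1 + C i \<omega>)"
      by eventually_elim (simp add: num_simulated_def A_def)
  qed
  also have "\<dots> = (\<integral>\<^sup>+\<omega>. A \<omega> \<partial>P) + (\<Sum>i\<in>?I. \<integral>\<^sup>+\<omega>. 1 + C i \<omega> \<partial>P)"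
    by (rule integral_sum) (intro borel_measurable_add measurable_const C, simp_all)
  also have "(\<Sum>i\<in>?I. \<integral>\<^sup>+\<omega>. 1 + C i \<omega> \<partial>P) =
      (\<Sum>i\<in>?I. 1 + (\<integral>\<^sup>+\<omega>. emeasure \<mu>t {f \<in> C0. f (t i) \<in> {Xt \<omega> (t i)..}} \<partial>M'))"
    using C by (intro sum.cong refl) (simp add: nn_integral_add emeasure_space_1 mean)
  also have "\<dots> = of_nat (d - card J0) +
      (\<Sum>i\<in>?I. \<integral>\<^sup>+\<omega>. emeasure \<mu>t {f \<in> C0. f (t i) \<in> {Xt \<omega> (t i)..}} \<partial>M')"
    unfolding sum.distrib card[symmetric] by simp
  finally have first: "(\<integral>\<^sup>+\<omega>. num_simulated t d J0 (\<lambda>i. N i \<omega>) (\<lambda>i n. F i n \<omega>) \<partial>P)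
        = of_nat (d - card J0) + emeasure \<mu> {f \<in> C0. \<exists>j\<in>J0. f (t j) > 0}
          + (\<Sum>i\<in>{1..d} - J0. \<integral>\<^sup>+\<omega>. emeasure \<mu>t {f \<in> C0. f (t i) \<in> {Xt \<omega> (t i)..}} \<partial>M')"
    unfolding A by (simp only: add.commute add.left_commute add.assoc)
  have second: "(\<integral>\<^sup>+\<omega>. num_simulated_cont t d J0 (\<lambda>i. N i \<omega>) (\<lambda>i n. F i n \<omega>) \<partial>P)
        = of_nat (d - card J0) + emeasure \<mu> {f \<in> C0. \<exists>j\<in>J0. f (t j) > 0}"
    if cont: "\<forall>i\<in>?I. continuous_on UNIV (cdf (distr M' borel (\<lambda>\<omega>. Xt \<omega> (t i))))"
  proof -
    have "(\<integral>\<^sup>+\<omega>. num_simulated_cont t d J0 (\<lambda>i. N i \<omega>) (\<lambda>i n. F i n \<omega>) \<partial>P) =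
        (\<integral>\<^sup>+\<omega>. A \<omega> + (\<Sum>i\<in>?I. C i \<omega>) \<partial>P)"
    proof (rule nn_integral_cong_AE)
      have "AE \<omega> in P. \<forall>i\<in>?I. emeasure (count_space UNIV) (simulated_cont (earlier t J0 i) (t i)
          (process_after t J0 (\<lambda>i n. F i n \<omega>) (i - 1)) (\<lambda>n. F i n \<omega>)) = C i \<omega>"
        using sim_cont by (intro AE_ball_countable[THEN iffD2]) auto
      then show "AE \<omega> in P. num_simulated_cont t d J0 (\<lambda>i. N i \<omega>) (\<lambda>i n. F i n \<omega>) = A \<omega> + (\<Sum>i\<in>?I. C i \<omega>)"
        by eventually_elim (simp add: num_simulated_cont_def A_def)
    qed
    also have "\<dots> = (\<integral>\<^sup>+\<omega>. A \<omega> \<partial>P) + (\<Sum>i\<in>?I. \<integral>\<^sup>+\<omega>. C i \<omega> \<partial>P)"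
      by (rule integral_sum) (rule C)
    also have "(\<Sum>i\<in>?I. \<integral>\<^sup>+\<omega>. C i \<omega> \<partial>P) = of_nat (d - card J0)"
      unfolding card[symmetric] using one cont by simp
    finally show ?thesis
      unfolding A by (simp only: add.commute)
  qed
  show ?thesis
    using first second by blast
qed

end
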